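(* Let $A,B$ be commutative rings, $f:A\to B$ a ring homomorphism and $J$ an ideal of $B$ (an $A$-module via $f$). (1) Let $\mathcal A$ be a nonempty class of ideals of $A$ and assume $f$ satisfies the going-down property. If the ring $A\bowtie^fJ$ is Cohen–Macaulay in the sense of $\mathcal A^e:=\{\mathfrak a^e:\mathfrak a\in\mathcal A\}$, then $A$ is Cohen–Macaulay in the sense of $\mathcal A$ and $\operatorname{Kgrade}_A(\mathfrak a,J)\ge\operatorname{ht}\mathfrak a$ for every $\mathfrak a\in\mathcal A$. (2) Assume that $\iota_A:A\to A\bowtie^fJ$ is an integral ring extension. If $A$ is Cohen–Macaulay in the sense of ideals and $\operatorname{Kgrade}_A(\mathfrak a,J)\ge\operatorname{ht}\mathfrak a$ for every ideal $\mathfrak a$ of $A$, then $A\bowtie^fJ$ is Cohen–Macaulay in the sense of ideals.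
   Context: $A\bowtie^fJ=\{(a,f(a)+j): a\in A,\ j\in J\}\subseteq A\times B$; $\iota_A:A\to A\bowtie^fJ$, $\iota_A(x)=(x,f(x))$; $\mathfrak a^e=\iota_A(\mathfrak a)(A\bowtie^fJ)$. Koszul grade: for a ring $R$, an $R$-module $M$ and a finitely generated ideal $\mathfrak b=(x_1,\dots,x_\ell)$, $\operatorname{Kgrade}_R(\mathfrak b,M)=\inf\{i\ge0: H^i(\operatorname{Hom}_R(\mathbb K_\bullet(x_1,\dots,x_\ell),M))\ne0\}$ ($\inf\emptyset=\infty$), independent of generators; for arbitrary $\mathfrak a$, the sup over finitely generated subideals. $\operatorname{ht}I=\inf\{\dim R_\mathfrak P:\mathfrak P\supseteq I$ prime$\}$. For a nonempty class $\mathcal C$ of ideals of $R$, $R$ is Cohen–Macaulay in the sense of $\mathcal C$ if $\operatorname{ht}I=\operatorname{Kgrade}_R(I,R)$ for all $I\in\mathcal C$; "in the sense of ideals" means for the class of all ideals. *)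

theory Defs
  imports "HOL-Algebra.Algebra" "HOL-Library.Extended_Nat"
begin

text \<open>Hom_R(K_i(x_1..x_l), M) is identified with the M-valued functions on the
  i-element subsets of {0..<l} (values 0 elsewhere), since K_i is free on the
  basis e_S, |S| = i.\<close>

definition koszul_cochains :: "('a, 'm) module \<Rightarrow> nat \<Rightarrow> nat \<Rightarrow> (nat set \<Rightarrow> 'm) set" where
  "koszul_cochains M l i =
     {\<phi>. (\<forall>S. S \<subseteq> {..<l} \<and> card S = i \<longrightarrow> \<phi> S \<in> carrier M) \<and>
          (\<forall>S. \<not> (S \<subseteq> {..<l} \<and> card S = i) \<longrightarrow> \<phi> S = \<zero>\<^bsub>M\<^esub>)}"

text \<open>The coboundary Hom(K_i,M) -> Hom(K_(i+1),M), phi |-> phi o d_(i+1), where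
  d(e_T) = sum_k (-1)^(k+1) x_(t_k) e_(T - {t_k}) for T = {t_1 < ... < t_(i+1)}.\<close>

definition koszul_diff :: "'a ring \<Rightarrow> ('a, 'm) module \<Rightarrow> 'a list \<Rightarrow> nat \<Rightarrow> (nat set \<Rightarrow> 'm) \<Rightarrow> (nat set \<Rightarrow> 'm)" where
  "koszul_diff R M xs i \<phi> =
     (\<lambda>T. if T \<subseteq> {..<length xs} \<and> card T = Suc i
          then (\<Oplus>\<^bsub>M\<^esub> t\<in>T. (if even (card {s\<in>T. s < t}) then xs ! t else \<ominus>\<^bsub>R\<^esub> (xs ! t))
                               \<odot>\<^bsub>M\<^esub> \<phi> (T - {t}))
          else \<zero>\<^bsub>M\<^esub>)"

definition koszul_H_nonzero :: "'a ring \<Rightarrow> ('a, 'm) module \<Rightarrow> 'a list \<Rightarrow> nat \<Rightarrow> bool" where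
  "koszul_H_nonzero R M xs i =
     (\<exists>\<phi>\<in>koszul_cochains M (length xs) i.
        koszul_diff R M xs i \<phi> = (\<lambda>_. \<zero>\<^bsub>M\<^esub>) \<and>
        (\<forall>\<psi>\<in>koszul_cochains M (length xs) (i - 1).
           \<phi> \<noteq> (if i = 0 then (\<lambda>_. \<zero>\<^bsub>M\<^esub>) else koszul_diff R M xs (i - 1) \<psi>)))"

definition koszul_grade_list :: "'a ring \<Rightarrow> ('a, 'm) module \<Rightarrow> 'a list \<Rightarrow> enat" where
  "koszul_grade_list R M xs = (INF i\<in>{i. koszul_H_nonzero R M xs i}. enat i)"

definition fin_gen_ideal :: "'a ring \<Rightarrow> 'a set \<Rightarrow> bool" where
  "fin_gen_ideal R b = (\<exists>xs. set xs \<subseteq> carrier R \<and> b = Idl\<^bsub>R\<^esub> (set xs))"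

definition Kgrade_fg :: "'a ring \<Rightarrow> ('a, 'm) module \<Rightarrow> 'a set \<Rightarrow> enat" where
  "Kgrade_fg R M b = koszul_grade_list R M (SOME xs. set xs \<subseteq> carrier R \<and> b = Idl\<^bsub>R\<^esub> (set xs))"

definition Kgrade :: "'a ring \<Rightarrow> ('a, 'm) module \<Rightarrow> 'a set \<Rightarrow> enat" where
  "Kgrade R M I = (SUP b\<in>{b. b \<subseteq> I \<and> fin_gen_ideal R b}. Kgrade_fg R M b)"

text \<open>dim R_P, expressed through chains of primes of R contained in P.\<close>
definition prime_height :: "'a ring \<Rightarrow> 'a set \<Rightarrow> enat" where
  "prime_height R P = (SUP n\<in>{n. \<exists>c :: nat \<Rightarrow> 'a set.
        (\<forall>k\<le>n. primeideal (c k) R) \<and> (\<forall>k<n. c k \<subset> c (Suc k)) \<and> c n = P}. enat n)"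

definition ht :: "'a ring \<Rightarrow> 'a set \<Rightarrow> enat" where
  "ht R I = (INF P\<in>{P. primeideal P R \<and> I \<subseteq> P}. prime_height R P)"

definition ring_module :: "'a ring \<Rightarrow> ('a, 'a) module" where
  "ring_module R = \<lparr>Congruence.partial_object.carrier = carrier R, Group.monoid.mult = monoid.mult R, Group.monoid.one = monoid.one R, Ring.ring.zero = ring.zero R,
                    Ring.ring.add = ring.add R, Module.module.smult = monoid.mult R\<rparr>"

definition module_via :: "'b ring \<Rightarrow> ('a \<Rightarrow> 'b) \<Rightarrow> 'b set \<Rightarrow> ('a, 'b) module" where
  "module_via B f J = \<lparr>Congruence.partial_object.carrier = J, Group.monoid.mult = monoid.mult B, Group.monoid.one = monoid.one B, Ring.ring.zero = ring.zero B,
                       Ring.ring.add = ring.add B, Module.module.smult = (\<lambda>a j. f a \<otimes>\<^bsub>B\<^esub> j)\<rparr>"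

definition CM_sense :: "'a ring \<Rightarrow> 'a set set \<Rightarrow> bool" where
  "CM_sense R \<C> = (\<forall>I\<in>\<C>. ht R I = Kgrade R (ring_module R) I)"

definition all_ideals :: "'a ring \<Rightarrow> 'a set set" where
  "all_ideals R = {I. ideal I R}"

definition amalg :: "'a ring \<Rightarrow> 'b ring \<Rightarrow> ('a \<Rightarrow> 'b) \<Rightarrow> 'b set \<Rightarrow> ('a \<times> 'b) ring" where
  "amalg A B f J = \<lparr>Congruence.partial_object.carrier = {(a, f a \<oplus>\<^bsub>B\<^esub> j) | a j. a \<in> carrier A \<and> j \<in> J},
     Group.monoid.mult = (\<lambda>x y. (fst x \<otimes>\<^bsub>A\<^esub> fst y, snd x \<otimes>\<^bsub>B\<^esub> snd y)),
     Group.monoid.one = (\<one>\<^bsub>A\<^esub>, \<one>\<^bsub>B\<^esub>),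
     Ring.ring.zero = (\<zero>\<^bsub>A\<^esub>, \<zero>\<^bsub>B\<^esub>),
     Ring.ring.add = (\<lambda>x y. (fst x \<oplus>\<^bsub>A\<^esub> fst y, snd x \<oplus>\<^bsub>B\<^esub> snd y))\<rparr>"

definition iota :: "('a \<Rightarrow> 'b) \<Rightarrow> 'a \<Rightarrow> 'a \<times> 'b" where
  "iota f x = (x, f x)"

definition ext_ideal :: "'a ring \<Rightarrow> 'b ring \<Rightarrow> ('a \<Rightarrow> 'b) \<Rightarrow> 'b set \<Rightarrow> 'a set \<Rightarrow> ('a \<times> 'b) set" where
  "ext_ideal A B f J I = Idl\<^bsub>amalg A B f J\<^esub> (iota f ` I)"

definition going_down :: "'a ring \<Rightarrow> 'b ring \<Rightarrow> ('a \<Rightarrow> 'b) \<Rightarrow> bool" where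
  "going_down A B f = (\<forall>p' p q. primeideal p' A \<and> primeideal p A \<and> p' \<subseteq> p \<and>
      primeideal q B \<and> {a\<in>carrier A. f a \<in> q} = p \<longrightarrow>
      (\<exists>q'. primeideal q' B \<and> q' \<subseteq> q \<and> {a\<in>carrier A. f a \<in> q'} = p'))"

definition integral_over :: "'a ring \<Rightarrow> 'c ring \<Rightarrow> ('a \<Rightarrow> 'c) \<Rightarrow> 'c \<Rightarrow> bool" where
  "integral_over A S g x = (\<exists>n c. (\<forall>i<n. c i \<in> carrier A) \<and>
      x [^]\<^bsub>S\<^esub> (n::nat) \<oplus>\<^bsub>S\<^esub> (\<Oplus>\<^bsub>S\<^esub> i\<in>{..<n}. g (c i) \<otimes>\<^bsub>S\<^esub> x [^]\<^bsub>S\<^esub> i) = \<zero>\<^bsub>S\<^esub>)"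

definition integral_extension :: "'a ring \<Rightarrow> 'c ring \<Rightarrow> ('a \<Rightarrow> 'c) \<Rightarrow> bool" where
  "integral_extension A S g = (g \<in> ring_hom A S \<and> inj_on g (carrier A) \<and>
      (\<forall>x\<in>carrier S. integral_over A S g x))"

end

theory Submission
  imports Defs
begin

text \<open>As an \<open>A\<close>-module the amalgamation is \<open>A \<oplus> J\<close>, so the Koszul grade of an extended ideal
  \<open>\<aa>\<^sup>e\<close> is the minimum of the Koszul grades of \<open>\<aa>\<close> on \<open>A\<close> and on \<open>J\<close>. In every commutative ring the
  Koszul grade of an ideal is at most its height. To see this at a prime \<open>p\<close>, induct on the length
  of a sequence in \<open>p\<close>: either the sequence carries a chain of primes of its own length ending in
  \<open>p\<close>, and the top Koszul cohomology bounds the grade by that length; or Kronecker's theorem, which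
  needs no Noetherian hypothesis, yields a sequence with one element less and the same radical at
  \<open>p\<close>, hence the same grade. It remains to compare heights: going-down passes from \<open>f\<close> to \<open>\<iota>\<close> and
  gives \<open>ht \<aa> \<le> ht \<aa>\<^sup>e\<close>, while lying over and incomparability give \<open>ht I \<le> ht (I \<inter> A)\<close> if \<open>\<iota>\<close> is
  integral.\<close>

section \<open>Koszul cohomology up to a multiplicative set\<close>

text \<open>As the reverse inequality always holds, being Cohen-Macaulay means \<open>ht\<close>
  \<le> \<open>Kgrade\<close>. So (1) rests on the chain ht a \<le> ht a^e = Kgrade a^e, and (2) on
  ht I \<le> ht c \<le> Kgrade c^e \<le> Kgrade I for the contraction c of I, whose extension lies
  in I. The obstacle is that ideals need not be finitely generated: grades and heights are suprema
  that may be infinite, and \<open>Kgrade_fg\<close> rests on an arbitrary choice of generators.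
  Everything is therefore phrased as \<open>kacyclic\<close> below a natural number, a statement
  about one explicit sequence, with no cohomology module formed. As localisation is exact, a class
  dies after inverting T exactly if some t in T turns its multiple into a coboundary; such
  denominators replace localised modules. This yields independence of generators, monotonicity in
  the ideal, and the shortening step of the height bound.\<close>

definition ksign :: "('a, 'm, 'r) module_scheme \<Rightarrow> nat \<Rightarrow> 'm \<Rightarrow> 'm" where
  "ksign M c m = (if even c then m else \<ominus>\<^bsub>M\<^esub> m)"

text \<open>Degrees are integers, so that in degree \<open>-1\<close> only the zero cochain exists and degree \<open>0\<close>
  needs no special treatment.\<close>

definition kcochains :: "('a, 'm, 'r) module_scheme \<Rightarrow> nat set \<Rightarrow> int \<Rightarrow> (nat set \<Rightarrow> 'm) set" where
  "kcochains M I i = {\<phi>. (\<forall>S. \<phi> S \<in> carrier M) \<and>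
     (\<forall>S. \<not> (S \<subseteq> I \<and> int (card S) = i) \<longrightarrow> \<phi> S = \<zero>\<^bsub>M\<^esub>)}"

definition kdiff :: "('a, 'm, 'r) module_scheme \<Rightarrow> (nat \<Rightarrow> 'a) \<Rightarrow> nat set \<Rightarrow> (nat set \<Rightarrow> 'm) \<Rightarrow> (nat set \<Rightarrow> 'm)" where
  "kdiff M x I \<phi> = (\<lambda>T. if T \<subseteq> I
     then (\<Oplus>\<^bsub>M\<^esub> t\<in>T. ksign M (card {s\<in>T. s < t}) (x t \<odot>\<^bsub>M\<^esub> \<phi> (T - {t})))
     else \<zero>\<^bsub>M\<^esub>)"

text \<open>Vanishing of the Koszul cohomology in degrees below \<open>n\<close> after inverting \<open>T\<close>: \<open>T = {1}\<close> gives
  the Koszul grade, \<open>T = R - p\<close> the Koszul grade at a prime \<open>p\<close> without forming \<open>R\<^sub>p\<close>.\<close>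

definition kacyclic :: "('a, 'm, 'r) module_scheme \<Rightarrow> 'a set \<Rightarrow> (nat \<Rightarrow> 'a) \<Rightarrow> nat set \<Rightarrow> nat \<Rightarrow> bool" where
  "kacyclic M T x I n \<longleftrightarrow> (\<forall>i<int n. \<forall>\<phi>\<in>kcochains M I i. kdiff M x I \<phi> = (\<lambda>_. \<zero>\<^bsub>M\<^esub>) \<longrightarrow>
     (\<exists>t\<in>T. \<exists>\<psi>\<in>kcochains M I (i - 1). (\<lambda>S. t \<odot>\<^bsub>M\<^esub> \<phi> S) = kdiff M x I \<psi>))"

text \<open>The sign makes the differential below independent of the position of \<open>k\<close> in the index set.\<close>

definition kglue :: "('a, 'm, 'r) module_scheme \<Rightarrow> nat \<Rightarrow> (nat set \<Rightarrow> 'm) \<Rightarrow> (nat set \<Rightarrow> 'm) \<Rightarrow> (nat set \<Rightarrow> 'm)" where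
  "kglue M k \<phi>0 \<phi>1 = (\<lambda>S. if k \<in> S
     then ksign M (card {s\<in>S. s < k}) (\<phi>1 (S - {k})) else \<phi>0 S)"

lemma kcochainsI:
  assumes "\<And>S. \<phi> S \<in> carrier M"
    and "\<And>S. \<not> (S \<subseteq> I \<and> int (card S) = i) \<Longrightarrow> \<phi> S = \<zero>\<^bsub>M\<^esub>"
  shows "\<phi> \<in> kcochains M I i"
  using assms by (auto simp: kcochains_def)

lemma kcochains_closed: "\<phi> \<in> kcochains M I i \<Longrightarrow> \<phi> S \<in> carrier M"
  by (auto simp: kcochains_def)

lemma kcochains_zero:
  "\<phi> \<in> kcochains M I i \<Longrightarrow> \<not> (S \<subseteq> I \<and> int (card S) = i) \<Longrightarrow> \<phi> S = \<zero>\<^bsub>M\<^esub>"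
  by (auto simp: kcochains_def)

section \<open>Additive maps and the Koszul differential\<close>

lemma (in abelian_group) additive_map_zero:
  assumes N: "abelian_group N"
    and hc: "\<And>m. m \<in> carrier G \<Longrightarrow> h m \<in> carrier N"
    and ha: "\<And>m m'. m \<in> carrier G \<Longrightarrow> m' \<in> carrier G \<Longrightarrow> h (m \<oplus> m') = h m \<oplus>\<^bsub>N\<^esub> h m'"
  shows "h \<zero> = \<zero>\<^bsub>N\<^esub>"
proof -
  interpret N: abelian_group N by fact
  have "h \<zero> \<oplus>\<^bsub>N\<^esub> h \<zero> = h \<zero>" using ha[of \<zero> \<zero>] by simp
  then show ?thesis using hc[of \<zero>] by (metis N.add.r_cancel_one' zero_closed)
qed

lemma (in abelian_group) additive_map_minus:
  assumes N: "abelian_group N"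
    and hc: "\<And>m. m \<in> carrier G \<Longrightarrow> h m \<in> carrier N"
    and ha: "\<And>m m'. m \<in> carrier G \<Longrightarrow> m' \<in> carrier G \<Longrightarrow> h (m \<oplus> m') = h m \<oplus>\<^bsub>N\<^esub> h m'"
    and m: "m \<in> carrier G"
  shows "h (\<ominus> m) = \<ominus>\<^bsub>N\<^esub> h m"
proof -
  interpret N: abelian_group N by fact
  have "h (\<ominus> m) \<oplus>\<^bsub>N\<^esub> h m = \<zero>\<^bsub>N\<^esub>"
    using ha[of "\<ominus> m" m] additive_map_zero[OF N hc ha] m by (simp add: l_neg)
  then show ?thesis using hc m by (metis N.minus_equality a_inv_closed)
qed

lemma (in abelian_group) additive_map_finsum:
  assumes N: "abelian_group N"
    and hc: "\<And>m. m \<in> carrier G \<Longrightarrow> h m \<in> carrier N"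
    and ha: "\<And>m m'. m \<in> carrier G \<Longrightarrow> m' \<in> carrier G \<Longrightarrow> h (m \<oplus> m') = h m \<oplus>\<^bsub>N\<^esub> h m'"
    and fin: "finite A" and g: "g \<in> A \<rightarrow> carrier G"
  shows "h (finsum G g A) = (\<Oplus>\<^bsub>N\<^esub> a\<in>A. h (g a))"
proof -
  interpret N: abelian_group N by fact
  show ?thesis using fin g
  proof (induction A rule: finite_induct)
    case empty
    then show ?case using additive_map_zero[OF N hc ha] by simp
  next
    case (insert a A)
    have "h (finsum G g (insert a A)) = h (g a \<oplus> finsum G g A)"
      using insert by (subst finsum_insert) auto
    also have "\<dots> = h (g a) \<oplus>\<^bsub>N\<^esub> h (finsum G g A)" using insert by (intro ha finsum_closed) auto
    also have "\<dots> = (\<Oplus>\<^bsub>N\<^esub> a\<in>insert a A. h (g a))"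
      using insert hc by (subst N.finsum_insert) auto
    finally show ?case .
  qed
qed

text \<open>\<open>ksign\<close> puts the signs on module elements rather than on scalars, so an
  additive map commutes with them and no ring of scalars has to be mentioned. Multiplication by a
  ring element and module homomorphisms are both instances.\<close>

lemma kdiff_map:
  assumes M: "abelian_group M" and N: "abelian_group N" and fin: "finite I"
    and hc: "\<And>m. m \<in> carrier M \<Longrightarrow> h m \<in> carrier N"
    and ha: "\<And>m m'. m \<in> carrier M \<Longrightarrow> m' \<in> carrier M \<Longrightarrow> h (m \<oplus>\<^bsub>M\<^esub> m') = h m \<oplus>\<^bsub>N\<^esub> h m'"
    and xc: "\<And>t m. t \<in> I \<Longrightarrow> m \<in> carrier M \<Longrightarrow> x t \<odot>\<^bsub>M\<^esub> m \<in> carrier M"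
    and hs: "\<And>t m. t \<in> I \<Longrightarrow> m \<in> carrier M \<Longrightarrow> h (x t \<odot>\<^bsub>M\<^esub> m) = y t \<odot>\<^bsub>N\<^esub> h m"
    and \<phi>: "\<And>S. \<phi> S \<in> carrier M"
  shows "(\<lambda>T. h (kdiff M x I \<phi> T)) = kdiff N y I (\<lambda>S. h (\<phi> S))"
proof
  fix T
  interpret M: abelian_group M by fact
  interpret N: abelian_group N by fact
  show "h (kdiff M x I \<phi> T) = kdiff N y I (\<lambda>S. h (\<phi> S)) T"
  proof (cases "T \<subseteq> I")
    case True
    have cl: "ksign M c (x t \<odot>\<^bsub>M\<^esub> \<phi> S) \<in> carrier M" if "t \<in> T" for t S c
      using that True xc \<phi> by (auto simp: ksign_def)
    have eq: "h (ksign M c (x t \<odot>\<^bsub>M\<^esub> \<phi> S)) = ksign N c (y t \<odot>\<^bsub>N\<^esub> h (\<phi> S))" if "t \<in> T" for t S c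
      using that True xc \<phi> hs M.additive_map_minus[OF N hc ha] by (auto simp: ksign_def subset_eq)
    have "h (kdiff M x I \<phi> T) = (\<Oplus>\<^bsub>N\<^esub> t\<in>T. h (ksign M (card {s\<in>T. s < t}) (x t \<odot>\<^bsub>M\<^esub> \<phi> (T - {t}))))"
      unfolding kdiff_def using True fin cl
      by (simp add: M.additive_map_finsum[OF N hc ha finite_subset])
    also have "\<dots> = kdiff N y I (\<lambda>S. h (\<phi> S)) T"
      unfolding kdiff_def using True cl hc by (auto simp flip: eq intro!: N.finsum_cong')
    finally show ?thesis .
  next
    case False
    then show ?thesis using M.additive_map_zero[OF N hc ha] by (simp add: kdiff_def)
  qed
qed

section \<open>Koszul cochains and the mapping cone\<close>

context module begin

lemma minus_zero_module [simp]: "\<ominus>\<^bsub>M\<^esub> \<zero>\<^bsub>M\<^esub> = \<zero>\<^bsub>M\<^esub>"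
  using M.minus_equality M.l_zero M.zero_closed by blast

lemma ksign_closed [simp]: "m \<in> carrier M \<Longrightarrow> ksign M c m \<in> carrier M"
  by (simp add: ksign_def)

lemma ksign_zero [simp]: "ksign M c \<zero>\<^bsub>M\<^esub> = \<zero>\<^bsub>M\<^esub>"
  by (simp add: ksign_def)

lemma ksign_ksign [simp]: "m \<in> carrier M \<Longrightarrow> ksign M c (ksign M c m) = m"
  by (simp add: ksign_def)

lemma ksign_smult:
  "a \<in> carrier R \<Longrightarrow> m \<in> carrier M \<Longrightarrow> a \<odot>\<^bsub>M\<^esub> ksign M c m = ksign M c (a \<odot>\<^bsub>M\<^esub> m)"
  by (simp add: ksign_def smult_r_minus)

lemma ksign_add:
  "m \<in> carrier M \<Longrightarrow> m' \<in> carrier M \<Longrightarrow> ksign M c (m \<oplus>\<^bsub>M\<^esub> m') = ksign M c m \<oplus>\<^bsub>M\<^esub> ksign M c m'"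
  by (simp add: ksign_def M.minus_add M.a_comm)

lemma kdiff_closed:
  assumes "x ` I \<subseteq> carrier R" "\<And>S. \<phi> S \<in> carrier M"
  shows "kdiff M x I \<phi> S \<in> carrier M"
  using assms by (auto simp: kdiff_def image_subset_iff intro!: M.finsum_closed ksign_closed smult_closed)

lemma kdiff_kcochains:
  assumes "x ` I \<subseteq> carrier R" "finite I" "\<phi> \<in> kcochains M I i"
  shows "kdiff M x I \<phi> \<in> kcochains M I (i + 1)"
proof (rule kcochainsI)
  show "kdiff M x I \<phi> S \<in> carrier M" for S
    using assms kcochains_closed by (intro kdiff_closed) auto
  show "kdiff M x I \<phi> S = \<zero>\<^bsub>M\<^esub>" if *: "\<not> (S \<subseteq> I \<and> int (card S) = i + 1)" for S
  proof (cases "S \<subseteq> I")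
    case True
    then have fS: "finite S" using assms finite_subset by auto
    have z: "\<phi> (S - {t}) = \<zero>\<^bsub>M\<^esub>" if "t \<in> S" for t
    proof (rule kcochains_zero[OF assms(3)])
      have "card S = Suc (card (S - {t}))" using fS that by (rule card.remove)
      then show "\<not> (S - {t} \<subseteq> I \<and> int (card (S - {t})) = i)" using * True by auto
    qed
    have "(\<Oplus>\<^bsub>M\<^esub>t\<in>S. ksign M (card {s \<in> S. s < t}) (x t \<odot>\<^bsub>M\<^esub> \<phi> (S - {t}))) = (\<Oplus>\<^bsub>M\<^esub>t\<in>S. \<zero>\<^bsub>M\<^esub>)"
      using z True assms(1) by (intro M.finsum_cong') (auto simp: image_subset_iff subset_eq)
    then show ?thesis using True by (simp add: kdiff_def)
  qed (simp add: kdiff_def)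
qed

lemma kdiff_smult:
  assumes "x ` I \<subseteq> carrier R" "finite I" "\<And>S. \<phi> S \<in> carrier M" "a \<in> carrier R"
  shows "kdiff M x I (\<lambda>S. a \<odot>\<^bsub>M\<^esub> \<phi> S) = (\<lambda>S. a \<odot>\<^bsub>M\<^esub> kdiff M x I \<phi> S)"
proof (rule kdiff_map[where x = x and y = x and M = M and N = M, symmetric])
  fix t m assume "t \<in> I" "m \<in> carrier M"
  moreover from this have "x t \<in> carrier R" using assms(1) by auto
  ultimately show "a \<odot>\<^bsub>M\<^esub> (x t \<odot>\<^bsub>M\<^esub> m) = x t \<odot>\<^bsub>M\<^esub> (a \<odot>\<^bsub>M\<^esub> m)"
    using assms(4) by (simp add: m_comm flip: smult_assoc1)
qed (use assms in \<open>auto simp: smult_r_distr image_subset_iff M.abelian_group_axioms intro: smult_closed\<close>)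

lemma kdiff_add:
  assumes "x ` I \<subseteq> carrier R" "\<And>S. \<phi> S \<in> carrier M" "\<And>S. \<psi> S \<in> carrier M"
  shows "kdiff M x I (\<lambda>S. \<phi> S \<oplus>\<^bsub>M\<^esub> \<psi> S) = (\<lambda>S. kdiff M x I \<phi> S \<oplus>\<^bsub>M\<^esub> kdiff M x I \<psi> S)"
proof
  fix T
  show "kdiff M x I (\<lambda>S. \<phi> S \<oplus>\<^bsub>M\<^esub> \<psi> S) T = kdiff M x I \<phi> T \<oplus>\<^bsub>M\<^esub> kdiff M x I \<psi> T"
  proof (cases "T \<subseteq> I")
    case True
    let ?g = "\<lambda>\<phi> t. ksign M (card {s\<in>T. s < t}) (x t \<odot>\<^bsub>M\<^esub> \<phi> (T - {t}))"
    have xc: "x t \<in> carrier R" if "t \<in> T" for t using that True assms(1) by auto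
    have "(\<Oplus>\<^bsub>M\<^esub> t\<in>T. ?g (\<lambda>S. \<phi> S \<oplus>\<^bsub>M\<^esub> \<psi> S) t) = (\<Oplus>\<^bsub>M\<^esub> t\<in>T. ?g \<phi> t \<oplus>\<^bsub>M\<^esub> ?g \<psi> t)"
      using assms xc by (intro M.finsum_cong') (auto simp: smult_r_distr ksign_add)
    also have "\<dots> = (\<Oplus>\<^bsub>M\<^esub> t\<in>T. ?g \<phi> t) \<oplus>\<^bsub>M\<^esub> (\<Oplus>\<^bsub>M\<^esub> t\<in>T. ?g \<psi> t)"
      using assms xc by (intro M.finsum_addf) auto
    finally show ?thesis using True by (simp add: kdiff_def)
  qed (simp add: kdiff_def)
qed

lemma kdiff_zero:
  assumes "x ` I \<subseteq> carrier R"
  shows "kdiff M x I (\<lambda>_. \<zero>\<^bsub>M\<^esub>) = (\<lambda>_. \<zero>\<^bsub>M\<^esub>)"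
proof -
  have "(\<Oplus>\<^bsub>M\<^esub> t\<in>T. ksign M (card {s\<in>T. s < t}) (x t \<odot>\<^bsub>M\<^esub> \<zero>\<^bsub>M\<^esub>)) = (\<Oplus>\<^bsub>M\<^esub> t\<in>T. \<zero>\<^bsub>M\<^esub>)"
    if "T \<subseteq> I" for T
    using that assms by (intro M.finsum_cong') (auto simp: image_subset_iff subset_eq)
  then show ?thesis by (auto simp: kdiff_def)
qed

lemma kcochains_zeroI [simp]: "(\<lambda>_. \<zero>\<^bsub>M\<^esub>) \<in> kcochains M I i"
  by (auto intro: kcochainsI)

lemma kcochains_smult:
  "a \<in> carrier R \<Longrightarrow> \<phi> \<in> kcochains M I i \<Longrightarrow> (\<lambda>S. a \<odot>\<^bsub>M\<^esub> \<phi> S) \<in> kcochains M I i"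
  by (rule kcochainsI) (simp_all add: kcochains_closed kcochains_zero)

lemma kcochains_add:
  "\<phi> \<in> kcochains M I i \<Longrightarrow> \<psi> \<in> kcochains M I i \<Longrightarrow> (\<lambda>S. \<phi> S \<oplus>\<^bsub>M\<^esub> \<psi> S) \<in> kcochains M I i"
  by (rule kcochainsI) (simp_all add: kcochains_closed kcochains_zero)

lemma kcochains_glue:
  assumes "\<phi>0 \<in> kcochains M I i" "\<phi>1 \<in> kcochains M I (i - 1)" "finite I" "k \<notin> I"
  shows "kglue M k \<phi>0 \<phi>1 \<in> kcochains M (insert k I) i"
proof (rule kcochainsI)
  show "kglue M k \<phi>0 \<phi>1 S \<in> carrier M" for S
    using kcochains_closed[OF assms(1)] kcochains_closed[OF assms(2)] by (simp add: kglue_def)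
  show "kglue M k \<phi>0 \<phi>1 S = \<zero>\<^bsub>M\<^esub>" if *: "\<not> (S \<subseteq> insert k I \<and> int (card S) = i)" for S
  proof (cases "k \<in> S")
    case True
    have "\<not> (S - {k} \<subseteq> I \<and> int (card (S - {k})) = i - 1)"
    proof
      assume a: "S - {k} \<subseteq> I \<and> int (card (S - {k})) = i - 1"
      then have "finite S" using assms by (metis finite_Diff2 finite_subset finite.emptyI finite_insert)
      then have "card S = Suc (card (S - {k}))" using True by (rule card.remove)
      then show False using a * by auto
    qed
    then show ?thesis using True kcochains_zero[OF assms(2)] by (simp add: kglue_def)
  next
    case False
    then show ?thesis using * kcochains_zero[OF assms(1), of S] by (auto simp: kglue_def)
  qed
qed

lemma kcochains_glueE:
  assumes "\<phi> \<in> kcochains M (insert k I) i" "finite I" "k \<notin> I"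
  obtains \<phi>0 \<phi>1 where "\<phi>0 \<in> kcochains M I i" "\<phi>1 \<in> kcochains M I (i - 1)" "\<phi> = kglue M k \<phi>0 \<phi>1"
proof
  let ?\<phi>0 = "\<lambda>S. if k \<in> S then \<zero>\<^bsub>M\<^esub> else \<phi> S"
  \<comment> \<open>The sign in \<open>kglue\<close> is its own inverse, so the same sign recovers
    the second component. Both components are 0 on sets containing \<open>k\<close>, as cochains on
    \<open>I\<close> have to be.\<close>
  let ?\<phi>1 = "\<lambda>S. if k \<in> S then \<zero>\<^bsub>M\<^esub> else ksign M (card {s\<in>S. s < k}) (\<phi> (insert k S))"
  note c = kcochains_closed[OF assms(1)] and z = kcochains_zero[OF assms(1)]
  show "?\<phi>0 \<in> kcochains M I i"
    by (rule kcochainsI) (auto simp: c intro!: z)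
  show "?\<phi>1 \<in> kcochains M I (i - 1)"
  proof (rule kcochainsI)
    fix S assume *: "\<not> (S \<subseteq> I \<and> int (card S) = i - 1)"
    have "\<phi> (insert k S) = \<zero>\<^bsub>M\<^esub>" if "k \<notin> S"
    proof (rule z)
      show "\<not> (insert k S \<subseteq> insert k I \<and> int (card (insert k S)) = i)"
      proof
        assume a: "insert k S \<subseteq> insert k I \<and> int (card (insert k S)) = i"
        then have "S \<subseteq> I" "finite S" using that assms(2) by (auto intro: finite_subset)
        then show False using a * that by auto
      qed
    qed
    then show "?\<phi>1 S = \<zero>\<^bsub>M\<^esub>" by simp
  qed (simp add: c)
  show "\<phi> = kglue M k ?\<phi>0 ?\<phi>1"
  proof
    fix S
    have "{s \<in> S - {k}. s < k} = {s \<in> S. s < k}" by auto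
    then show "\<phi> S = kglue M k ?\<phi>0 ?\<phi>1 S"
      by (simp add: kglue_def c insert_absorb)
  qed
qed

text \<open>The values on sets without \<open>k\<close> give the first component, those on sets with
  \<open>k\<close> give the second up to a sign; everywhere else both vanish because
  \<open>k\<close> is not in \<open>I\<close>. Equations in the cone can thus be split into
  components.\<close>

lemma kglue_eqD:
  assumes "kglue M k \<phi>0 \<phi>1 = kglue M k \<psi>0 \<psi>1" "k \<notin> I"
    and "\<phi>0 \<in> kcochains M I i" "\<psi>0 \<in> kcochains M I i"
    and "\<phi>1 \<in> kcochains M I j" "\<psi>1 \<in> kcochains M I j"
  shows "\<phi>0 = \<psi>0" "\<phi>1 = \<psi>1"
proof -
  have z: "\<phi> S = \<zero>\<^bsub>M\<^esub>" if "k \<in> S" "\<phi> \<in> kcochains M I j" for \<phi> j S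
    using that assms(2) kcochains_zero[OF that(2)] by auto
  show "\<phi>0 = \<psi>0"
  proof
    fix S
    show "\<phi>0 S = \<psi>0 S"
      using fun_cong[OF assms(1), of S] z[OF _ assms(3), of S] z[OF _ assms(4), of S]
      by (cases "k \<in> S") (simp_all add: kglue_def)
  qed
  show "\<phi>1 = \<psi>1"
  proof
    fix S
    show "\<phi>1 S = \<psi>1 S"
    proof (cases "k \<in> S")
      case True
      then show ?thesis using z[OF _ assms(5)] z[OF _ assms(6)] by simp
    next
      case False
      let ?c = "card {s \<in> insert k S. s < k}"
      have "ksign M ?c (\<phi>1 S) = ksign M ?c (\<psi>1 S)"
        using fun_cong[OF assms(1), of "insert k S"] False by (simp add: kglue_def)
      then show ?thesis
        using ksign_ksign kcochains_closed[OF assms(5)] kcochains_closed[OF assms(6)] by metis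
    qed
  qed
qed

text \<open>The Koszul complex on one more element is the mapping cone of multiplication by it.\<close>

lemma kdiff_glue:
  assumes "x ` insert k I \<subseteq> carrier R" "finite I" "k \<notin> I"
    and \<phi>0: "\<phi>0 \<in> kcochains M I i" and \<phi>1: "\<phi>1 \<in> kcochains M I j"
  shows "kdiff M x (insert k I) (kglue M k \<phi>0 \<phi>1) =
    kglue M k (kdiff M x I \<phi>0) (\<lambda>S. x k \<odot>\<^bsub>M\<^esub> \<phi>0 S \<oplus>\<^bsub>M\<^esub> \<ominus>\<^bsub>M\<^esub> kdiff M x I \<phi>1 S)"
    (is "?L = ?R")
proof
  fix T
  note c0 = kcochains_closed[OF \<phi>0] and c1 = kcochains_closed[OF \<phi>1]
  have xc: "x t \<in> carrier R" if "t \<in> insert k I" for t using that assms(1) by auto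
  consider "\<not> T \<subseteq> insert k I" | "T \<subseteq> I" | U where "T = insert k U" "U \<subseteq> I" "k \<notin> U"
  proof (cases "T \<subseteq> insert k I \<and> k \<in> T")
    case True
    then have "T = insert k (T - {k})" "T - {k} \<subseteq> I" "k \<notin> T - {k}" by auto
    then show ?thesis using that(3) by blast
  qed (use that in blast)
  then show "?L T = ?R T"
  proof cases
    case 1
    have "\<phi>0 T = \<zero>\<^bsub>M\<^esub>" "\<phi>0 (T - {k}) = \<zero>\<^bsub>M\<^esub>"
      using 1 kcochains_zero[OF \<phi>0, of T] kcochains_zero[OF \<phi>0, of "T - {k}"] by auto
    moreover have "\<not> T \<subseteq> I" "\<not> T - {k} \<subseteq> I" using 1 by auto
    ultimately show ?thesis using 1 xc by (simp add: kdiff_def kglue_def ksign_def)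
  next
    case 2
    then have "k \<notin> T" using assms(3) by auto
    then show ?thesis using 2 by (auto simp: kdiff_def kglue_def)
  next
    case (3 U)
    let ?c = "card {s\<in>U. s < k}"
    have fU: "finite U" using 3 assms finite_subset by auto
    let ?g = "\<lambda>t. ksign M (card {s\<in>T. s < t}) (x t \<odot>\<^bsub>M\<^esub> kglue M k \<phi>0 \<phi>1 (T - {t}))"
    let ?h = "\<lambda>t. ksign M (card {s\<in>U. s < t}) (x t \<odot>\<^bsub>M\<^esub> \<phi>1 (U - {t}))"
    have Tk: "{s \<in> T. s < k} = {s \<in> U. s < k}" using 3 by auto
    have gk: "?g k = ksign M ?c (x k \<odot>\<^bsub>M\<^esub> \<phi>0 U)"
      using 3 Tk by (simp add: kglue_def)
    have h_closed: "?h t \<in> carrier M" if "t \<in> U" for t using that 3 xc c1 by auto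
    have g: "?g t = ksign M ?c (\<ominus>\<^bsub>M\<^esub> ?h t)" if t: "t \<in> U" for t
    proof -
      have tk: "t \<noteq> k" using t 3 by auto
      have e1: "T - {t} = insert k (U - {t})" "T - {t} - {k} = U - {t}" using 3 tk by auto
      have e2: "{s \<in> T - {t}. s < k} = {s \<in> U. s < k} - {t}" using 3 by auto
      \<comment> \<open>Adding \<open>k\<close> to \<open>U\<close> shifts the position of
        \<open>t\<close> exactly if \<open>k < t\<close>, and deleting \<open>t\<close> shifts the
        position of \<open>k\<close> exactly if \<open>t < k\<close>. Since one and only one of
        these happens, the two parities together produce the minus sign in front of the differential
        of \<open>\<phi>1\<close>.\<close>
      have p1: "even (card {s \<in> T. s < t}) = (even (card {s\<in>U. s < t}) \<longleftrightarrow> \<not> k < t)"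
      proof (cases "k < t")
        case True
        have "{s \<in> T. s < t} = insert k {s\<in>U. s < t}" using 3 True by auto
        then show ?thesis using True 3 fU by auto
      next
        case False
        then have "{s \<in> T. s < t} = {s\<in>U. s < t}" using 3 by auto
        then show ?thesis using False by auto
      qed
      have p2: "even (card ({s \<in> U. s < k} - {t})) = (even ?c \<longleftrightarrow> \<not> t < k)"
      proof (cases "t < k")
        case True
        then have "card {s \<in> U. s < k} = Suc (card ({s \<in> U. s < k} - {t}))"
          using t fU by (intro card.remove) auto
        then show ?thesis using True by simp
      qed simp
      have xct: "x t \<in> carrier R" using xc t 3 by auto
      have "?g t = ksign M (card {s\<in>T. s < t})
          (ksign M (card ({s \<in> U. s < k} - {t})) (x t \<odot>\<^bsub>M\<^esub> \<phi>1 (U - {t})))"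
        using xct c1 unfolding kglue_def e2 e1(2) by (simp add: e1(1) ksign_smult)
      also have "\<dots> = ksign M ?c (\<ominus>\<^bsub>M\<^esub> ?h t)"
        using p1 p2 tk smult_closed[OF xct c1, of "U - {t}"]
        by (cases "even (card {s\<in>U. s < t})"; cases "even ?c"; cases "k < t"; simp add: ksign_def)
      finally show ?thesis .
    qed
    have neg: "ksign M ?c (\<ominus>\<^bsub>M\<^esub> finsum M ?h U) = (\<Oplus>\<^bsub>M\<^esub> t\<in>U. ksign M ?c (\<ominus>\<^bsub>M\<^esub> ?h t))"
      using fU h_closed
      by (intro M.additive_map_finsum[OF M.abelian_group_axioms, where h = "\<lambda>m. ksign M ?c (\<ominus>\<^bsub>M\<^esub> m)"])
        (auto simp: M.minus_add ksign_add)
    have "?L T = finsum M ?g (insert k U)"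
      using 3 by (auto simp: kdiff_def)
    also have "\<dots> = ?g k \<oplus>\<^bsub>M\<^esub> finsum M ?g U"
      using 3(3) fU g h_closed gk c0 xc by (intro M.finsum_insert) simp_all
    also have "finsum M ?g U = (\<Oplus>\<^bsub>M\<^esub> t\<in>U. ksign M ?c (\<ominus>\<^bsub>M\<^esub> ?h t))"
      using g h_closed by (intro M.finsum_cong') simp_all
    also have "\<dots> = ksign M ?c (\<ominus>\<^bsub>M\<^esub> finsum M ?h U)" using neg by simp
    also have "?g k \<oplus>\<^bsub>M\<^esub> \<dots> = ksign M ?c (x k \<odot>\<^bsub>M\<^esub> \<phi>0 U \<oplus>\<^bsub>M\<^esub> \<ominus>\<^bsub>M\<^esub> finsum M ?h U)"
      using h_closed unfolding gk by (subst ksign_add) (simp_all add: xc c0 M.finsum_closed)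
    also have "\<dots> = ?R T" using 3 Tk by (simp add: kglue_def kdiff_def)
    finally show ?thesis .
  qed
qed

end

section \<open>Adding and dropping entries of a sequence\<close>

definition mult_set :: "('a, 'r) ring_scheme \<Rightarrow> 'a set \<Rightarrow> bool" where
  "mult_set R T \<longleftrightarrow> T \<subseteq> carrier R \<and> \<one>\<^bsub>R\<^esub> \<in> T \<and> (\<forall>s\<in>T. \<forall>t\<in>T. s \<otimes>\<^bsub>R\<^esub> t \<in> T)"

lemma kacyclicE:
  assumes "kacyclic M T x I n" "i < int n" "\<phi> \<in> kcochains M I i" "kdiff M x I \<phi> = (\<lambda>_. \<zero>\<^bsub>M\<^esub>)"
  obtains t \<psi> where "t \<in> T" "\<psi> \<in> kcochains M I (i - 1)" "(\<lambda>S. t \<odot>\<^bsub>M\<^esub> \<phi> S) = kdiff M x I \<psi>"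
  using assms unfolding kacyclic_def by blast

context module begin

lemma kglue_zero: "kglue M k (\<lambda>_. \<zero>\<^bsub>M\<^esub>) (\<lambda>_. \<zero>\<^bsub>M\<^esub>) = (\<lambda>_. \<zero>\<^bsub>M\<^esub>)"
  by (auto simp: kglue_def)

lemma kglue_smult:
  assumes "a \<in> carrier R" "\<And>S. \<phi>1 S \<in> carrier M"
  shows "(\<lambda>S. a \<odot>\<^bsub>M\<^esub> kglue M k \<phi>0 \<phi>1 S) = kglue M k (\<lambda>S. a \<odot>\<^bsub>M\<^esub> \<phi>0 S) (\<lambda>S. a \<odot>\<^bsub>M\<^esub> \<phi>1 S)"
  using assms by (auto simp: kglue_def ksign_smult)

lemma kcochains_minus:
  "\<phi> \<in> kcochains M I i \<Longrightarrow> (\<lambda>S. \<ominus>\<^bsub>M\<^esub> \<phi> S) \<in> kcochains M I i"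
  by (rule kcochainsI) (simp_all add: kcochains_closed kcochains_zero)

lemma kdiff_minus:
  assumes "x ` I \<subseteq> carrier R" "finite I" "\<And>S. \<phi> S \<in> carrier M"
  shows "kdiff M x I (\<lambda>S. \<ominus>\<^bsub>M\<^esub> \<phi> S) = (\<lambda>S. \<ominus>\<^bsub>M\<^esub> kdiff M x I \<phi> S)"
proof -
  have m: "\<ominus>\<^bsub>M\<^esub> m = (\<ominus> \<one>) \<odot>\<^bsub>M\<^esub> m" if "m \<in> carrier M" for m
    using that by (simp add: smult_l_minus)
  show ?thesis
    using kdiff_smult[OF assms(1,2), of \<phi> "\<ominus> \<one>"] assms(3) kdiff_closed[OF assms(1)]
    by (simp add: m)
qed

lemma kdiff_glue_eq_iff:
  assumes "x ` insert k I \<subseteq> carrier R" "finite I" "k \<notin> I"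
    and \<psi>: "\<psi>0 \<in> kcochains M I i" "\<psi>1 \<in> kcochains M I (i - 1)"
    and \<phi>: "\<phi>0 \<in> kcochains M I (i + 1)" "\<phi>1 \<in> kcochains M I i"
  shows "kdiff M x (insert k I) (kglue M k \<psi>0 \<psi>1) = kglue M k \<phi>0 \<phi>1 \<longleftrightarrow>
    kdiff M x I \<psi>0 = \<phi>0 \<and> (\<lambda>S. x k \<odot>\<^bsub>M\<^esub> \<psi>0 S \<oplus>\<^bsub>M\<^esub> \<ominus>\<^bsub>M\<^esub> kdiff M x I \<psi>1 S) = \<phi>1"
proof -
  have xI: "x ` I \<subseteq> carrier R" "x k \<in> carrier R" using assms(1) by auto
  have c0: "kdiff M x I \<psi>0 \<in> kcochains M I (i + 1)" using xI assms(2) \<psi>(1) by (intro kdiff_kcochains)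
  have c1: "(\<lambda>S. x k \<odot>\<^bsub>M\<^esub> \<psi>0 S \<oplus>\<^bsub>M\<^esub> \<ominus>\<^bsub>M\<^esub> kdiff M x I \<psi>1 S) \<in> kcochains M I i"
    using xI assms(2) \<psi> kdiff_kcochains[OF xI(1) assms(2) \<psi>(2)]
    by (intro kcochains_add kcochains_minus kcochains_smult) auto
  show ?thesis
    unfolding kdiff_glue[OF assms(1-3) \<psi>]
    using kglue_eqD[OF _ assms(3) c0 \<phi>(1) c1 \<phi>(2)] by blast
qed

lemma kcocycle_glue_iff:
  assumes "x ` insert k I \<subseteq> carrier R" "finite I" "k \<notin> I"
    and \<psi>: "\<psi>0 \<in> kcochains M I i" "\<psi>1 \<in> kcochains M I (i - 1)"
  shows "kdiff M x (insert k I) (kglue M k \<psi>0 \<psi>1) = (\<lambda>_. \<zero>\<^bsub>M\<^esub>) \<longleftrightarrow>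
    kdiff M x I \<psi>0 = (\<lambda>_. \<zero>\<^bsub>M\<^esub>) \<and> (\<lambda>S. x k \<odot>\<^bsub>M\<^esub> \<psi>0 S) = kdiff M x I \<psi>1"
proof -
  have xI: "x ` I \<subseteq> carrier R" "x k \<in> carrier R" using assms(1) by auto
  have "x k \<odot>\<^bsub>M\<^esub> \<psi>0 S \<oplus>\<^bsub>M\<^esub> \<ominus>\<^bsub>M\<^esub> kdiff M x I \<psi>1 S = \<zero>\<^bsub>M\<^esub> \<longleftrightarrow> x k \<odot>\<^bsub>M\<^esub> \<psi>0 S = kdiff M x I \<psi>1 S" for S
    using kdiff_closed[OF xI(1)] kcochains_closed[OF \<psi>(1)] kcochains_closed[OF \<psi>(2)] xI(2)
    by (metis M.a_inv_closed M.minus_equality M.minus_minus M.r_neg smult_closed)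
  then show ?thesis
    using kdiff_glue_eq_iff[OF assms, of "\<lambda>_. \<zero>\<^bsub>M\<^esub>" "\<lambda>_. \<zero>\<^bsub>M\<^esub>"] by (simp add: kglue_zero fun_eq_iff)
qed

text \<open>This is the long exact sequence of the cone, carried out on cocycles with denominators:
  \<open>t\<close> kills the first component, a correction of the second component is a cocycle one
  degree lower, and \<open>t'\<close> kills that. Their product kills the class in the cone.\<close>

lemma kacyclic_insert:
  assumes T: "mult_set R T" and x: "x ` insert k I \<subseteq> carrier R" and fin: "finite I" and k: "k \<notin> I"
    and ac: "kacyclic M T x I n"
  shows "kacyclic M T x (insert k I) n"
  unfolding kacyclic_def
proof (intro allI impI ballI)
  fix i \<phi> assume i: "i < int n" and \<phi>: "\<phi> \<in> kcochains M (insert k I) i"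
    and d: "kdiff M x (insert k I) \<phi> = (\<lambda>_. \<zero>\<^bsub>M\<^esub>)"
  have xI: "x ` I \<subseteq> carrier R" and xk: "x k \<in> carrier R" using x by auto
  obtain \<phi>0 \<phi>1 where g: "\<phi>0 \<in> kcochains M I i" "\<phi>1 \<in> kcochains M I (i - 1)" "\<phi> = kglue M k \<phi>0 \<phi>1"
    using kcochains_glueE[OF \<phi> fin k] by blast
  have d0: "kdiff M x I \<phi>0 = (\<lambda>_. \<zero>\<^bsub>M\<^esub>)" and d1: "(\<lambda>S. x k \<odot>\<^bsub>M\<^esub> \<phi>0 S) = kdiff M x I \<phi>1"
    using d kcocycle_glue_iff[OF x fin k g(1,2)] unfolding g(3) by auto
  obtain t \<psi>0 where t: "t \<in> T" "\<psi>0 \<in> kcochains M I (i - 1)" "(\<lambda>S. t \<odot>\<^bsub>M\<^esub> \<phi>0 S) = kdiff M x I \<psi>0"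
    using kacyclicE[OF ac i g(1) d0] .
  have tR: "t \<in> carrier R" using t T by (auto simp: mult_set_def)
  note c0 = kcochains_closed[OF g(1)] and c1 = kcochains_closed[OF g(2)] and p0 = kcochains_closed[OF t(2)]
  \<comment> \<open>\<open>t\<close> times \<open>\<phi>1\<close> and \<open>x k\<close> times
    \<open>\<psi>0\<close> have the same coboundary, namely \<open>t\<close> times
    \<open>x k\<close> times \<open>\<phi>0\<close>. Their difference is the cocycle of degree
    \<open>i - 1\<close> to be bounded next.\<close>
  define \<chi> where "\<chi> = (\<lambda>S. t \<odot>\<^bsub>M\<^esub> \<phi>1 S \<oplus>\<^bsub>M\<^esub> \<ominus>\<^bsub>M\<^esub> (x k \<odot>\<^bsub>M\<^esub> \<psi>0 S))"
  have \<chi>: "\<chi> \<in> kcochains M I (i - 1)"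
    unfolding \<chi>_def using t(2) g(2) tR xk by (intro kcochains_add kcochains_minus kcochains_smult)
  have "kdiff M x I \<chi> = (\<lambda>S. t \<odot>\<^bsub>M\<^esub> kdiff M x I \<phi>1 S \<oplus>\<^bsub>M\<^esub> \<ominus>\<^bsub>M\<^esub> (x k \<odot>\<^bsub>M\<^esub> kdiff M x I \<psi>0 S))"
    unfolding \<chi>_def using tR xk c1 p0 xI fin
    by (simp add: kdiff_add kdiff_minus kdiff_smult)
  also have "\<dots> = (\<lambda>S. t \<odot>\<^bsub>M\<^esub> (x k \<odot>\<^bsub>M\<^esub> \<phi>0 S) \<oplus>\<^bsub>M\<^esub> \<ominus>\<^bsub>M\<^esub> (x k \<odot>\<^bsub>M\<^esub> (t \<odot>\<^bsub>M\<^esub> \<phi>0 S)))"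
    using fun_cong[OF d1] fun_cong[OF t(3)] by simp
  also have "\<dots> = (\<lambda>_. \<zero>\<^bsub>M\<^esub>)"
    using tR xk c0 by (simp add: R.m_comm M.r_neg flip: smult_assoc1)
  finally have "kdiff M x I \<chi> = (\<lambda>_. \<zero>\<^bsub>M\<^esub>)" .
  then obtain t' \<omega> where t': "t' \<in> T" "\<omega> \<in> kcochains M I (i - 1 - 1)" "(\<lambda>S. t' \<odot>\<^bsub>M\<^esub> \<chi> S) = kdiff M x I \<omega>"
    using kacyclicE[OF ac _ \<chi>] i by auto
  have t'R: "t' \<in> carrier R" using t' T by (auto simp: mult_set_def)
  \<comment> \<open>The sign of \<open>\<omega>\<close> cancels the minus of the cone differential;
    the terms in \<open>x k\<close> and \<open>\<psi>0\<close> then drop out and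
    \<open>t' \<otimes> t\<close> times \<open>\<phi>1\<close> remains.\<close>
  let ?\<psi> = "kglue M k (\<lambda>S. t' \<odot>\<^bsub>M\<^esub> \<psi>0 S) (\<lambda>S. \<ominus>\<^bsub>M\<^esub> \<omega> S)"
  have w: "kdiff M x I \<omega> S = (t' \<otimes> t) \<odot>\<^bsub>M\<^esub> \<phi>1 S \<oplus>\<^bsub>M\<^esub> \<ominus>\<^bsub>M\<^esub> (x k \<odot>\<^bsub>M\<^esub> (t' \<odot>\<^bsub>M\<^esub> \<psi>0 S))" for S
  proof -
    have "kdiff M x I \<omega> S = t' \<odot>\<^bsub>M\<^esub> \<chi> S" using fun_cong[OF t'(3)] by simp
    also have "\<dots> = (t' \<otimes> t) \<odot>\<^bsub>M\<^esub> \<phi>1 S \<oplus>\<^bsub>M\<^esub> \<ominus>\<^bsub>M\<^esub> ((t' \<otimes> x k) \<odot>\<^bsub>M\<^esub> \<psi>0 S)"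
      unfolding \<chi>_def using t'R tR xk p0 c1 by (simp add: smult_r_distr smult_r_minus smult_assoc1)
    also have "(t' \<otimes> x k) \<odot>\<^bsub>M\<^esub> \<psi>0 S = x k \<odot>\<^bsub>M\<^esub> (t' \<odot>\<^bsub>M\<^esub> \<psi>0 S)"
      using t'R xk p0 by (simp add: R.m_comm flip: smult_assoc1)
    finally show ?thesis .
  qed
  show "\<exists>t\<in>T. \<exists>\<psi>\<in>kcochains M (insert k I) (i - 1). (\<lambda>S. t \<odot>\<^bsub>M\<^esub> \<phi> S) = kdiff M x (insert k I) \<psi>"
  proof (intro bexI)
    show "t' \<otimes> t \<in> T" using t t' T by (auto simp: mult_set_def)
    show "?\<psi> \<in> kcochains M (insert k I) (i - 1)"
      using t t' fin k t'R by (intro kcochains_glue kcochains_smult kcochains_minus) auto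
    have "kdiff M x (insert k I) ?\<psi> =
        kglue M k (\<lambda>S. (t' \<otimes> t) \<odot>\<^bsub>M\<^esub> \<phi>0 S) (\<lambda>S. (t' \<otimes> t) \<odot>\<^bsub>M\<^esub> \<phi>1 S)"
    proof (subst kdiff_glue_eq_iff[OF x fin k, where i = "i - 1"], goal_cases)
      case 5
      have "kdiff M x I (\<lambda>S. t' \<odot>\<^bsub>M\<^esub> \<psi>0 S) = (\<lambda>S. (t' \<otimes> t) \<odot>\<^bsub>M\<^esub> \<phi>0 S)"
        using fun_cong[OF t(3), symmetric] t'R tR c0 p0 xI fin by (simp add: kdiff_smult smult_assoc1)
      moreover have "x k \<odot>\<^bsub>M\<^esub> (t' \<odot>\<^bsub>M\<^esub> \<psi>0 S) \<oplus>\<^bsub>M\<^esub> \<ominus>\<^bsub>M\<^esub> kdiff M x I (\<lambda>S. \<ominus>\<^bsub>M\<^esub> \<omega> S) S = (t' \<otimes> t) \<odot>\<^bsub>M\<^esub> \<phi>1 S" for S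
      proof -
        let ?a = "x k \<odot>\<^bsub>M\<^esub> (t' \<odot>\<^bsub>M\<^esub> \<psi>0 S)" and ?b = "(t' \<otimes> t) \<odot>\<^bsub>M\<^esub> \<phi>1 S"
        have cl: "?a \<in> carrier M" "?b \<in> carrier M" using xk t'R tR p0 c1 by auto
        have "\<ominus>\<^bsub>M\<^esub> kdiff M x I (\<lambda>S. \<ominus>\<^bsub>M\<^esub> \<omega> S) S = kdiff M x I \<omega> S"
          using kcochains_closed[OF t'(2)] xI fin by (simp add: kdiff_minus kdiff_closed)
        then show ?thesis using w[of S] cl
          by (simp add: M.a_lcomm M.r_neg)
      qed
      ultimately show ?case by auto
    qed (use t t' g t'R tR in \<open>auto intro!: kcochains_smult kcochains_minus\<close>)
    then show "(\<lambda>S. (t' \<otimes> t) \<odot>\<^bsub>M\<^esub> \<phi> S) = kdiff M x (insert k I) ?\<psi>"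
      unfolding g(3) using kglue_smult[of "t' \<otimes> t" \<phi>1] t'R tR c1 by simp
  qed
qed

text \<open>Multiplication by an entry is null-homotopic on the Koszul complex. The homotopy
  contracts with the basis vector of index \<open>k\<close>: it moves the second component of the
  cocycle to the first place.\<close>

lemma kcocycle_annihilated_by_entry:
  assumes x: "x ` I \<subseteq> carrier R" and fin: "finite I" and k: "k \<in> I"
    and \<phi>: "\<phi> \<in> kcochains M I i" and d: "kdiff M x I \<phi> = (\<lambda>_. \<zero>\<^bsub>M\<^esub>)"
  shows "\<exists>\<psi>\<in>kcochains M I (i - 1). (\<lambda>S. x k \<odot>\<^bsub>M\<^esub> \<phi> S) = kdiff M x I \<psi>"
proof -
  define I' where "I' = I - {k}"
  have I: "I = insert k I'" "k \<notin> I'" "finite I'" using k fin by (auto simp: I'_def)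
  have x': "x ` insert k I' \<subseteq> carrier R" "x k \<in> carrier R" "x ` I' \<subseteq> carrier R" using x I by auto
  obtain \<phi>0 \<phi>1 where g: "\<phi>0 \<in> kcochains M I' i" "\<phi>1 \<in> kcochains M I' (i - 1)" "\<phi> = kglue M k \<phi>0 \<phi>1"
    using kcochains_glueE[of \<phi> k I' i] \<phi> I by auto
  have d1: "(\<lambda>S. x k \<odot>\<^bsub>M\<^esub> \<phi>0 S) = kdiff M x I' \<phi>1"
    using d kcocycle_glue_iff[OF x'(1) I(3,2) g(1,2)] unfolding g(3) I(1) by auto
  note c0 = kcochains_closed[OF g(1)] and c1 = kcochains_closed[OF g(2)]
  show ?thesis
  proof (intro bexI)
    show "kglue M k \<phi>1 (\<lambda>_. \<zero>\<^bsub>M\<^esub>) \<in> kcochains M I (i - 1)"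
      unfolding I(1) using g I by (intro kcochains_glue) auto
    have "kdiff M x (insert k I') (kglue M k \<phi>1 (\<lambda>_. \<zero>\<^bsub>M\<^esub>)) =
        kglue M k (\<lambda>S. x k \<odot>\<^bsub>M\<^esub> \<phi>0 S) (\<lambda>S. x k \<odot>\<^bsub>M\<^esub> \<phi>1 S)"
      using g x' c1 d1 by (subst kdiff_glue[OF x'(1) I(3,2) g(2), where j = "i - 2"]) (auto simp: kdiff_zero)
    then show "(\<lambda>S. x k \<odot>\<^bsub>M\<^esub> \<phi> S) = kdiff M x I (kglue M k \<phi>1 (\<lambda>_. \<zero>\<^bsub>M\<^esub>))"
      unfolding I(1) g(3) using kglue_smult[OF x'(2) c1] by simp
  qed
qed

text \<open>The ring elements that annihilate a fixed cohomology class form an ideal, and this ideal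
  contains every entry.\<close>

lemma kcocycle_annihilated_by_ideal:
  assumes x: "x ` I \<subseteq> carrier R" and fin: "finite I" and r: "r \<in> Idl (x ` I)"
    and \<phi>: "\<phi> \<in> kcochains M I i" and d: "kdiff M x I \<phi> = (\<lambda>_. \<zero>\<^bsub>M\<^esub>)"
  shows "\<exists>\<psi>\<in>kcochains M I (i - 1). (\<lambda>S. r \<odot>\<^bsub>M\<^esub> \<phi> S) = kdiff M x I \<psi>"
proof -
  let ?P = "\<lambda>r. \<exists>\<psi>\<in>kcochains M I (i - 1). (\<lambda>S. r \<odot>\<^bsub>M\<^esub> \<phi> S) = kdiff M x I \<psi>"
  let ?K = "{r \<in> carrier R. ?P r}"
  note c = kcochains_closed[OF \<phi>]
  have mul: "?P (a \<otimes> b)" if P: "?P a" and ab: "a \<in> carrier R" "b \<in> carrier R" for a b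
  proof -
    obtain \<psi> where \<psi>: "\<psi> \<in> kcochains M I (i - 1)" "(\<lambda>S. a \<odot>\<^bsub>M\<^esub> \<phi> S) = kdiff M x I \<psi>" using P by blast
    have "(\<lambda>S. (a \<otimes> b) \<odot>\<^bsub>M\<^esub> \<phi> S) = (\<lambda>S. b \<odot>\<^bsub>M\<^esub> (a \<odot>\<^bsub>M\<^esub> \<phi> S))"
      using ab c by (simp add: R.m_comm flip: smult_assoc1)
    also have "\<dots> = kdiff M x I (\<lambda>S. b \<odot>\<^bsub>M\<^esub> \<psi> S)"
      using ab(2) kcochains_closed[OF \<psi>(1)] x fin fun_cong[OF \<psi>(2)] by (simp add: kdiff_smult)
    finally show ?thesis using kcochains_smult[OF ab(2) \<psi>(1)] by blast
  qed
  have "ideal ?K R"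
  proof (rule idealI)
    show "ring R" by (rule R.ring_axioms)
    show "subgroup ?K (add_monoid R)"
    proof (rule R.add.subgroupI)
      show "?K \<subseteq> carrier R" by auto
      have "?P \<zero>" using c kdiff_zero[OF x] by (intro bexI[of _ "\<lambda>_. \<zero>\<^bsub>M\<^esub>"]) auto
      then show "?K \<noteq> {}" using R.zero_closed by blast
      show "\<ominus> a \<in> ?K" if "a \<in> ?K" for a
        using that mul[of a "\<ominus> \<one>"] by (auto simp: R.r_minus)
      show "a \<oplus> b \<in> ?K" if ab: "a \<in> ?K" "b \<in> ?K" for a b
      proof -
        obtain \<psi> \<psi>' where \<psi>: "\<psi> \<in> kcochains M I (i - 1)" "(\<lambda>S. a \<odot>\<^bsub>M\<^esub> \<phi> S) = kdiff M x I \<psi>"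
          "\<psi>' \<in> kcochains M I (i - 1)" "(\<lambda>S. b \<odot>\<^bsub>M\<^esub> \<phi> S) = kdiff M x I \<psi>'" using ab by blast
        have "(\<lambda>S. (a \<oplus> b) \<odot>\<^bsub>M\<^esub> \<phi> S) = kdiff M x I (\<lambda>S. \<psi> S \<oplus>\<^bsub>M\<^esub> \<psi>' S)"
          using ab c x fun_cong[OF \<psi>(2)] fun_cong[OF \<psi>(4)] kcochains_closed[OF \<psi>(1)] kcochains_closed[OF \<psi>(3)]
          by (simp add: smult_l_distr kdiff_add)
        then show ?thesis using kcochains_add[OF \<psi>(1,3)] ab by blast
      qed
    qed
    show "b \<otimes> a \<in> ?K" if "a \<in> ?K" "b \<in> carrier R" for a b
      using that mul[of a b] by (auto simp: R.m_comm)
    show "a \<otimes> b \<in> ?K" if "a \<in> ?K" "b \<in> carrier R" for a b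
      using that mul[of a b] by auto
  qed
  moreover have "x ` I \<subseteq> ?K" using kcocycle_annihilated_by_entry[OF x fin _ \<phi> d] x by auto
  ultimately show ?thesis using r R.genideal_minimal by blast
qed

text \<open>Acyclicity of the cone makes multiplication by \<open>x k\<close> injective on the
  cohomology of the shorter sequence, up to T. But \<open>t\<close> times a power of
  \<open>x k\<close> lies in the ideal of that sequence and annihilates its cohomology, so the
  factors \<open>x k\<close> can be cancelled one after the other.\<close>

lemma kacyclic_remove:
  assumes T: "mult_set R T" and x: "x ` insert k I \<subseteq> carrier R" and fin: "finite I" and k: "k \<notin> I"
    and ac: "kacyclic M T x (insert k I) n"
    and t: "t \<in> T" "t \<otimes> x k [^] (N::nat) \<in> Idl (x ` I)"
  shows "kacyclic M T x I n"
  unfolding kacyclic_def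
proof (intro allI impI ballI)
  fix i \<phi> assume i: "i < int n" and \<phi>: "\<phi> \<in> kcochains M I i" and d: "kdiff M x I \<phi> = (\<lambda>_. \<zero>\<^bsub>M\<^esub>)"
  have xI: "x ` I \<subseteq> carrier R" and xk: "x k \<in> carrier R" using x by auto
  have TR: "t \<in> carrier R" if "t \<in> T" for t using that T by (auto simp: mult_set_def)
  let ?P = "\<lambda>r \<phi>. \<exists>\<psi>\<in>kcochains M I (i - 1). (\<lambda>S. r \<odot>\<^bsub>M\<^esub> \<phi> S) = kdiff M x I \<psi>"
  \<comment> \<open>A class killed by \<open>t\<close> and \<open>x k\<close>, glued with a
    primitive of its multiple, is a cocycle of the cone. The first component of a primitive in the
    cone bounds the class itself, up to T.\<close>
  have inj: "\<exists>t'\<in>T. ?P t' \<phi>"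
    if \<phi>: "\<phi> \<in> kcochains M I i" and d: "kdiff M x I \<phi> = (\<lambda>_. \<zero>\<^bsub>M\<^esub>)" and t: "t \<in> T" and P: "?P (t \<otimes> x k) \<phi>" for t \<phi>
  proof -
    note c = kcochains_closed[OF \<phi>]
    obtain \<psi> where \<psi>: "\<psi> \<in> kcochains M I (i - 1)" "(\<lambda>S. (t \<otimes> x k) \<odot>\<^bsub>M\<^esub> \<phi> S) = kdiff M x I \<psi>" using P by blast
    have t\<phi>: "(\<lambda>S. t \<odot>\<^bsub>M\<^esub> \<phi> S) \<in> kcochains M I i" using \<phi> TR[OF t] by (intro kcochains_smult)
    let ?\<omega> = "kglue M k (\<lambda>S. t \<odot>\<^bsub>M\<^esub> \<phi> S) \<psi>"
    have "(\<lambda>S. x k \<odot>\<^bsub>M\<^esub> (t \<odot>\<^bsub>M\<^esub> \<phi> S)) = kdiff M x I \<psi>"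
      unfolding \<psi>(2)[symmetric] using TR[OF t] xk c by (simp add: R.m_comm flip: smult_assoc1)
    then have "kdiff M x (insert k I) ?\<omega> = (\<lambda>_. \<zero>\<^bsub>M\<^esub>)"
      using d TR[OF t] c xI fin
      by (subst kcocycle_glue_iff[OF x fin k t\<phi> \<psi>(1)]) (auto simp: kdiff_smult)
    moreover have "?\<omega> \<in> kcochains M (insert k I) i" using t\<phi> \<psi>(1) fin k by (rule kcochains_glue)
    ultimately obtain t' \<chi> where t': "t' \<in> T" "\<chi> \<in> kcochains M (insert k I) (i - 1)"
      "(\<lambda>S. t' \<odot>\<^bsub>M\<^esub> ?\<omega> S) = kdiff M x (insert k I) \<chi>"
      using kacyclicE[OF ac i] by blast
    obtain \<chi>0 \<chi>1 where g: "\<chi>0 \<in> kcochains M I (i - 1)" "\<chi>1 \<in> kcochains M I (i - 1 - 1)" "\<chi> = kglue M k \<chi>0 \<chi>1"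
      using kcochains_glueE[OF t'(2) fin k] by blast
    have "kdiff M x (insert k I) (kglue M k \<chi>0 \<chi>1)
        = kglue M k (\<lambda>S. t' \<odot>\<^bsub>M\<^esub> (t \<odot>\<^bsub>M\<^esub> \<phi> S)) (\<lambda>S. t' \<odot>\<^bsub>M\<^esub> \<psi> S)"
      using t'(3) kglue_smult[OF TR[OF t'(1)] kcochains_closed[OF \<psi>(1)]] g(3) by simp
    then have "kdiff M x I \<chi>0 = (\<lambda>S. t' \<odot>\<^bsub>M\<^esub> (t \<odot>\<^bsub>M\<^esub> \<phi> S))"
      using kdiff_glue_eq_iff[OF x fin k g(1,2), of "\<lambda>S. t' \<odot>\<^bsub>M\<^esub> (t \<odot>\<^bsub>M\<^esub> \<phi> S)" "\<lambda>S. t' \<odot>\<^bsub>M\<^esub> \<psi> S"]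
        kcochains_smult[OF TR[OF t'(1)] t\<phi>] kcochains_smult[OF TR[OF t'(1)] \<psi>(1)] by simp
    then have "?P (t' \<otimes> t) \<phi>"
      using g(1) TR[OF t'(1)] TR[OF t] c by (intro bexI[of _ \<chi>0]) (auto simp: smult_assoc1)
    moreover have "t' \<otimes> t \<in> T" using t t'(1) T by (auto simp: mult_set_def)
    ultimately show ?thesis by blast
  qed
  \<comment> \<open>Each cancellation changes the denominator, so the induction has to range over
    all \<open>t\<close>. It is applied to the class of \<open>\<phi>\<close> times the remaining
    power.\<close>
  have "\<exists>t'\<in>T. ?P t' \<phi>" if "t \<in> T" "?P (t \<otimes> x k [^] (N::nat)) \<phi>" for t N
    using that
  proof (induction N arbitrary: t)
    case 0
    then show ?case using TR by auto
  next
    case (Suc N)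
    let ?\<phi> = "\<lambda>S. x k [^] N \<odot>\<^bsub>M\<^esub> \<phi> S"
    have xN: "x k [^] N \<in> carrier R" using xk by simp
    note c = kcochains_closed[OF \<phi>]
    have "kdiff M x I ?\<phi> = (\<lambda>_. \<zero>\<^bsub>M\<^esub>)" using d c xI fin xN by (simp add: kdiff_smult)
    moreover have "?\<phi> \<in> kcochains M I i" using \<phi> xN by (intro kcochains_smult)
    moreover have "(\<lambda>S. (t \<otimes> x k) \<odot>\<^bsub>M\<^esub> ?\<phi> S) = (\<lambda>S. (t \<otimes> x k [^] Suc N) \<odot>\<^bsub>M\<^esub> \<phi> S)"
    proof -
      have "t \<otimes> x k [^] Suc N = t \<otimes> x k \<otimes> x k [^] N"
        using TR[OF Suc.prems(1)] xk xN by (simp add: R.m_assoc R.m_comm)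
      then show ?thesis using TR[OF Suc.prems(1)] xk xN c by (simp add: smult_assoc1)
    qed
    ultimately obtain t' where t': "t' \<in> T" "?P t' ?\<phi>" using inj Suc.prems by metis
    then have "?P (t' \<otimes> x k [^] N) \<phi>" using TR xN c by (simp add: smult_assoc1)
    then show ?case using Suc.IH t' by blast
  qed
  then show "\<exists>t\<in>T. ?P t \<phi>" using t kcocycle_annihilated_by_ideal[OF xI fin t(2) \<phi> d] by blast
qed

end

section \<open>Reindexing and change of generators\<close>

context module begin

text \<open>The signs only count smaller elements, so an order-preserving renaming of the indices
  leaves them unchanged.\<close>

lemma kdiff_reindex:
  assumes h: "strict_mono_on I h" "h ` I = I'" and y: "\<And>t. t \<in> I \<Longrightarrow> y (h t) = x t"
    and x: "x ` I \<subseteq> carrier R" and fin: "finite I" and \<phi>: "\<And>S. \<phi> S \<in> carrier M"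
    and \<phi>': "\<And>S. S \<subseteq> I \<Longrightarrow> \<phi>' S = \<phi> (h ` S)" and T: "T \<subseteq> I"
  shows "kdiff M x I \<phi>' T = kdiff M y I' \<phi> (h ` T)"
proof -
  have inj: "inj_on h I" using h(1) by (simp add: strict_mono_on_imp_inj_on)
  then have injT: "inj_on h T" using T inj_on_subset by blast
  have xc: "x t \<in> carrier R" if "t \<in> T" for t using x that T by auto
  let ?g = "\<lambda>t. ksign M (card {s\<in>h ` T. s < t}) (y t \<odot>\<^bsub>M\<^esub> \<phi> (h ` T - {t}))"
  have eq: "ksign M (card {s\<in>T. s < t}) (x t \<odot>\<^bsub>M\<^esub> \<phi>' (T - {t})) = ?g (h t)" if t: "t \<in> T" for t
  proof -
    have "{s\<in>h ` T. s < h t} = h ` {s\<in>T. s < t}"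
      using strict_mono_on_less[OF h(1)] T t by (auto simp: subset_eq)
    then have "card {s\<in>h ` T. s < h t} = card {s\<in>T. s < t}"
      using injT by (simp add: card_image inj_on_def)
    moreover have "h ` T - {h t} = h ` (T - {t})" using injT t by (auto simp: inj_on_def)
    moreover have "y (h t) = x t" using y T t by auto
    moreover have "\<phi>' (T - {t}) = \<phi> (h ` (T - {t}))" by (rule \<phi>') (use T in auto)
    ultimately show ?thesis by simp
  qed
  have "kdiff M x I \<phi>' T = (\<Oplus>\<^bsub>M\<^esub> t\<in>T. ?g (h t))"
    unfolding kdiff_def using T eq xc \<phi> y by (auto intro!: M.finsum_cong')
  also have "\<dots> = finsum M ?g (h ` T)"
    using injT xc \<phi> y T by (intro M.finsum_reindex[symmetric]) auto
  also have "\<dots> = kdiff M y I' \<phi> (h ` T)" using T h(2) by (auto simp: kdiff_def)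
  finally show ?thesis .
qed

lemma kacyclic_reindex:
  assumes h: "strict_mono_on I h" "h ` I = I'" and y: "\<And>t. t \<in> I \<Longrightarrow> y (h t) = x t"
    and x: "x ` I \<subseteq> carrier R" and fin: "finite I" and T: "T \<subseteq> carrier R"
    and ac: "kacyclic M T x I n"
  shows "kacyclic M T y I' n"
  unfolding kacyclic_def
proof (intro allI impI ballI)
  fix i \<phi> assume i: "i < int n" and \<phi>: "\<phi> \<in> kcochains M I' i" and d: "kdiff M y I' \<phi> = (\<lambda>_. \<zero>\<^bsub>M\<^esub>)"
  have inj: "inj_on h I" using h(1) by (simp add: strict_mono_on_imp_inj_on)
  note c = kcochains_closed[OF \<phi>] and z = kcochains_zero[OF \<phi>]
  have card: "card (h ` S) = card S" if "S \<subseteq> I" for S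
    using that inj by (meson card_image inj_on_subset)
  let ?\<phi> = "\<lambda>S. if S \<subseteq> I then \<phi> (h ` S) else \<zero>\<^bsub>M\<^esub>"
  have "?\<phi> \<in> kcochains M I i" by (rule kcochainsI) (auto simp: c card intro!: z)
  moreover have "kdiff M x I ?\<phi> = (\<lambda>_. \<zero>\<^bsub>M\<^esub>)"
  proof
    fix S
    show "kdiff M x I ?\<phi> S = \<zero>\<^bsub>M\<^esub>"
    proof (cases "S \<subseteq> I")
      case True
      have "kdiff M x I ?\<phi> S = kdiff M y I' \<phi> (h ` S)"
        by (rule kdiff_reindex[OF h y x fin c _ True]) auto
      then show ?thesis using d by simp
    qed (simp add: kdiff_def)
  qed
  ultimately obtain t \<psi> where t: "t \<in> T" "\<psi> \<in> kcochains M I (i - 1)" "(\<lambda>S. t \<odot>\<^bsub>M\<^esub> ?\<phi> S) = kdiff M x I \<psi>"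
    using kacyclicE[OF ac i] by blast
  let ?g = "inv_into I h"
  let ?\<psi> = "\<lambda>S. if S \<subseteq> I' then \<psi> (?g ` S) else \<zero>\<^bsub>M\<^esub>"
  have gh: "?g ` h ` S = S" if "S \<subseteq> I" for S using that inj by (simp add: inv_into_image_cancel)
  have sub: "\<exists>U. U \<subseteq> I \<and> S = h ` U" if "S \<subseteq> I'" for S using that h(2) by (metis subset_imageE)
  have \<psi>c: "?\<psi> S \<in> carrier M" for S using kcochains_closed[OF t(2)] by simp
  show "\<exists>t\<in>T. \<exists>\<psi>\<in>kcochains M I' (i - 1). (\<lambda>S. t \<odot>\<^bsub>M\<^esub> \<phi> S) = kdiff M y I' \<psi>"
  proof (intro bexI)
    show "t \<in> T" by fact
    show "?\<psi> \<in> kcochains M I' (i - 1)"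
    proof (rule kcochainsI)
      fix S assume *: "\<not> (S \<subseteq> I' \<and> int (card S) = i - 1)"
      show "?\<psi> S = \<zero>\<^bsub>M\<^esub>"
      proof (cases "S \<subseteq> I'")
        case True
        then obtain U where "U \<subseteq> I" "S = h ` U" using sub by blast
        then show ?thesis using * True card gh kcochains_zero[OF t(2), of U] by simp
      qed simp
    qed (rule \<psi>c)
    show "(\<lambda>S. t \<odot>\<^bsub>M\<^esub> \<phi> S) = kdiff M y I' ?\<psi>"
    proof
      fix S
      show "t \<odot>\<^bsub>M\<^esub> \<phi> S = kdiff M y I' ?\<psi> S"
      proof (cases "S \<subseteq> I'")
        case True
        then obtain U where U: "U \<subseteq> I" "S = h ` U" using sub by blast
        have "kdiff M x I \<psi> U = kdiff M y I' ?\<psi> (h ` U)"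
        proof (rule kdiff_reindex[OF h y x fin \<psi>c _ U(1)])
          fix V assume "V \<subseteq> I"
          then show "\<psi> V = ?\<psi> (h ` V)" using gh h(2) by auto
        qed auto
        then show ?thesis using fun_cong[OF t(3), of U] U by simp
      next
        case False
        then have "\<phi> S = \<zero>\<^bsub>M\<^esub>" using z by blast
        then show ?thesis using False t(1) T by (auto simp: kdiff_def)
      qed
    qed
  qed
qed

lemma kacyclic_cong:
  assumes xy: "\<And>t. t \<in> I \<Longrightarrow> x t = y t" and x: "x ` I \<subseteq> carrier R" and fin: "finite I" and T: "T \<subseteq> carrier R"
  shows "kacyclic M T x I n \<longleftrightarrow> kacyclic M T y I n"
proof -
  have idm: "strict_mono_on I id" "id ` I = I" by (simp_all add: strict_mono_on_def)
  have y: "y ` I \<subseteq> carrier R" using x xy by auto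
  show ?thesis
    using kacyclic_reindex[OF idm _ x fin T, of y n] kacyclic_reindex[OF idm _ y fin T, of x n] xy by auto
qed

lemma kacyclic_superset:
  assumes T: "mult_set R T" and x: "x ` I' \<subseteq> carrier R" and fin: "finite I'" and sub: "I \<subseteq> I'"
    and ac: "kacyclic M T x I n"
  shows "kacyclic M T x I' n"
proof -
  have "kacyclic M T x (I \<union> K) n" if "K \<subseteq> I' - I" for K
    using finite_subset[OF that finite_Diff[OF fin]] that
  proof (induction K rule: finite_induct)
    case (insert k K)
    have "kacyclic M T x (insert k (I \<union> K)) n"
      using insert x fin sub by (intro kacyclic_insert[OF T]) (auto intro: finite_subset)
    then show ?case by simp
  qed (use ac in simp)
  from this[of "I' - I"] show ?thesis using sub by (simp add: Un_absorb1)
qed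

lemma kacyclic_subset:
  assumes T: "mult_set R T" and x: "x ` I' \<subseteq> carrier R" and fin: "finite I'" and sub: "I \<subseteq> I'"
    and rad: "\<And>k. k \<in> I' - I \<Longrightarrow> \<exists>t\<in>T. \<exists>N::nat. t \<otimes> x k [^] N \<in> Idl (x ` I)"
    and ac: "kacyclic M T x I' n"
  shows "kacyclic M T x I n"
proof -
  have "kacyclic M T x (I \<union> K) n \<Longrightarrow> kacyclic M T x I n" if "K \<subseteq> I' - I" for K
    using finite_subset[OF that finite_Diff[OF fin]] that
  proof (induction K rule: finite_induct)
    case (insert k K)
    obtain t N where t: "t \<in> T" "t \<otimes> x k [^] (N::nat) \<in> Idl (x ` I)" using rad[of k] insert.prems by auto
    have IK: "I \<union> K \<subseteq> I'" using insert.prems sub by auto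
    \<comment> \<open>Entries are dropped one at a time. The radical condition refers to the ideal
      of \<open>I\<close> alone, which lies in the ideal of the entries still present.\<close>
    have "Idl (x ` I) \<subseteq> Idl (x ` (I \<union> K))"
      using x IK by (intro R.subset_Idl_subset) (auto simp: image_Un intro: subset_trans[OF image_mono])
    then have tN: "t \<otimes> x k [^] N \<in> Idl (x ` (I \<union> K))" using t by blast
    have "finite (I \<union> K)" using IK fin finite_subset by blast
    moreover have "x ` insert k (I \<union> K) \<subseteq> carrier R" "k \<notin> I \<union> K"
      using x IK insert by auto
    ultimately have "kacyclic M T x (I \<union> K) n"
      using insert.prems by (intro kacyclic_remove[OF T _ _ _ _ t(1) tN]) auto
    then show ?case using insert by simp
  qed simp
  from this[of "I' - I"] show ?thesis using sub ac by (simp add: Un_absorb1)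
qed

text \<open>The two sequences are compared through their concatenation: appending \<open>ys\<close>
  keeps acyclicity, and afterwards each entry of \<open>xs\<close> may go because it lies in the
  radical of the ideal of \<open>ys\<close>, up to T.\<close>

lemma kacyclic_radical:
  assumes T: "mult_set R T" and xs: "set xs \<subseteq> carrier R" and ys: "set ys \<subseteq> carrier R"
    and rad: "\<And>x. x \<in> set xs \<Longrightarrow> \<exists>t\<in>T. \<exists>N::nat. t \<otimes> x [^] N \<in> Idl (set ys)"
    and ac: "kacyclic M T (nth xs) {..<length xs} n"
  shows "kacyclic M T (nth ys) {..<length ys} n"
proof -
  let ?l = "length xs" and ?m = "length ys" and ?z = "nth (xs @ ys)"
  have zc: "?z ` {..<?l + ?m} \<subseteq> carrier R"
  proof -
    have "?z ` {..<?l + ?m} \<subseteq> set (xs @ ys)" by (auto simp del: set_append)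
    then show ?thesis using xs ys by auto
  qed
  have TR: "T \<subseteq> carrier R" using T by (simp add: mult_set_def)
  have L: "?z ` {?l..<?l + ?m} = set ys"
  proof -
    have "{?l..<?l + ?m} = (+) ?l ` {..<?m}"
      by (simp add: lessThan_atLeast0 image_add_atLeastLessThan add.commute)
    then have "?z ` {?l..<?l + ?m} = nth ys ` {..<?m}" by (simp add: image_image)
    then show ?thesis by (auto simp: set_conv_nth)
  qed
  have "kacyclic M T ?z {..<?l} n"
    by (rule kacyclic_reindex[OF _ _ _ _ _ TR ac, where h = id])
      (use xs in \<open>auto simp: strict_mono_on_def nth_append\<close>)
  then have "kacyclic M T ?z {..<?l + ?m} n"
    by (rule kacyclic_superset[OF T zc, rotated 2]) auto
  then have "kacyclic M T ?z {?l..<?l + ?m} n"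
    by (rule kacyclic_subset[OF T zc, rotated 3])
      (use rad in \<open>auto simp: L nth_append_left\<close>)
  \<comment> \<open>The block of \<open>ys\<close> occupies the last positions of the concatenation;
    a shift by the length of \<open>xs\<close> brings it back to the initial segment without
    disturbing the order.\<close>
  then show ?thesis
    by (rule kacyclic_reindex[where h = "\<lambda>i. i - ?l", OF _ _ _ _ _ TR, rotated 5])
      (use ys in \<open>auto simp: strict_mono_on_def nth_append image_iff subset_eq intro!: bexI[of _ "_ + ?l"]\<close>)
qed

end

section \<open>From acyclicity to the grade as an extended natural number\<close>

lemma enat_le_SUP_iff:
  fixes f :: "'x \<Rightarrow> enat"
  assumes "A \<noteq> {}"
  shows "enat n \<le> (SUP a\<in>A. f a) \<longleftrightarrow> (\<exists>a\<in>A. enat n \<le> f a)"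
proof
  assume *: "enat n \<le> (SUP a\<in>A. f a)"
  show "\<exists>a\<in>A. enat n \<le> f a"
  proof (cases n)
    \<comment> \<open>This is where nonemptiness enters: the supremum of the empty family is 0,
      which is a bound without a member attaining it.\<close>
    case 0
    then show ?thesis using assms by (auto simp: enat_0)
  next
    case (Suc k)
    show ?thesis
    proof (rule ccontr)
      assume "\<not> ?thesis"
      then have "f a \<le> enat k" if "a \<in> A" for a
        using that Suc by (metis Suc_ile_eq not_le)
      then have "(SUP a\<in>A. f a) \<le> enat k" by (rule SUP_least)
      then show False using * Suc by (metis enat_ord_simps(1) not_less_eq_eq order.refl order.trans)
    qed
  qed
qed (meson SUP_upper order.trans)

text \<open>An infinite value is determined by its finite lower bounds. This turns comparisons of
  grades and heights into statements about one natural number.\<close>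

lemma enat_leI:
  fixes a b :: enat
  assumes "\<And>n. enat n \<le> a \<Longrightarrow> enat n \<le> b"
  shows "a \<le> b"
proof (cases a)
  case (enat n)
  then show ?thesis using assms[of n] by simp
next
  case infinity
  then have "enat n \<le> b" for n using assms[of n] by simp
  then have "b = \<infinity>" by (metis Suc_ile_eq enat.exhaust less_irrefl)
  then show ?thesis by simp
qed

lemma koszul_cochains_eq:
  assumes "abelian_group M"
  shows "koszul_cochains M l i = kcochains M {..<l} (int i)"
proof -
  interpret abelian_group M by fact
  show ?thesis unfolding koszul_cochains_def kcochains_def by (auto, metis zero_closed)
qed

text \<open>The given differential negates the scalar and tests the cardinality of its argument. The
  other one negates the module element, and outside the right degree it vanishes by itself on
  cochains.\<close>

lemma koszul_diff_eq:
  assumes "module R M" and xs: "set xs \<subseteq> carrier R" and \<phi>: "\<phi> \<in> koszul_cochains M (length xs) i"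
  shows "koszul_diff R M xs i \<phi> = kdiff M (nth xs) {..<length xs} \<phi>"
proof
  fix T
  interpret module R M by fact
  have \<phi>': "\<phi> \<in> kcochains M {..<length xs} (int i)"
    using \<phi> koszul_cochains_eq M.abelian_group_axioms by blast
  have xc: "(nth xs) ` {..<length xs} \<subseteq> carrier R" using xs by auto
  show "koszul_diff R M xs i \<phi> T = kdiff M (nth xs) {..<length xs} \<phi> T"
  proof (cases "T \<subseteq> {..<length xs} \<and> card T = Suc i")
    case True
    have "xs ! t \<in> carrier R" if "t \<in> T" for t using that True xs nth_mem by blast
    then show ?thesis
      unfolding koszul_diff_def kdiff_def ksign_def
      using True kcochains_closed[OF \<phi>'] by (auto intro!: M.finsum_cong' simp: smult_l_minus)
  next
    case False
    then have "kdiff M (nth xs) {..<length xs} \<phi> T = \<zero>\<^bsub>M\<^esub>"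
      using kdiff_kcochains[OF xc _ \<phi>'] by (intro kcochains_zero[where i = "int i + 1"]) auto
    then show ?thesis using False by (auto simp: koszul_diff_def)
  qed
qed

lemma koszul_H_nonzero_iff:
  assumes "module R M" and xs: "set xs \<subseteq> carrier R"
  shows "\<not> koszul_H_nonzero R M xs i \<longleftrightarrow>
    (\<forall>\<phi>\<in>kcochains M {..<length xs} (int i). kdiff M (nth xs) {..<length xs} \<phi> = (\<lambda>_. \<zero>\<^bsub>M\<^esub>) \<longrightarrow>
     (\<exists>\<psi>\<in>kcochains M {..<length xs} (int i - 1). \<phi> = kdiff M (nth xs) {..<length xs} \<psi>))"
proof -
  interpret module R M by fact
  have xc: "(nth xs) ` {..<length xs} \<subseteq> carrier R" using xs by auto
  note ce = koszul_cochains_eq[OF M.abelian_group_axioms]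
  have neg: "\<psi> = (\<lambda>_. \<zero>\<^bsub>M\<^esub>)" if "\<psi> \<in> kcochains M {..<length xs} (- 1)" for \<psi>
    using kcochains_zero[OF that] by auto
  have 1: "(\<exists>\<psi>\<in>koszul_cochains M (length xs) (i - 1).
      \<phi> = (if i = 0 then (\<lambda>_. \<zero>\<^bsub>M\<^esub>) else koszul_diff R M xs (i - 1) \<psi>)) \<longleftrightarrow>
    (\<exists>\<psi>\<in>kcochains M {..<length xs} (int i - 1). \<phi> = kdiff M (nth xs) {..<length xs} \<psi>)" for \<phi>
  proof (cases i)
    \<comment> \<open>Natural subtraction stays at 0 here, and the given definition substitutes the
      zero cochain for a coboundary. With integer degrees the only cochain in degree -1 is zero,
      which gives the same condition.\<close>
    case 0
    have "(\<exists>\<psi>\<in>kcochains M {..<length xs} (- 1). \<phi> = kdiff M (nth xs) {..<length xs} \<psi>) \<longleftrightarrow> \<phi> = (\<lambda>_. \<zero>\<^bsub>M\<^esub>)"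
      using neg kdiff_zero[OF xc] kcochains_zeroI by metis
    moreover have "kcochains M {..<length xs} 0 \<noteq> {}" using kcochains_zeroI by blast
    ultimately show ?thesis using 0 by (auto simp: ce)
  next
    case (Suc j)
    have "koszul_diff R M xs j \<psi> = kdiff M (nth xs) {..<length xs} \<psi>"
      if "\<psi> \<in> kcochains M {..<length xs} (int j)" for \<psi>
      using that koszul_diff_eq[OF assms] by (simp add: ce)
    then show ?thesis using Suc by (simp add: ce cong: bex_cong)
  qed
  have 2: "koszul_diff R M xs i \<phi> = kdiff M (nth xs) {..<length xs} \<phi>"
    if "\<phi> \<in> kcochains M {..<length xs} (int i)" for \<phi>
    using that koszul_diff_eq[OF assms] by (simp add: ce)
  have "\<not> koszul_H_nonzero R M xs i \<longleftrightarrow>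
    (\<forall>\<phi>\<in>koszul_cochains M (length xs) i. koszul_diff R M xs i \<phi> = (\<lambda>_. \<zero>\<^bsub>M\<^esub>) \<longrightarrow>
      (\<exists>\<psi>\<in>koszul_cochains M (length xs) (i - 1).
        \<phi> = (if i = 0 then (\<lambda>_. \<zero>\<^bsub>M\<^esub>) else koszul_diff R M xs (i - 1) \<psi>)))"
    unfolding koszul_H_nonzero_def by metis
  then show ?thesis unfolding 1 unfolding ce using 2 by (simp cong: ball_cong)
qed

lemma koszul_grade_list_ge_iff:
  fixes R :: "'a ring" (structure)
  assumes "module R M" and xs: "set xs \<subseteq> carrier R"
  shows "enat n \<le> koszul_grade_list R M xs \<longleftrightarrow> kacyclic M {\<one>\<^bsub>R\<^esub>} (nth xs) {..<length xs} n"
proof -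
  interpret module R M by fact
  have xc: "(nth xs) ` {..<length xs} \<subseteq> carrier R" using xs by auto
  let ?P = "\<lambda>i. \<forall>\<phi>\<in>kcochains M {..<length xs} i. kdiff M (nth xs) {..<length xs} \<phi> = (\<lambda>_. \<zero>\<^bsub>M\<^esub>) \<longrightarrow>
     (\<exists>\<psi>\<in>kcochains M {..<length xs} (i - 1). \<phi> = kdiff M (nth xs) {..<length xs} \<psi>)"
  have one: "(\<lambda>S. \<one> \<odot>\<^bsub>M\<^esub> \<phi> S) = \<phi>" if "\<phi> \<in> kcochains M {..<length xs} i" for \<phi> i
    using kcochains_closed[OF that] by simp
  have neg: "?P i" if "i < 0" for i
  proof (intro ballI impI)
    fix \<phi> assume "\<phi> \<in> kcochains M {..<length xs} i"
    then have "\<phi> = (\<lambda>_. \<zero>\<^bsub>M\<^esub>)" using that kcochains_zero by fastforce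
    then show "\<exists>\<psi>\<in>kcochains M {..<length xs} (i - 1). \<phi> = kdiff M (nth xs) {..<length xs} \<psi>"
      using kdiff_zero[OF xc] kcochains_zeroI by metis
  qed
  have "enat n \<le> koszul_grade_list R M xs \<longleftrightarrow> (\<forall>i. koszul_H_nonzero R M xs i \<longrightarrow> n \<le> i)"
    by (auto simp: koszul_grade_list_def le_INF_iff)
  also have "\<dots> \<longleftrightarrow> (\<forall>i<n. \<not> koszul_H_nonzero R M xs i)" by (meson not_le)
  also have "\<dots> \<longleftrightarrow> (\<forall>i<n. ?P (int i))" using koszul_H_nonzero_iff[OF assms] by simp
  also have "\<dots> \<longleftrightarrow> (\<forall>i<int n. ?P i)"
    (is "?L \<longleftrightarrow> ?R")
  proof
    assume *: ?L
    show ?R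
    proof (intro allI impI)
      fix i assume "i < int n"
      then show "?P i" using * neg[of i] by (cases "i < 0") (auto simp: not_less elim: nonneg_int_cases)
    qed
  qed auto
  also have "\<dots> \<longleftrightarrow> kacyclic M {\<one>\<^bsub>R\<^esub>} (nth xs) {..<length xs} n"
    unfolding kacyclic_def using one by simp
  finally show ?thesis .
qed

lemma (in cring) mult_set_one: "mult_set R {\<one>}"
  by (simp add: mult_set_def)

text \<open>Exponent 1 and denominator \<open>\<one>\<close> suffice here. Two lists generating the
  same ideal bound each other in this way, which is the independence of the Koszul grade from the
  generators.\<close>

lemma (in module) kacyclic_ideal_mono:
  assumes xs: "set xs \<subseteq> carrier R" and ys: "set ys \<subseteq> carrier R" and sub: "set xs \<subseteq> Idl (set ys)"
    and T: "mult_set R T" and ac: "kacyclic M T (nth xs) {..<length xs} n"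
  shows "kacyclic M T (nth ys) {..<length ys} n"
proof (rule kacyclic_radical[OF T xs ys _ ac])
  fix x assume x: "x \<in> set xs"
  then have "\<one> \<otimes> x [^] (1::nat) \<in> Idl (set ys)" using sub xs by (auto simp: subset_eq)
  moreover have "\<one> \<in> T" using T by (simp add: mult_set_def)
  ultimately show "\<exists>t\<in>T. \<exists>N::nat. t \<otimes> x [^] N \<in> Idl (set ys)" by blast
qed

text \<open>The \<open>SOME\<close> in \<open>Kgrade_fg\<close> disappears: whatever list is chosen
  generates the same ideal as the given one, so it is acyclic in the same range.\<close>

lemma Kgrade_ge_iff:
  fixes R :: "'a ring" (structure)
  assumes M: "module R M" and I: "ideal I R"
  shows "enat n \<le> Kgrade R M I \<longleftrightarrow>
    (\<exists>xs. set xs \<subseteq> I \<and> kacyclic M {\<one>\<^bsub>R\<^esub>} (nth xs) {..<length xs} n)"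
proof -
  interpret module R M by fact
  interpret I: ideal I R by fact
  let ?F = "{b. b \<subseteq> I \<and> fin_gen_ideal R b}"
  let ?xs = "\<lambda>b. SOME xs. set xs \<subseteq> carrier R \<and> b = Idl (set xs)"
  have sel: "set (?xs b) \<subseteq> carrier R \<and> b = Idl (set (?xs b))" if "b \<in> ?F" for b
    using that unfolding fin_gen_ideal_def by (intro someI_ex[where P = "\<lambda>xs. set xs \<subseteq> carrier R \<and> b = Idl (set xs)"]) auto
  have fg: "Idl (set xs) \<in> ?F" if "set xs \<subseteq> I" for xs
    using that I.a_subset R.genideal_minimal[OF I that] by (auto simp: fin_gen_ideal_def)
  have "?F \<noteq> {}" using fg[of "[]"] by auto
  then have "enat n \<le> Kgrade R M I \<longleftrightarrow> (\<exists>b\<in>?F. kacyclic M {\<one>} (nth (?xs b)) {..<length (?xs b)} n)"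
    unfolding Kgrade_def enat_le_SUP_iff[OF \<open>?F \<noteq> {}\<close>] Kgrade_fg_def
    using koszul_grade_list_ge_iff[OF M] sel by auto
  also have "\<dots> \<longleftrightarrow> (\<exists>xs. set xs \<subseteq> I \<and> kacyclic M {\<one>} (nth xs) {..<length xs} n)"
  proof
    assume "\<exists>b\<in>?F. kacyclic M {\<one>} (nth (?xs b)) {..<length (?xs b)} n"
    then obtain b where b: "b \<in> ?F" "kacyclic M {\<one>} (nth (?xs b)) {..<length (?xs b)} n" by blast
    have "set (?xs b) \<subseteq> I" using sel[OF b(1)] b(1) R.genideal_self[of "set (?xs b)"] by auto
    then show "\<exists>xs. set xs \<subseteq> I \<and> kacyclic M {\<one>} (nth xs) {..<length xs} n" using b by blast
  next
    assume "\<exists>xs. set xs \<subseteq> I \<and> kacyclic M {\<one>} (nth xs) {..<length xs} n"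
    then obtain xs where xs: "set xs \<subseteq> I" "kacyclic M {\<one>} (nth xs) {..<length xs} n" by blast
    let ?b = "Idl (set xs)"
    have xc: "set xs \<subseteq> carrier R" using xs I.a_subset by auto
    have "kacyclic M {\<one>} (nth (?xs ?b)) {..<length (?xs ?b)} n"
      using sel[OF fg[OF xs(1)]] R.genideal_self[OF xc]
      by (intro kacyclic_ideal_mono[OF xc _ _ R.mult_set_one xs(2)]) auto
    then show "\<exists>b\<in>?F. kacyclic M {\<one>} (nth (?xs b)) {..<length (?xs b)} n" using fg[OF xs(1)] by blast
  qed
  finally show ?thesis .
qed

section \<open>Koszul grade and height\<close>

text \<open>The sum of \<open>P\<close> and the principal ideal of \<open>a\<close>, kept abstract
  because every later use argues only with elements of the shape
  \<open>u \<oplus> r \<otimes> a\<close>.\<close>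

lemma (in cring) ideal_adjoin:
  assumes "ideal P R" "a \<in> carrier R"
  obtains K where "ideal K R" "P \<subseteq> K" "a \<in> K" "\<forall>s\<in>K. \<exists>u\<in>P. \<exists>r\<in>carrier R. s = u \<oplus> r \<otimes> a"
proof
  have a: "ideal (PIdl a) R" "a \<in> PIdl a" using assms(2) cgenideal_ideal cgenideal_self by auto
  interpret P: ideal P R by fact
  interpret A: ideal "PIdl a" R by fact
  show "ideal (P <+>\<^bsub>R\<^esub> PIdl a) R" using add_ideals[OF assms(1) a(1)] .
  show "P \<subseteq> P <+>\<^bsub>R\<^esub> PIdl a"
  proof
    fix u assume "u \<in> P"
    then have "u = u \<oplus> \<zero>" using P.Icarr by simp
    then show "u \<in> P <+>\<^bsub>R\<^esub> PIdl a" using \<open>u \<in> P\<close> A.zero_closed unfolding set_add_def' by blast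
  qed
  have "a = \<zero> \<oplus> a" using assms(2) by simp
  then show "a \<in> P <+>\<^bsub>R\<^esub> PIdl a" using a(2) P.zero_closed unfolding set_add_def' by blast
  show "\<forall>s\<in>P <+>\<^bsub>R\<^esub> PIdl a. \<exists>u\<in>P. \<exists>r\<in>carrier R. s = u \<oplus> r \<otimes> a"
    unfolding set_add_def' cgenideal_def by blast
qed

text \<open>An ideal maximal among those over \<open>I\<close> that miss \<open>T\<close> is prime:
  elements outside it would give two members of \<open>T\<close> with product inside it. The
  maximality clause is recorded for lying over, where it supplies elements of \<open>T\<close> in
  larger ideals.\<close>

lemma (in cring) prime_disjoint_exists:
  assumes T: "mult_set R T" and I: "ideal I R" "I \<inter> T = {}"
  obtains P where "primeideal P R" "I \<subseteq> P" "P \<inter> T = {}"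
    "\<forall>K. ideal K R \<longrightarrow> P \<subset> K \<longrightarrow> K \<inter> T \<noteq> {}"
proof -
  let ?F = "{K. ideal K R \<and> I \<subseteq> K \<and> K \<inter> T = {}}"
  have "\<exists>P\<in>?F. \<forall>K\<in>?F. P \<subseteq> K \<longrightarrow> K = P"
  proof (rule subset_Zorn_nonempty)
    show "?F \<noteq> {}" using I by blast
    fix C assume C: "C \<noteq> {}" "subset.chain ?F C"
    have CF: "C \<subseteq> ?F" using C(2) by (simp add: subset_chain_def)
    then have "subset.chain {I. ideal I R} C" using C(2) unfolding subset_chain_def by blast
    then have "ideal (\<Union>C) R" using chain_Union_is_ideal[of C] C(1) by simp
    moreover have "I \<subseteq> \<Union>C" "\<Union>C \<inter> T = {}" using C(1) CF by blast+
    ultimately show "\<Union>C \<in> ?F" by blast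
  qed
  then obtain P where P': "P \<in> ?F" and max: "\<forall>K\<in>?F. P \<subseteq> K \<longrightarrow> K = P" ..
  from P' have P: "ideal P R" "I \<subseteq> P" "P \<inter> T = {}" by simp_all
  interpret P: ideal P R by fact
  have meets: "K \<inter> T \<noteq> {}" if "ideal K R" "P \<subset> K" for K 
  proof
    assume "K \<inter> T = {}"
    then have "K = P" using that max P(2) by simp
    then show False using that(2) by simp
  qed
  have T1: "\<one> \<in> T" and Tm: "\<And>s t. s \<in> T \<Longrightarrow> t \<in> T \<Longrightarrow> s \<otimes> t \<in> T" and TR: "T \<subseteq> carrier R"
    using T by (auto simp: mult_set_def)
  have adj: "\<exists>u\<in>P. \<exists>r\<in>carrier R. u \<oplus> r \<otimes> a \<in> T" if a: "a \<in> carrier R" "a \<notin> P" for a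
  proof -
    obtain K where K: "ideal K R" "P \<subseteq> K" "a \<in> K" "\<forall>s\<in>K. \<exists>u\<in>P. \<exists>r\<in>carrier R. s = u \<oplus> r \<otimes> a"
      using ideal_adjoin[OF P(1) a(1)] .
    then obtain s where "s \<in> K" "s \<in> T" using meets[of K] a(2) by blast
    then show ?thesis using K(4) by metis
  qed
  have "primeideal P R"
  proof (rule primeidealI)
    show "ideal P R" "cring R" by (rule P(1), rule is_cring)
    show "carrier R \<noteq> P" using P(3) T1 by auto
    fix a b assume ab: "a \<in> carrier R" "b \<in> carrier R" "a \<otimes> b \<in> P"
    show "a \<in> P \<or> b \<in> P"
    proof (rule ccontr)
      assume "\<not> ?thesis"
      then obtain u r v s where u: "u \<in> P" "r \<in> carrier R" "u \<oplus> r \<otimes> a \<in> T"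
        and v: "v \<in> P" "s \<in> carrier R" "v \<oplus> s \<otimes> b \<in> T" using adj ab by metis
      have uc: "u \<in> carrier R" "v \<in> carrier R" using u v P.Icarr by auto
      have "(u \<oplus> r \<otimes> a) \<otimes> (v \<oplus> s \<otimes> b) =
          u \<otimes> (v \<oplus> s \<otimes> b) \<oplus> ((r \<otimes> a) \<otimes> v \<oplus> (r \<otimes> s) \<otimes> (a \<otimes> b))"
        using u(2) v(2) uc ab(1,2) by algebra
      also have "\<dots> \<in> P"
        using u(1,2) v(1,2) uc ab P.I_r_closed[of u] P.I_l_closed[of v] P.I_l_closed[OF ab(3)]
        by (intro P.a_closed) auto
      finally show False using Tm[OF u(3) v(3)] P(3) by blast
    qed
  qed
  then show thesis using that P meets by blast
qed

section \<open>Chains of primes and the boundary monoid\<close>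

lemma prime_height_geI:
  fixes R :: "'a ring"
  assumes "\<And>k. k \<le> n \<Longrightarrow> primeideal (c k) R" "\<And>k. k < n \<Longrightarrow> c k \<subset> c (Suc k)" "c n = P"
  shows "enat n \<le> prime_height R P"
  unfolding prime_height_def using assms by (intro SUP_upper) auto

lemma prime_height_leI:
  fixes R :: "'a ring"
  assumes "\<And>n c. (\<And>k. k \<le> n \<Longrightarrow> primeideal (c k) R) \<Longrightarrow> (\<And>k. k < n \<Longrightarrow> c k \<subset> c (Suc k)) \<Longrightarrow> c n = P
    \<Longrightarrow> enat n \<le> h"
  shows "prime_height R P \<le> h"
  unfolding prime_height_def using assms by (intro SUP_least) auto

lemma (in primeideal) pow_mem_imp:
  "x \<in> carrier R \<Longrightarrow> x [^] (n::nat) \<in> I \<Longrightarrow> x \<in> I"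
proof (induction n)
  case 0
  then show ?case using one_imp_carrier I_notcarr by simp
next
  case (Suc n)
  then show ?case using I_prime[of "x [^] n" x] by auto
qed

text \<open>If \<open>0\<close> is not in the boundary monoid of \<open>x\<^sub>1, \<dots>, x\<^sub>n\<close> over \<open>R - p\<close>, there is a chain of primes
  \<open>c\<^sub>0 \<subset> \<dots> \<subset> c\<^sub>n = p\<close> with \<open>x\<^sub>i \<in> c\<^sub>i - c\<^sub>i\<^sub>-\<^sub>1\<close>.\<close>

fun boundary_monoid :: "('a, 'r) ring_scheme \<Rightarrow> 'a set \<Rightarrow> 'a list \<Rightarrow> 'a set" where
  "boundary_monoid R T [] = T"
| "boundary_monoid R T (x # xs) = {x [^]\<^bsub>R\<^esub> (m::nat) \<otimes>\<^bsub>R\<^esub> (s \<oplus>\<^bsub>R\<^esub> a \<otimes>\<^bsub>R\<^esub> x) | m s a.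
     s \<in> boundary_monoid R T xs \<and> a \<in> carrier R}"

context cring begin

lemma mult_set_boundary_monoid:
  assumes "mult_set R T" "set xs \<subseteq> carrier R"
  shows "mult_set R (boundary_monoid R T xs)"
  using assms(2)
proof (induction xs)
  case Nil
  then show ?case using assms by simp
next
  case (Cons x xs)
  let ?S = "boundary_monoid R T xs"
  have x: "x \<in> carrier R" and IH: "mult_set R ?S" using Cons by auto
  have S: "s \<in> carrier R" if "s \<in> ?S" for s using that IH by (auto simp: mult_set_def)
  show ?case unfolding mult_set_def
  proof (intro conjI ballI)
    show "boundary_monoid R T (x # xs) \<subseteq> carrier R" using x S by auto
    have "\<one> = x [^] (0::nat) \<otimes> (\<one> \<oplus> \<zero> \<otimes> x)" using x by simp
    moreover have "\<one> \<in> ?S" using IH by (simp add: mult_set_def)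
    ultimately show "\<one> \<in> boundary_monoid R T (x # xs)" using zero_closed unfolding boundary_monoid.simps by blast
    fix u v assume "u \<in> boundary_monoid R T (x # xs)" "v \<in> boundary_monoid R T (x # xs)"
    then obtain m s a m' s' a' where u: "u = x [^] (m::nat) \<otimes> (s \<oplus> a \<otimes> x)" "s \<in> ?S" "a \<in> carrier R"
      and v: "v = x [^] (m'::nat) \<otimes> (s' \<oplus> a' \<otimes> x)" "s' \<in> ?S" "a' \<in> carrier R" by auto
    have c: "x [^] m \<in> carrier R" "x [^] m' \<in> carrier R" "s \<in> carrier R" "s' \<in> carrier R" using x S u v by auto
    have "u \<otimes> v = x [^] m \<otimes> x [^] m' \<otimes> (s \<otimes> s' \<oplus> (a \<otimes> s' \<oplus> a' \<otimes> s \<oplus> a \<otimes> a' \<otimes> x) \<otimes> x)"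
      unfolding u(1) v(1) using c u(3) v(3) x by algebra
    also have "x [^] m \<otimes> x [^] m' = x [^] (m + m')" using x by (rule nat_pow_mult)
    finally have "u \<otimes> v = x [^] (m + m') \<otimes> (s \<otimes> s' \<oplus> (a \<otimes> s' \<oplus> a' \<otimes> s \<oplus> a \<otimes> a' \<otimes> x) \<otimes> x)" .
    moreover have "s \<otimes> s' \<in> ?S" using IH u v by (auto simp: mult_set_def)
    moreover have "a \<otimes> s' \<oplus> a' \<otimes> s \<oplus> a \<otimes> a' \<otimes> x \<in> carrier R" using c u(3) v(3) x by auto
    ultimately show "u \<otimes> v \<in> boundary_monoid R T (x # xs)" unfolding boundary_monoid.simps by blast
  qed
qed

lemma mult_set_prime_compl: "primeideal P R \<Longrightarrow> mult_set R (carrier R - P)"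
proof -
  assume "primeideal P R"
  then interpret P: primeideal P R .
  show ?thesis unfolding mult_set_def
    using P.I_prime P.one_imp_carrier P.I_notcarr by auto
qed

text \<open>The two factors of the boundary monoid play different roles for a prime \<open>q\<close>
  missing it: the powers of \<open>x\<close> force \<open>x\<close> out of \<open>q\<close>, while
  the elements \<open>s \<oplus> a \<otimes> x\<close> force the ideal of \<open>q\<close> and
  \<open>x\<close> to miss the monoid of the remaining list. Hence the next prime can be taken over
  \<open>q\<close> and \<open>x\<close>, strictly above \<open>q\<close>. These are the monoids of
  the Coquand-Lombardi description of Krull dimension, taken relative to
  \<open>R - p\<close>.\<close>

lemma boundary_monoid_chain:
  assumes p: "primeideal p R" and xs: "set xs \<subseteq> carrier R"
    and I: "ideal I R" "I \<inter> boundary_monoid R (carrier R - p) xs = {}"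
  shows "\<exists>c. (\<forall>k\<le>length xs. primeideal (c k) R) \<and> (\<forall>k<length xs. c k \<subset> c (Suc k)) \<and>
    I \<subseteq> c 0 \<and> c (length xs) = p"
  using xs I
proof (induction xs arbitrary: I)
  case Nil
  then have "I \<subseteq> p" using ideal.Icarr by fastforce
  then show ?case using p by (intro exI[of _ "\<lambda>_. p"]) simp
next
  case (Cons x xs)
  let ?S = "boundary_monoid R (carrier R - p)"
  have x: "x \<in> carrier R" and xs: "set xs \<subseteq> carrier R" using Cons.prems by auto
  note mS = mult_set_boundary_monoid[OF mult_set_prime_compl[OF p]]
  obtain q where q: "primeideal q R" "I \<subseteq> q" "q \<inter> ?S (x # xs) = {}"
    "\<forall>K. ideal K R \<longrightarrow> q \<subset> K \<longrightarrow> K \<inter> ?S (x # xs) \<noteq> {}"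
    using prime_disjoint_exists[OF mS[OF Cons.prems(1)] Cons.prems(2,3)] .
  interpret q: primeideal q R by fact
  obtain K where K: "ideal K R" "q \<subseteq> K" "x \<in> K" "\<forall>s\<in>K. \<exists>u\<in>q. \<exists>r\<in>carrier R. s = u \<oplus> r \<otimes> x"
    using ideal_adjoin[OF q.is_ideal x] .
  have disj: "s \<notin> ?S xs" if sK: "s \<in> K" for s
  proof
    assume s: "s \<in> ?S xs"
    obtain u r where u: "u \<in> q" "r \<in> carrier R" "s = u \<oplus> r \<otimes> x" using K(4) sK by metis
    have "u = x [^] (0::nat) \<otimes> (s \<oplus> (\<ominus> r) \<otimes> x)"
      using u x q.Icarr[OF u(1)] by (simp add: l_minus a_assoc r_neg)
    then have "u \<in> ?S (x # xs)" using s u(2) unfolding boundary_monoid.simps by blast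
    then show False using u(1) q(3) by blast
  qed
  have "K \<inter> ?S xs = {}" using disj by blast
  then obtain c where c: "\<And>k. k \<le> length xs \<Longrightarrow> primeideal (c k) R" "\<And>k. k < length xs \<Longrightarrow> c k \<subset> c (Suc k)"
    "K \<subseteq> c 0" "c (length xs) = p"
    using Cons.IH[OF xs K(1)] by blast
  have "x \<notin> q"
  proof
    assume "x \<in> q"
    moreover have "\<one> \<in> ?S xs" using mS[OF xs] by (simp add: mult_set_def)
    then have "x [^] (1::nat) \<otimes> (\<one> \<oplus> \<zero> \<otimes> x) \<in> ?S (x # xs)" using zero_closed unfolding boundary_monoid.simps by blast
    then have "x \<in> ?S (x # xs)" using x by simp
    ultimately show False using q(3) by blast
  qed
  then have "q \<subset> c 0" using K(2,3) c(3) by blast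
  then show ?case
    using c q(1,2) by (intro exI[of _ "case_nat q c"]) (auto split: nat.splits simp: less_Suc_eq_0_disj)
qed

text \<open>Kronecker's theorem at \<open>p\<close>: if \<open>u = 0\<close> the \<open>ys\<close> and the \<open>x # xs\<close> have the same
  radical in the localisation at \<open>p\<close>. The witnesses are \<open>y\<^sub>k = x\<^sub>k + b\<^sub>k x\<^sub>k\<^sub>+\<^sub>1\<close>
  with \<open>b\<^sub>k = s\<^sub>k + a\<^sub>k x\<^sub>k\<close> read off the membership of \<open>u\<close> in the boundary monoid.\<close>

lemma boundary_monoid_reduce:
  assumes p: "primeideal p R" and "set (x # xs) \<subseteq> p" "u \<in> boundary_monoid R (carrier R - p) (x # xs)"
  shows "\<exists>ys. length ys = length xs \<and> set ys \<subseteq> p \<and>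
    (\<forall>Q. primeideal Q R \<longrightarrow> Q \<subseteq> p \<longrightarrow> set ys \<subseteq> Q \<longrightarrow> u \<otimes> x \<in> Q \<longrightarrow> set (x # xs) \<subseteq> Q)"
  using assms(2,3)
\<comment> \<open>The case of interest is \<open>u = \<zero>\<close>, but the recursion replaces
  \<open>u\<close> by the element \<open>s\<close> inside it. The condition that survives this
  replacement is that \<open>u\<close> times the head lies in \<open>Q\<close>.\<close>
proof (induction xs arbitrary: x u)
  case Nil
  interpret p: primeideal p R by fact
  have x: "x \<in> p" "x \<in> carrier R" using Nil p.Icarr by auto
  obtain m s a where u: "u = x [^] (m::nat) \<otimes> (s \<oplus> a \<otimes> x)" "s \<in> carrier R" "s \<notin> p" "a \<in> carrier R"
    using Nil by auto
  have "s \<oplus> a \<otimes> x \<notin> p"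
  proof
    assume *: "s \<oplus> a \<otimes> x \<in> p"
    have "s = (s \<oplus> a \<otimes> x) \<oplus> \<ominus> (a \<otimes> x)" using u x by (simp add: a_assoc r_neg)
    also have "\<dots> \<in> p" by (rule p.a_closed[OF * p.a_inv_closed[OF p.I_l_closed[OF x(1) u(4)]]])
    finally show False using u by simp
  qed
  then have "x \<in> Q" if Q: "primeideal Q R" "Q \<subseteq> p" "u \<otimes> x \<in> Q" for Q
  proof -
    interpret Q: primeideal Q R by fact
    have "u \<otimes> x = (s \<oplus> a \<otimes> x) \<otimes> x [^] (Suc m)"
      using u x by (simp add: m_ac)
    then have "x [^] Suc m \<in> Q" using Q \<open>s \<oplus> a \<otimes> x \<notin> p\<close> Q.I_prime[of "s \<oplus> a \<otimes> x" "x [^] Suc m"] u x by auto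
    then show ?thesis using Q.pow_mem_imp x by blast
  qed
  then show ?case by (intro exI[of _ "[]"]) auto
next
  case (Cons x1 xs)
  interpret p: primeideal p R by fact
  have x: "x \<in> p" "x \<in> carrier R" "x1 \<in> p" "x1 \<in> carrier R" using Cons.prems p.Icarr by auto
  obtain m s a where u: "u = x [^] (m::nat) \<otimes> (s \<oplus> a \<otimes> x)"
    "s \<in> boundary_monoid R (carrier R - p) (x1 # xs)" "a \<in> carrier R"
    using Cons.prems(2) unfolding boundary_monoid.simps(2)[of R _ x] by blast
  have "mult_set R (boundary_monoid R (carrier R - p) (x1 # xs))"
    using Cons.prems p.Icarr by (intro mult_set_boundary_monoid mult_set_prime_compl p) auto
  then have s: "s \<in> carrier R" using u(2) unfolding mult_set_def by blast
  obtain ys where ys: "length ys = length xs" "set ys \<subseteq> p"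
    "\<And>Q. primeideal Q R \<Longrightarrow> Q \<subseteq> p \<Longrightarrow> set ys \<subseteq> Q \<Longrightarrow> s \<otimes> x1 \<in> Q \<Longrightarrow> set (x1 # xs) \<subseteq> Q"
    using Cons.IH[OF _ u(2)] Cons.prems by auto
  define b where "b = s \<oplus> a \<otimes> x"
  have b: "b \<in> carrier R" using s x u by (simp add: b_def)
  let ?y = "x \<oplus> b \<otimes> x1"
  show ?case
  proof (intro exI[of _ "?y # ys"] conjI allI impI)
    show "length (?y # ys) = length (x1 # xs)" using ys by simp
    show "set (?y # ys) \<subseteq> p" using ys x b by (auto intro!: p.a_closed p.I_l_closed)
    fix Q assume Q: "primeideal Q R" "Q \<subseteq> p" "set (?y # ys) \<subseteq> Q" "u \<otimes> x \<in> Q"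
    interpret Q: primeideal Q R by fact
    have y: "?y \<in> Q" using Q by simp
    have "u \<otimes> x = x [^] Suc m \<otimes> b"
      using u x b unfolding b_def[symmetric] by (simp add: m_ac)
    \<comment> \<open>A prime containing this product contains \<open>x\<close> directly or contains
      \<open>b\<close>; in the second case \<open>x\<close> is the new element \<open>?y\<close>
      minus a multiple of \<open>b\<close>.\<close>
    then have "x [^] Suc m \<in> Q \<or> b \<in> Q" using Q.I_prime[of "x [^] Suc m" b] x b Q(4) by auto
    then have xQ: "x \<in> Q"
    proof
      assume "x [^] Suc m \<in> Q" then show ?thesis using Q.pow_mem_imp x by blast
    next
      assume "b \<in> Q"
      have "x = ?y \<oplus> \<ominus> (b \<otimes> x1)" using x b by (simp add: a_assoc r_neg)
      also have "\<dots> \<in> Q" by (rule Q.a_closed[OF y Q.a_inv_closed[OF Q.I_r_closed[OF \<open>b \<in> Q\<close> x(4)]]])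
      finally show ?thesis .
    qed
    \<comment> \<open>Expanding \<open>b\<close> in \<open>?y\<close> leaves
      \<open>s \<otimes> x1\<close> up to multiples of \<open>x\<close>. This is the hypothesis of
      the induction for the shorter list, with \<open>s\<close> in place of
      \<open>u\<close>.\<close>
    have "s \<otimes> x1 = ?y \<oplus> \<ominus> x \<oplus> \<ominus> (a \<otimes> x1 \<otimes> x)"
      unfolding b_def using s x u by algebra
    also have "\<dots> \<in> Q" using Q.I_l_closed[OF xQ, of "a \<otimes> x1"] x u
      by (intro Q.a_closed[OF Q.a_closed[OF y Q.a_inv_closed[OF xQ]] Q.a_inv_closed]) auto
    finally show "set (x # x1 # xs) \<subseteq> Q" using ys(3)[OF Q(1,2)] Q(3) xQ by auto
  qed
qed

end

section \<open>The Koszul grade at a prime\<close>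

lemma ring_module_simps [simp]:
  "carrier (ring_module R) = carrier R" "Ring.ring.zero (ring_module R) = Ring.ring.zero R"
  "Ring.ring.add (ring_module R) = Ring.ring.add R" "Module.module.smult (ring_module R) = monoid.mult R"
 
  by (simp_all add: ring_module_def)

lemma ring_module_finsum [simp]: "finsum (ring_module R) = finsum R"
  by (simp add: finsum_def finprod_def fun_eq_iff)

lemma ring_module_a_inv [simp]: "a_inv (ring_module R) = a_inv R"
  by (simp add: a_inv_def m_inv_def fun_eq_iff)

lemma module_ring_module: "cring R \<Longrightarrow> module R (ring_module R)"
proof -
  assume "cring R"
  then interpret cring R .
  have "abelian_group (ring_module R)"
    by (rule abelian_groupI) (auto simp: a_ac intro: l_neg)
  then show ?thesis
    by (intro moduleI is_cring) (auto simp: l_distr r_distr m_assoc)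
qed

lemma kacyclic_mono: "kacyclic M T x I n \<Longrightarrow> T \<subseteq> T' \<Longrightarrow> kacyclic M T' x I n"
  unfolding kacyclic_def by (meson subset_iff)

lemma (in ideal) finsum_mem:
  assumes "finite A" "\<And>a. a \<in> A \<Longrightarrow> g a \<in> I"
  shows "finsum R g A \<in> I"
  using assms
proof (induction A rule: finite_induct)
  case (insert a A)
  then have "finsum R g (insert a A) = g a \<oplus> finsum R g A"
    using Icarr by (intro finsum_insert) auto
  then show ?case using insert by simp
qed simp

text \<open>The top Koszul cohomology is \<open>R\<close> modulo the ideal generated by the sequence, and it
  survives localisation at \<open>p\<close>.\<close>

lemma kacyclic_prime_le_length:
  fixes R :: "'a ring" (structure)
  assumes p: "primeideal p R" and xs: "set xs \<subseteq> p"
    and ac: "kacyclic (ring_module R) (carrier R - p) (nth xs) {..<length xs} n"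
  shows "n \<le> length xs"
proof (rule ccontr)
  assume *: "\<not> n \<le> length xs"
  let ?M = "ring_module R" and ?l = "length xs"
  interpret p: primeideal p R by fact
  interpret module R ?M using module_ring_module[OF p.is_cring] .
  have xp: "xs ! t \<in> p" if "t < ?l" for t using xs that by auto
  then have xc: "(nth xs) ` {..<?l} \<subseteq> carrier R" using p.Icarr by auto
  \<comment> \<open>The top cochain with value 1 is a cocycle, there being no index sets with one
    element more. If \<open>t\<close> makes it a coboundary, then \<open>t\<close> is a combination
    of the entries and lies in \<open>p\<close>.\<close>
  let ?\<phi> = "\<lambda>S. if S = {..<?l} then \<one> else \<zero>"
  have \<phi>: "?\<phi> \<in> kcochains ?M {..<?l} (int ?l)" by (rule kcochainsI) auto
  have d: "kdiff ?M (nth xs) {..<?l} ?\<phi> = (\<lambda>_. \<zero>\<^bsub>?M\<^esub>)"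
  proof
    fix S
    have "\<not> (S \<subseteq> {..<?l} \<and> int (card S) = int ?l + 1)"
      using card_mono[of "{..<?l}" S] by auto
    then show "kdiff ?M (nth xs) {..<?l} ?\<phi> S = \<zero>\<^bsub>?M\<^esub>"
      using kdiff_kcochains[OF xc _ \<phi>] kcochains_zero by blast
  qed
  obtain t \<psi> where t: "t \<in> carrier R - p" "\<psi> \<in> kcochains ?M {..<?l} (int ?l - 1)"
    "(\<lambda>S. t \<odot>\<^bsub>?M\<^esub> ?\<phi> S) = kdiff ?M (nth xs) {..<?l} \<psi>"
    using kacyclicE[OF ac _ \<phi> d] * by auto
  have "t = kdiff ?M (nth xs) {..<?l} \<psi> {..<?l}" using fun_cong[OF t(3), of "{..<?l}"] t(1) by simp
  also have "\<dots> = (\<Oplus>s\<in>{..<?l}. ksign ?M (card {s'\<in>{..<?l}. s' < s}) (xs ! s \<otimes> \<psi> ({..<?l} - {s})))"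
    by (simp add: kdiff_def)
  also have "\<dots> \<in> p"
  proof (rule p.finsum_mem)
    fix s assume "s \<in> {..<?l}"
    then have "xs ! s \<otimes> \<psi> ({..<?l} - {s}) \<in> p"
      using xp kcochains_closed[OF t(2)] by (intro p.I_r_closed) auto
    then show "ksign ?M (card {s'\<in>{..<?l}. s' < s}) (xs ! s \<otimes> \<psi> ({..<?l} - {s})) \<in> p"
      by (simp add: ksign_def)
  qed simp
  finally show False using t(1) by simp
qed

text \<open>The radical as an intersection of primes, read in the localisation at \<open>p\<close>:
  a prime missing all products of an element outside \<open>p\<close> with a power of
  \<open>x\<close> lies inside \<open>p\<close> and omits \<open>x\<close>. Only primes inside
  \<open>p\<close> are therefore tested, which are the ones that Kronecker's theorem controls
  here.\<close>

lemma (in cring) radical_at_prime: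
  assumes p: "primeideal p R" and x: "x \<in> carrier R" and ys: "set ys \<subseteq> carrier R"
    and Q: "\<And>Q. primeideal Q R \<Longrightarrow> Q \<subseteq> p \<Longrightarrow> set ys \<subseteq> Q \<Longrightarrow> x \<in> Q"
  shows "\<exists>t\<in>carrier R - p. \<exists>N::nat. t \<otimes> x [^] N \<in> Idl (set ys)"
proof (rule ccontr)
  assume *: "\<not> ?thesis"
  let ?T = "{t \<otimes> x [^] (N::nat) | t N. t \<in> carrier R - p}"
  have m: "mult_set R (carrier R - p)" using p by (rule mult_set_prime_compl)
  have mem: "t \<otimes> x [^] (N::nat) \<in> ?T" if "t \<in> carrier R - p" for t N using that by blast
  have T: "mult_set R ?T" unfolding mult_set_def
  proof (intro conjI ballI)
    show "?T \<subseteq> carrier R" using x by auto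
    have one: "\<one> \<in> carrier R - p" using m by (simp add: mult_set_def)
    then show "\<one> \<in> ?T" using mem[OF one, of 0] by simp
    fix u v assume "u \<in> ?T" "v \<in> ?T"
    then obtain s N t N' where u: "u = s \<otimes> x [^] (N::nat)" "s \<in> carrier R - p"
      and v: "v = t \<otimes> x [^] (N'::nat)" "t \<in> carrier R - p" by blast
    have c: "s \<in> carrier R" "t \<in> carrier R" "x [^] N \<in> carrier R" "x [^] N' \<in> carrier R" using u v x by auto
    have "u \<otimes> v = (s \<otimes> t) \<otimes> (x [^] N \<otimes> x [^] N')" unfolding u(1) v(1) using c by (simp add: m_ac)
    also have "\<dots> = (s \<otimes> t) \<otimes> x [^] (N + N')" using x by (simp add: nat_pow_mult)
    finally show "u \<otimes> v \<in> ?T" using mem[of "s \<otimes> t"] m u(2) v(2) by (auto simp: mult_set_def)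
  qed
  have I: "ideal (Idl (set ys)) R" using ys by (rule genideal_ideal)
  have "Idl (set ys) \<inter> ?T = {}" using * by blast
  from prime_disjoint_exists[OF T I this] obtain Q where Q': "primeideal Q R" "Idl (set ys) \<subseteq> Q" "Q \<inter> ?T = {}"
    "\<forall>K. ideal K R \<longrightarrow> Q \<subset> K \<longrightarrow> K \<inter> ?T \<noteq> {}"
    .
  interpret Q: primeideal Q R by fact
  have "Q \<subseteq> p"
  proof
    fix t assume t: "t \<in> Q"
    show "t \<in> p"
    proof (rule ccontr)
      assume "t \<notin> p"
      then have "t \<in> ?T" using mem[of t 0] Q.Icarr[OF t] by simp
      then show False using t Q'(3) by blast
    qed
  qed
  moreover have "set ys \<subseteq> Q" using Q'(2) genideal_self[OF ys] by blast
  ultimately have "x \<in> Q" using Q Q'(1) by blast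
  moreover have "x \<in> ?T" using mem[of \<one> 1] m x by (simp add: mult_set_def)
  ultimately show False using Q'(3) by blast
qed

lemma kacyclic_le_prime_height:
  fixes R :: "'a ring" (structure)
  assumes p: "primeideal p R" and "set xs \<subseteq> p"
    and "kacyclic (ring_module R) (carrier R - p) (nth xs) {..<length xs} n"
  shows "enat n \<le> prime_height R p"
  using assms(2,3)
proof (induction "length xs" arbitrary: xs rule: less_induct)
  case less
  interpret p: primeideal p R by fact
  interpret module R "ring_module R" using module_ring_module[OF p.is_cring] .
  have xc: "set xs \<subseteq> carrier R" using less.prems p.Icarr by auto
  show ?case
  proof (cases "\<zero> \<in> boundary_monoid R (carrier R - p) xs")
    case False
    then obtain c where "\<forall>k\<le>length xs. primeideal (c k) R" "\<forall>k<length xs. c k \<subset> c (Suc k)"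
      "c (length xs) = p"
      using p.boundary_monoid_chain[OF p xc p.zeroideal] by auto
    then have "enat (length xs) \<le> prime_height R p" by (intro prime_height_geI[of _ c]) simp_all
    moreover have "n \<le> length xs" using kacyclic_prime_le_length[OF p less.prems] .
    ultimately show ?thesis by (meson enat_ord_simps(1) order.trans)
  next
    case True
    \<comment> \<open>The boundary monoid of the empty list is \<open>R - p\<close>, which does not
      contain 0, so there is a head to eliminate.\<close>
    then obtain x zs where xs: "xs = x # zs" by (cases xs) auto
    obtain ys where ys: "length ys = length zs" "set ys \<subseteq> p"
      "\<forall>Q. primeideal Q R \<longrightarrow> Q \<subseteq> p \<longrightarrow> set ys \<subseteq> Q \<longrightarrow> \<zero> \<otimes> x \<in> Q \<longrightarrow> set (x # zs) \<subseteq> Q"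
      using p.boundary_monoid_reduce[OF p, of x zs \<zero>] less.prems(1) True unfolding xs by blast
    have yc: "set ys \<subseteq> carrier R" using ys(2) p.Icarr by auto
    have "kacyclic (ring_module R) (carrier R - p) (nth ys) {..<length ys} n"
    proof (rule kacyclic_radical[OF p.mult_set_prime_compl[OF p] xc yc _ less.prems(2)])
      fix y assume y: "y \<in> set xs"
      show "\<exists>t\<in>carrier R - p. \<exists>N::nat. t \<otimes> y [^] N \<in> Idl (set ys)"
      proof (rule p.radical_at_prime[OF p _ yc])
        show "y \<in> carrier R" using y xc by auto
        fix Q assume Q: "primeideal Q R" "Q \<subseteq> p" "set ys \<subseteq> Q"
        interpret Q: primeideal Q R by fact
        have "\<zero> \<otimes> x \<in> Q" using xc xs by simp
        then show "y \<in> Q" using ys(3) Q y xs by blast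
      qed
    qed
    then show ?thesis using less.hyps[of ys] ys xs by simp
  qed
qed

text \<open>A coboundary remains one after localisation: \<open>\<one>\<close> lies outside every
  prime, so acyclicity over \<open>{\<one>}\<close> gives acyclicity at each prime over
  \<open>I\<close>.\<close>

theorem Kgrade_le_ht:
  fixes R :: "'a ring" (structure)
  assumes "cring R" "ideal I R"
  shows "Kgrade R (ring_module R) I \<le> ht R I"
  unfolding ht_def
proof (rule INF_greatest, rule enat_leI)
  fix p n assume p: "p \<in> {P. primeideal P R \<and> I \<subseteq> P}" and n: "enat n \<le> Kgrade R (ring_module R) I"
  then interpret p: primeideal p R by simp
  obtain xs where xs: "set xs \<subseteq> I" "kacyclic (ring_module R) {\<one>} (nth xs) {..<length xs} n"
    using n Kgrade_ge_iff[OF module_ring_module[OF assms(1)] assms(2)] by blast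
  have "{\<one>} \<subseteq> carrier R - p" using p.mult_set_prime_compl[OF p.primeideal] by (simp add: mult_set_def)
  then show "enat n \<le> prime_height R p"
    using p xs by (intro kacyclic_le_prime_height[OF p.primeideal _ kacyclic_mono]) auto
qed

section \<open>Heights under ring homomorphisms\<close>

abbreviation contract :: "('a, 'r) ring_scheme \<Rightarrow> ('a \<Rightarrow> 'b) \<Rightarrow> 'b set \<Rightarrow> 'a set" where
  "contract A g P \<equiv> {a \<in> carrier A. g a \<in> P}"

lemma primeideal_contract:
  assumes "cring A" "cring S" "g \<in> ring_hom A S" "primeideal P S"
  shows "primeideal (contract A g P) A"
proof -
  interpret ring_hom_ring A S g
    using assms by (intro ring_hom_ringI2) (auto simp: cring_def)
  show ?thesis using primeideal_vimage assms by blast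
qed

text \<open>Chains are lifted from the top downwards, each new prime being found below the previous
  one. The inclusions are strict because the contractions differ.\<close>

lemma chain_going_down:
  assumes gd: "going_down A S g"
    and c: "\<And>k. k \<le> n \<Longrightarrow> primeideal (c k) A" "\<And>k. k < n \<Longrightarrow> c k \<subset> c (Suc k)"
    and P: "primeideal P S" "contract A g P = c n"
  shows "\<exists>d. (\<forall>k\<le>n. primeideal (d k) S) \<and> (\<forall>k<n. d k \<subset> d (Suc k)) \<and> d n = P"
  using c P
proof (induction n arbitrary: P)
  case 0
  then show ?case by (intro exI[of _ "\<lambda>_. P"]) simp
next
  case (Suc n)
  have "primeideal (c n) A" "primeideal (c (Suc n)) A" "c n \<subset> c (Suc n)" using Suc.prems by simp_all
  then obtain q where q: "primeideal q S" "q \<subseteq> P" "contract A g q = c n"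
    using gd[unfolded going_down_def, rule_format, of "c n" "c (Suc n)" P] Suc.prems(3,4) by auto
  obtain d where d: "\<forall>k\<le>n. primeideal (d k) S" "\<forall>k<n. d k \<subset> d (Suc k)" "d n = q"
    using Suc.IH[OF _ _ q(1,3)] Suc.prems by auto
  have "q \<noteq> P" using q(3) Suc.prems(4) \<open>c n \<subset> c (Suc n)\<close> by auto
  then show ?case
    using d q(2) Suc.prems(3) by (intro exI[of _ "d(Suc n := P)"]) (auto simp: less_Suc_eq le_Suc_eq)
qed

lemma ht_le_going_down:
  assumes "cring A" "cring S" "g \<in> ring_hom A S" "going_down A S g" "ideal I A"
  shows "ht A I \<le> ht S (Idl\<^bsub>S\<^esub> (g ` I))"
  unfolding ht_def[of S]
proof (rule INF_greatest)
  fix P assume P: "P \<in> {P. primeideal P S \<and> Idl\<^bsub>S\<^esub> (g ` I) \<subseteq> P}"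
  let ?p = "contract A g P"
  interpret S: cring S by fact
  have P': "primeideal P S" "Idl\<^bsub>S\<^esub> (g ` I) \<subseteq> P" using P by simp_all
  have p: "primeideal ?p A" by (rule primeideal_contract[OF assms(1-3) P'(1)])
  have Ic: "I \<subseteq> carrier A" using ideal.Icarr[OF assms(5)] by (rule subsetI)
  then have "g ` I \<subseteq> carrier S" using ring_hom_closed[OF assms(3)] by auto
  then have "g ` I \<subseteq> P" using S.genideal_self P'(2) by (meson subset_trans)
  then have "I \<subseteq> ?p" using Ic by blast
  then have "ht A I \<le> prime_height A ?p" unfolding ht_def using p by (intro INF_lower) simp
  also have "\<dots> \<le> prime_height S P"
  proof (rule prime_height_leI)
    fix n c assume c: "\<And>k. k \<le> n \<Longrightarrow> primeideal (c k) A" "\<And>k. k < n \<Longrightarrow> c k \<subset> c (Suc k)" "c n = ?p"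
    obtain d where "\<forall>k\<le>n. primeideal (d k) S" "\<forall>k<n. d k \<subset> d (Suc k)" "d n = P"
      using chain_going_down[where c = c and n = n and P = P, OF assms(4) c(1,2) P'(1)] c(3) by auto
    then show "enat n \<le> prime_height S P" by (intro prime_height_geI[of _ d]) simp_all
  qed
  finally show "ht A I \<le> prime_height S P" .
qed

section \<open>Lying over and incomparability\<close>

lemma (in cring) scaled_integral_equation:
  fixes n :: nat
  assumes r: "r \<in> carrier R" and a: "a \<in> carrier R" and c: "\<And>i. i < n \<Longrightarrow> c i \<in> carrier R"
    and eq: "r [^] n \<oplus> (\<Oplus>i\<in>{..<n}. c i \<otimes> r [^] i) = \<zero>"
  shows "(r \<otimes> a) [^] n \<oplus> (\<Oplus>i\<in>{..<n}. c i \<otimes> a [^] (n - i) \<otimes> (r \<otimes> a) [^] i) = \<zero>"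
proof -
  \<comment> \<open>The factor \<open>a [^] n\<close> is split so that \<open>r [^] i\<close> takes
    \<open>i\<close> copies of \<open>a\<close> and the coefficient takes the other
    \<open>n - i\<close>. For \<open>a\<close> in an ideal, all coefficients except the leading one
    then lie in that ideal.\<close>
  have summand: "c i \<otimes> a [^] (n - i) \<otimes> (r \<otimes> a) [^] i = a [^] n \<otimes> (c i \<otimes> r [^] i)" if i: "i < n" for i
  proof -
    have "a [^] n = a [^] (n - i) \<otimes> a [^] i" using i a by (simp add: nat_pow_mult)
    then show ?thesis using c[OF i] a r by (simp add: nat_pow_distrib m_ac)
  qed
  have "(\<Oplus>i\<in>{..<n}. c i \<otimes> a [^] (n - i) \<otimes> (r \<otimes> a) [^] i) = (\<Oplus>i\<in>{..<n}. a [^] n \<otimes> (c i \<otimes> r [^] i))"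
    using summand c a r by (intro finsum_cong') auto
  also have "\<dots> = a [^] n \<otimes> (\<Oplus>i\<in>{..<n}. c i \<otimes> r [^] i)"
    using c a r by (intro finsum_rdistr[symmetric]) auto
  finally have "(r \<otimes> a) [^] n \<oplus> (\<Oplus>i\<in>{..<n}. c i \<otimes> a [^] (n - i) \<otimes> (r \<otimes> a) [^] i) =
      a [^] n \<otimes> r [^] n \<oplus> a [^] n \<otimes> (\<Oplus>i\<in>{..<n}. c i \<otimes> r [^] i)"
    using a r by (simp add: nat_pow_distrib m_comm)
  also have "\<dots> = a [^] n \<otimes> (r [^] n \<oplus> (\<Oplus>i\<in>{..<n}. c i \<otimes> r [^] i))"
    using a r c by (intro r_distr[symmetric]) auto
  finally show ?thesis using eq a by simp
qed

lemma (in ring_hom_cring) hom_monic_eval: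
  fixes n :: nat
  assumes "r \<in> carrier R" "\<And>i. i < n \<Longrightarrow> c i \<in> carrier R"
  shows "h (r [^]\<^bsub>R\<^esub> n \<oplus>\<^bsub>R\<^esub> (\<Oplus>\<^bsub>R\<^esub> i\<in>{..<n}. c i \<otimes>\<^bsub>R\<^esub> r [^]\<^bsub>R\<^esub> i)) =
    h r [^]\<^bsub>S\<^esub> n \<oplus>\<^bsub>S\<^esub> (\<Oplus>\<^bsub>S\<^esub> i\<in>{..<n}. h (c i) \<otimes>\<^bsub>S\<^esub> h r [^]\<^bsub>S\<^esub> i)"
proof -
  have cl: "(\<lambda>i. c i \<otimes>\<^bsub>R\<^esub> r [^]\<^bsub>R\<^esub> i) \<in> {..<n} \<rightarrow> carrier R" using assms by auto
  have "h (r [^]\<^bsub>R\<^esub> n \<oplus>\<^bsub>R\<^esub> (\<Oplus>\<^bsub>R\<^esub> i\<in>{..<n}. c i \<otimes>\<^bsub>R\<^esub> r [^]\<^bsub>R\<^esub> i)) =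
      h (r [^]\<^bsub>R\<^esub> n) \<oplus>\<^bsub>S\<^esub> (\<Oplus>\<^bsub>S\<^esub> i\<in>{..<n}. h (c i \<otimes>\<^bsub>R\<^esub> r [^]\<^bsub>R\<^esub> i))"
    using hom_finsum[OF cl] R.finsum_closed[OF cl] assms(1) by (simp add: comp_def)
  also have "(\<Oplus>\<^bsub>S\<^esub> i\<in>{..<n}. h (c i \<otimes>\<^bsub>R\<^esub> r [^]\<^bsub>R\<^esub> i)) = (\<Oplus>\<^bsub>S\<^esub> i\<in>{..<n}. h (c i) \<otimes>\<^bsub>S\<^esub> h r [^]\<^bsub>S\<^esub> i)"
    using assms by (intro S.finsum_cong') (auto simp: ring.hom_nat_pow)
  finally show ?thesis using assms(1) by (simp add: ring.hom_nat_pow)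
qed

text \<open>The element \<open>r\<close> need not come from the source ring, but its multiple by
  \<open>h a\<close> does. Scaling the equation therefore gives a monic expression in
  \<open>b\<close> with coefficients in the source ring that lies in the kernel.\<close>

lemma (in ring_hom_cring) hom_scaled_integral_equation:
  fixes n :: nat
  assumes r: "r \<in> carrier S" and a: "a \<in> carrier R" and b: "b \<in> carrier R" "h b = r \<otimes>\<^bsub>S\<^esub> h a"
    and c: "\<And>i. i < n \<Longrightarrow> c i \<in> carrier R"
    and eq: "r [^]\<^bsub>S\<^esub> n \<oplus>\<^bsub>S\<^esub> (\<Oplus>\<^bsub>S\<^esub> i\<in>{..<n}. h (c i) \<otimes>\<^bsub>S\<^esub> r [^]\<^bsub>S\<^esub> i) = \<zero>\<^bsub>S\<^esub>"
  shows "h (b [^]\<^bsub>R\<^esub> n \<oplus>\<^bsub>R\<^esub> (\<Oplus>\<^bsub>R\<^esub> i\<in>{..<n}. (c i \<otimes>\<^bsub>R\<^esub> a [^]\<^bsub>R\<^esub> (n - i)) \<otimes>\<^bsub>R\<^esub> b [^]\<^bsub>R\<^esub> i)) = \<zero>\<^bsub>S\<^esub>"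
proof -
  have "h (b [^]\<^bsub>R\<^esub> n \<oplus>\<^bsub>R\<^esub> (\<Oplus>\<^bsub>R\<^esub> i\<in>{..<n}. (c i \<otimes>\<^bsub>R\<^esub> a [^]\<^bsub>R\<^esub> (n - i)) \<otimes>\<^bsub>R\<^esub> b [^]\<^bsub>R\<^esub> i)) =
      h b [^]\<^bsub>S\<^esub> n \<oplus>\<^bsub>S\<^esub> (\<Oplus>\<^bsub>S\<^esub> i\<in>{..<n}. h (c i \<otimes>\<^bsub>R\<^esub> a [^]\<^bsub>R\<^esub> (n - i)) \<otimes>\<^bsub>S\<^esub> h b [^]\<^bsub>S\<^esub> i)"
    using a b c by (intro hom_monic_eval) auto
  also have "(\<Oplus>\<^bsub>S\<^esub> i\<in>{..<n}. h (c i \<otimes>\<^bsub>R\<^esub> a [^]\<^bsub>R\<^esub> (n - i)) \<otimes>\<^bsub>S\<^esub> h b [^]\<^bsub>S\<^esub> i) =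
      (\<Oplus>\<^bsub>S\<^esub> i\<in>{..<n}. h (c i) \<otimes>\<^bsub>S\<^esub> h a [^]\<^bsub>S\<^esub> (n - i) \<otimes>\<^bsub>S\<^esub> h b [^]\<^bsub>S\<^esub> i)"
    using a b(1) c by (intro S.finsum_cong') (auto simp: ring.hom_nat_pow)
  also have "h b [^]\<^bsub>S\<^esub> n \<oplus>\<^bsub>S\<^esub> \<dots> = \<zero>\<^bsub>S\<^esub>"
    unfolding b(2) using r a c eq by (intro S.scaled_integral_equation) auto
  finally show ?thesis .
qed

text \<open>Taking \<open>P\<close> maximal among the ideals over \<open>I\<close> avoiding the image of \<open>A - p\<close> avoids the
  determinant trick: if \<open>a \<in> p\<close> were not in the contraction of \<open>P\<close>, some \<open>b \<notin> p\<close> would satisfy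
  \<open>g b \<equiv> r g a\<close> modulo \<open>P\<close>, and an integral equation of \<open>r\<close> scaled by \<open>a\<^sup>n\<close> puts \<open>b\<^sup>n\<close> into \<open>p\<close>.\<close>

lemma lying_over:
  assumes "cring A" "cring S" "g \<in> ring_hom A S" and int: "\<And>x. x \<in> carrier S \<Longrightarrow> integral_over A S g x"
    and I: "ideal I S" and p: "primeideal p A" and Ip: "contract A g I \<subseteq> p"
  shows "\<exists>P. primeideal P S \<and> I \<subseteq> P \<and> contract A g P = p"
proof -
  interpret A: cring A by fact
  interpret S: cring S by fact
  interpret g: ring_hom_cring A S g
    by (rule UnivPoly.ring_hom_cringI[OF assms(1-3)])
  interpret p: primeideal p A by fact
  let ?T = "g ` (carrier A - p)"
  have m: "mult_set A (carrier A - p)" using A.mult_set_prime_compl[OF p] .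
  have T: "mult_set S ?T" unfolding mult_set_def
  proof (intro conjI ballI)
    show "?T \<subseteq> carrier S" by auto
    have "\<one>\<^bsub>A\<^esub> \<in> carrier A - p" using m by (simp add: mult_set_def)
    then show "\<one>\<^bsub>S\<^esub> \<in> ?T" using g.hom_one by force
    fix u v assume "u \<in> ?T" "v \<in> ?T"
    then obtain a b where ab: "a \<in> carrier A - p" "b \<in> carrier A - p" "u = g a" "v = g b" by blast
    then have "u \<otimes>\<^bsub>S\<^esub> v = g (a \<otimes>\<^bsub>A\<^esub> b)" by simp
    moreover have "a \<otimes>\<^bsub>A\<^esub> b \<in> carrier A - p" using m ab unfolding mult_set_def by blast
    ultimately show "u \<otimes>\<^bsub>S\<^esub> v \<in> ?T" by blast
  qed
  have "I \<inter> ?T = {}" using Ip by blast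
  from S.prime_disjoint_exists[OF T I this] obtain P where P: "primeideal P S" "I \<subseteq> P" "P \<inter> ?T = {}"
    "\<forall>K. ideal K S \<longrightarrow> P \<subset> K \<longrightarrow> K \<inter> ?T \<noteq> {}" .
  interpret P: primeideal P S by fact
  have sub: "contract A g P \<subseteq> p" using P(3) by blast
  have "a \<in> contract A g P" if a: "a \<in> p" for a
  proof (rule ccontr)
    assume na: "a \<notin> contract A g P"
    have ac: "a \<in> carrier A" using a p.Icarr by blast
    then have gac: "g a \<in> carrier S" "g a \<notin> P" using na by auto
    from S.ideal_adjoin[OF P.is_ideal gac(1)] obtain K where K: "ideal K S" "P \<subseteq> K" "g a \<in> K"
      "\<forall>s\<in>K. \<exists>u\<in>P. \<exists>r\<in>carrier S. s = u \<oplus>\<^bsub>S\<^esub> r \<otimes>\<^bsub>S\<^esub> g a" .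
    have "P \<subset> K" using K(2,3) gac(2) by blast
    then have "K \<inter> ?T \<noteq> {}" using P(4) K(1) by simp
    then obtain b where b: "b \<in> carrier A" "b \<notin> p" "g b \<in> K" by blast
    then obtain u r where u: "u \<in> P" "r \<in> carrier S" "g b = u \<oplus>\<^bsub>S\<^esub> r \<otimes>\<^bsub>S\<^esub> g a" using K(4) by metis
    obtain n c where c: "\<forall>i<n. c i \<in> carrier A"
      "r [^]\<^bsub>S\<^esub> (n::nat) \<oplus>\<^bsub>S\<^esub> (\<Oplus>\<^bsub>S\<^esub> i\<in>{..<n}. g (c i) \<otimes>\<^bsub>S\<^esub> r [^]\<^bsub>S\<^esub> i) = \<zero>\<^bsub>S\<^esub>"
      using int[OF u(2)] unfolding integral_over_def by blast
    let ?D = "S Quot P" and ?h = "(+>\<^bsub>S\<^esub>) P"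
    have h: "ring_hom_cring S ?D ?h" by (rule P.rcos_ring_hom_cring)
    have D: "cring ?D" using h by (simp add: ring_hom_cring_def)
    have hhom: "?h \<in> ring_hom S ?D" by (rule P.rcos_ring_hom)
    have hg: "ring_hom_cring A ?D (?h \<circ> g)"
      by (rule UnivPoly.ring_hom_cringI[OF assms(1) D ring_hom_trans[OF assms(3) hhom]])
    have zD: "\<zero>\<^bsub>?D\<^esub> = P" by (simp add: FactRing_def)
    have hP: "?h x = P \<longleftrightarrow> x \<in> P" if "x \<in> carrier S" for x
      using P.rcos_const_imp_mem[OF that] P.a_rcos_const[of x] by metis
    have hb: "(?h \<circ> g) b = ?h r \<otimes>\<^bsub>?D\<^esub> (?h \<circ> g) a"
    proof -
      have "?h (g b) = ?h u \<oplus>\<^bsub>?D\<^esub> ?h r \<otimes>\<^bsub>?D\<^esub> ?h (g a)"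
        unfolding u(3) using u(2) gac P.Icarr[OF u(1)] ring_hom_add[OF hhom] ring_hom_mult[OF hhom] by simp
      also have "?h u = \<zero>\<^bsub>?D\<^esub>" using hP[of u] u(1) P.Icarr[OF u(1)] zD by simp
      finally show ?thesis
        using cring.cring_simprules(8)[OF D] cring.cring_simprules(5)[OF D] ring_hom_closed[OF hhom] u(2) gac by simp
    qed
    let ?z = "b [^]\<^bsub>A\<^esub> n \<oplus>\<^bsub>A\<^esub> (\<Oplus>\<^bsub>A\<^esub> i\<in>{..<n}. c i \<otimes>\<^bsub>A\<^esub> a [^]\<^bsub>A\<^esub> (n - i) \<otimes>\<^bsub>A\<^esub> b [^]\<^bsub>A\<^esub> i)"
    have sc: "(\<Oplus>\<^bsub>A\<^esub> i\<in>{..<n}. c i \<otimes>\<^bsub>A\<^esub> a [^]\<^bsub>A\<^esub> (n - i) \<otimes>\<^bsub>A\<^esub> b [^]\<^bsub>A\<^esub> i) \<in> carrier A"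
      using c(1) ac b by (intro A.finsum_closed) simp
    have zc: "?z \<in> carrier A" using sc b by simp
    have eqD: "?h r [^]\<^bsub>?D\<^esub> n \<oplus>\<^bsub>?D\<^esub> (\<Oplus>\<^bsub>?D\<^esub> i\<in>{..<n}. (?h \<circ> g) (c i) \<otimes>\<^bsub>?D\<^esub> ?h r [^]\<^bsub>?D\<^esub> i) = \<zero>\<^bsub>?D\<^esub>"
      using ring_hom_cring.hom_monic_eval[OF h u(2), of n "\<lambda>i. g (c i)"] c hP[of "\<zero>\<^bsub>S\<^esub>"] zD by simp
    have "(?h \<circ> g) ?z = \<zero>\<^bsub>?D\<^esub>"
      using ring_hom_closed[OF hhom u(2)] c(1)
      by (intro ring_hom_cring.hom_scaled_integral_equation[OF hg _ ac b(1) hb _ eqD]) simp_all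
    then have "?h (g ?z) = P" using zD by simp
    then have "g ?z \<in> P" using hP[of "g ?z"] g.hom_closed[OF zc] by blast
    then have zp: "?z \<in> p" using sub zc by blast
    \<comment> \<open>Every exponent \<open>n - i\<close> is at least 1 because
      \<open>i < n\<close>, so each summand has a factor \<open>a\<close>, which lies in
      \<open>p\<close>.\<close>
    have sp: "(\<Oplus>\<^bsub>A\<^esub> i\<in>{..<n}. c i \<otimes>\<^bsub>A\<^esub> a [^]\<^bsub>A\<^esub> (n - i) \<otimes>\<^bsub>A\<^esub> b [^]\<^bsub>A\<^esub> i) \<in> p"
    proof (rule p.finsum_mem)
      fix i assume i: "i \<in> {..<n}"
      then obtain k where k: "n - i = Suc k" by (metis Suc_diff_Suc lessThan_iff)
      have "a [^]\<^bsub>A\<^esub> (n - i) \<in> p" unfolding k using a ac by (simp add: p.I_l_closed)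
      then show "c i \<otimes>\<^bsub>A\<^esub> a [^]\<^bsub>A\<^esub> (n - i) \<otimes>\<^bsub>A\<^esub> b [^]\<^bsub>A\<^esub> i \<in> p"
        using c i b by (intro p.I_r_closed p.I_l_closed) auto
    qed simp
    have "b [^]\<^bsub>A\<^esub> n = ?z \<oplus>\<^bsub>A\<^esub> \<ominus>\<^bsub>A\<^esub> (\<Oplus>\<^bsub>A\<^esub> i\<in>{..<n}. c i \<otimes>\<^bsub>A\<^esub> a [^]\<^bsub>A\<^esub> (n - i) \<otimes>\<^bsub>A\<^esub> b [^]\<^bsub>A\<^esub> i)"
      using sc b by (simp add: A.a_assoc A.r_neg)
    also have "\<dots> \<in> p" by (rule p.a_closed[OF zp p.a_inv_closed[OF sp]])
    finally show False using p.pow_mem_imp b by blast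
  qed
  then have "contract A g P = p" using sub by blast
  then show ?thesis using P by blast
qed

text \<open>For \<open>x\<close> in \<open>P\<close> but not in \<open>Q\<close>, no monic
  expression in \<open>x\<close> over \<open>A\<close> lies in \<open>Q\<close> if the contractions
  agree. Its constant term would lie in \<open>P\<close>, hence in \<open>Q\<close>; removing it and
  cancelling \<open>x\<close> modulo the prime \<open>Q\<close> lowers the degree, down to the
  expression 1. An integral equation of \<open>x\<close> contradicts this.\<close>

lemma incomparability:
  assumes "cring A" "cring S" "g \<in> ring_hom A S" and int: "\<And>x. x \<in> carrier S \<Longrightarrow> integral_over A S g x"
    and Q: "primeideal Q S" and P: "primeideal P S" and QP: "Q \<subset> P"
  shows "contract A g Q \<subset> contract A g P"
proof (rule ccontr)
  interpret A: cring A by fact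
  interpret S: cring S by fact
  interpret g: ring_hom_cring A S g
    by (rule UnivPoly.ring_hom_cringI[OF assms(1-3)])
  interpret Q: primeideal Q S by fact
  interpret P: primeideal P S by fact
  assume "\<not> contract A g Q \<subset> contract A g P"
  then have eq: "contract A g Q = contract A g P" using QP by blast
  obtain x where x: "x \<in> P" "x \<notin> Q" using QP by blast
  then have xc: "x \<in> carrier S" using P.Icarr by blast
  have no: "x [^]\<^bsub>S\<^esub> n \<oplus>\<^bsub>S\<^esub> (\<Oplus>\<^bsub>S\<^esub> i\<in>{..<n}. g (c i) \<otimes>\<^bsub>S\<^esub> x [^]\<^bsub>S\<^esub> i) \<notin> Q"
    if "\<And>i. i < n \<Longrightarrow> c i \<in> carrier A" for n :: nat and c
    using that
  proof (induction n arbitrary: c)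
    case 0
    then show ?case using Q.one_imp_carrier Q.I_notcarr by auto
  next
    case (Suc n)
    let ?y = "x [^]\<^bsub>S\<^esub> n \<oplus>\<^bsub>S\<^esub> (\<Oplus>\<^bsub>S\<^esub> i\<in>{..<n}. g (c (Suc i)) \<otimes>\<^bsub>S\<^esub> x [^]\<^bsub>S\<^esub> i)"
    let ?f = "\<lambda>i. g (c i) \<otimes>\<^bsub>S\<^esub> x [^]\<^bsub>S\<^esub> i"
    have fc: "?f i \<in> carrier S" if "i < Suc n" for i using that Suc.prems xc by auto
    have sc: "(\<Oplus>\<^bsub>S\<^esub> i\<in>{..<n}. g (c (Suc i)) \<otimes>\<^bsub>S\<^esub> x [^]\<^bsub>S\<^esub> i) \<in> carrier S"
      using Suc.prems xc by (intro S.finsum_closed) auto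
    then have yc: "?y \<in> carrier S" using xc by simp
    have c0: "g (c 0) \<in> carrier S" using Suc.prems by simp
    have "finsum S ?f {..<Suc n} = finsum S ?f (insert 0 (Suc ` {..<n}))"
      by (simp only: lessThan_Suc_eq_insert_0)
    also have "\<dots> = ?f 0 \<oplus>\<^bsub>S\<^esub> finsum S ?f (Suc ` {..<n})"
      using fc c0 by (intro S.finsum_insert) auto
    also have "finsum S ?f (Suc ` {..<n}) = (\<Oplus>\<^bsub>S\<^esub> i\<in>{..<n}. ?f (Suc i))"
      using fc by (intro S.finsum_reindex) auto
    also have "\<dots> = (\<Oplus>\<^bsub>S\<^esub> i\<in>{..<n}. x \<otimes>\<^bsub>S\<^esub> (g (c (Suc i)) \<otimes>\<^bsub>S\<^esub> x [^]\<^bsub>S\<^esub> i))"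
      using Suc.prems xc by (intro S.finsum_cong') (auto simp: S.m_ac)
    also have "\<dots> = x \<otimes>\<^bsub>S\<^esub> (\<Oplus>\<^bsub>S\<^esub> i\<in>{..<n}. g (c (Suc i)) \<otimes>\<^bsub>S\<^esub> x [^]\<^bsub>S\<^esub> i)"
      using Suc.prems xc by (intro S.finsum_rdistr[symmetric]) auto
    finally have s: "finsum S ?f {..<Suc n} = g (c 0) \<oplus>\<^bsub>S\<^esub> x \<otimes>\<^bsub>S\<^esub> (\<Oplus>\<^bsub>S\<^esub> i\<in>{..<n}. g (c (Suc i)) \<otimes>\<^bsub>S\<^esub> x [^]\<^bsub>S\<^esub> i)"
      using c0 by simp
    have e: "x [^]\<^bsub>S\<^esub> Suc n \<oplus>\<^bsub>S\<^esub> finsum S ?f {..<Suc n} = g (c 0) \<oplus>\<^bsub>S\<^esub> x \<otimes>\<^bsub>S\<^esub> ?y"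
      unfolding s using c0 xc sc by (simp add: S.r_distr S.a_ac S.m_comm)
    show ?case
    proof
      assume "x [^]\<^bsub>S\<^esub> Suc n \<oplus>\<^bsub>S\<^esub> finsum S ?f {..<Suc n} \<in> Q"
      then have m: "g (c 0) \<oplus>\<^bsub>S\<^esub> x \<otimes>\<^bsub>S\<^esub> ?y \<in> Q" unfolding e .
      have "g (c 0) = (g (c 0) \<oplus>\<^bsub>S\<^esub> x \<otimes>\<^bsub>S\<^esub> ?y) \<oplus>\<^bsub>S\<^esub> \<ominus>\<^bsub>S\<^esub> (x \<otimes>\<^bsub>S\<^esub> ?y)"
        using c0 xc yc by (simp add: S.a_assoc S.r_neg)
      also have "\<dots> \<in> P"
        using m QP by (intro P.a_closed[OF _ P.a_inv_closed[OF P.I_r_closed[OF x(1) yc]]]) blast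
      finally have "c 0 \<in> contract A g Q" using eq Suc.prems by blast
      then have g0: "g (c 0) \<in> Q" by blast
      have "x \<otimes>\<^bsub>S\<^esub> ?y = \<ominus>\<^bsub>S\<^esub> g (c 0) \<oplus>\<^bsub>S\<^esub> (g (c 0) \<oplus>\<^bsub>S\<^esub> x \<otimes>\<^bsub>S\<^esub> ?y)"
        using c0 xc yc by (simp add: S.l_neg flip: S.a_assoc)
      also have "\<dots> \<in> Q" by (rule Q.a_closed[OF Q.a_inv_closed[OF g0] m])
      finally have "?y \<in> Q" using Q.I_prime[OF xc yc] x(2) by blast
      then show False using Suc.IH[of "\<lambda>i. c (Suc i)"] Suc.prems by simp
    qed
  qed
  obtain n c where c: "\<forall>i<n. c i \<in> carrier A"
    "x [^]\<^bsub>S\<^esub> (n::nat) \<oplus>\<^bsub>S\<^esub> (\<Oplus>\<^bsub>S\<^esub> i\<in>{..<n}. g (c i) \<otimes>\<^bsub>S\<^esub> x [^]\<^bsub>S\<^esub> i) = \<zero>\<^bsub>S\<^esub>"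
    using int[OF xc] unfolding integral_over_def by blast
  show False using no[of n c] c Q.zero_closed by simp
qed

text \<open>Each prime over the contraction of \<open>I\<close> comes from a prime over
  \<open>I\<close> by lying over, and a chain below that prime stays strict under contraction by
  incomparability.\<close>

lemma ht_le_ht_contract:
  assumes "cring A" "cring S" "g \<in> ring_hom A S" and int: "\<And>x. x \<in> carrier S \<Longrightarrow> integral_over A S g x"
    and I: "ideal I S"
  shows "ht S I \<le> ht A (contract A g I)"
  unfolding ht_def[of A]
proof (rule INF_greatest)
  fix p assume "p \<in> {P. primeideal P A \<and> contract A g I \<subseteq> P}"
  then obtain P where P: "primeideal P S" "I \<subseteq> P" "contract A g P = p"
    using lying_over[OF assms(1-3) int I] by blast
  have "ht S I \<le> prime_height S P" unfolding ht_def using P by (intro INF_lower) simp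
  also have "\<dots> \<le> prime_height A p"
  proof (rule prime_height_leI)
    fix n c assume c: "\<And>k. k \<le> n \<Longrightarrow> primeideal (c k) S" "\<And>k. k < n \<Longrightarrow> c k \<subset> c (Suc k)" "c n = P"
    show "enat n \<le> prime_height A p"
    proof (rule prime_height_geI[of n "\<lambda>k. contract A g (c k)"])
      show "primeideal (contract A g (c k)) A" if "k \<le> n" for k
        using primeideal_contract[OF assms(1-3) c(1)[OF that]] .
      show "contract A g (c k) \<subset> contract A g (c (Suc k))" if "k < n" for k
        using that c by (intro incomparability[OF assms(1-3) int]) simp_all
      show "contract A g (c n) = p" using c(3) P(3) by simp
    qed
  qed
  finally show "ht S I \<le> prime_height A p" .
qed

section \<open>Amalgamation along an ideal\<close>

lemma module_via_simps [simp]: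
  "carrier (module_via B f J) = J" "Ring.ring.zero (module_via B f J) = Ring.ring.zero B"
  "Ring.ring.add (module_via B f J) = Ring.ring.add B"
  "Module.module.smult (module_via B f J) = (\<lambda>a j. f a \<otimes>\<^bsub>B\<^esub> j)"
  by (simp_all add: module_via_def)

lemma module_module_via:
  assumes "cring A" "cring B" "f \<in> ring_hom A B" "ideal J B"
  shows "module A (module_via B f J)"
proof -
  interpret A: cring A by fact
  interpret B: cring B by fact
  interpret J: ideal J B by fact
  note f = ring_hom_closed[OF assms(3)] and fs = ring_hom_mult[OF assms(3)] ring_hom_add[OF assms(3)]
    ring_hom_one[OF assms(3)]
  have "abelian_group (module_via B f J)"
  proof (rule abelian_groupI)
    fix x assume x: "x \<in> carrier (module_via B f J)"
    then show "\<exists>y\<in>carrier (module_via B f J). y \<oplus>\<^bsub>module_via B f J\<^esub> x = \<zero>\<^bsub>module_via B f J\<^esub>"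
      using J.Icarr by (intro bexI[of _ "\<ominus>\<^bsub>B\<^esub> x"]) (auto simp: B.l_neg)
  qed (auto simp: B.a_ac J.Icarr)
  then show ?thesis
    by (intro moduleI A.is_cring)
      (auto simp: f fs J.Icarr B.l_distr B.r_distr B.m_assoc intro: J.I_l_closed)
qed

lemma kdiff_module_via_carrier:
  "kdiff (module_via S g (carrier S)) x I = kdiff (ring_module S) (\<lambda>t. g (x t)) I"
proof -
  have "ksign (module_via S g (carrier S)) = ksign (ring_module S)"
    by (simp add: ksign_def fun_eq_iff a_inv_def m_inv_def)
  then show ?thesis by (simp add: kdiff_def finsum_def finprod_def fun_eq_iff)
qed

text \<open>Restriction of scalars changes neither the additive group nor the signs, only the way
  the entries act. This links grades over the amalgamation with grades over
  \<open>A\<close>.\<close>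

lemma kacyclic_module_via_carrier:
  "kacyclic (module_via S g (carrier S)) T x I n \<longleftrightarrow> kacyclic (ring_module S) (g ` T) (\<lambda>t. g (x t)) I n"
  by (simp add: kacyclic_def kdiff_module_via_carrier kcochains_def)

section \<open>Koszul acyclicity of retracts and direct sums\<close>

definition module_map :: "('a, 'r) ring_scheme \<Rightarrow> ('a, 'm, 's) module_scheme \<Rightarrow> ('a, 'n, 't) module_scheme
    \<Rightarrow> ('m \<Rightarrow> 'n) \<Rightarrow> bool" where
  "module_map R M N h \<longleftrightarrow> (\<forall>m\<in>carrier M. h m \<in> carrier N) \<and>
    (\<forall>m\<in>carrier M. \<forall>m'\<in>carrier M. h (m \<oplus>\<^bsub>M\<^esub> m') = h m \<oplus>\<^bsub>N\<^esub> h m') \<and>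
    (\<forall>a\<in>carrier R. \<forall>m\<in>carrier M. h (a \<odot>\<^bsub>M\<^esub> m) = a \<odot>\<^bsub>N\<^esub> h m)"

lemma kdiff_module_map:
  assumes "module R M" "module R N" "module_map R M N h" "x ` I \<subseteq> carrier R" "finite I" "\<phi> \<in> kcochains M I i"
  shows "kdiff N x I (\<lambda>S. h (\<phi> S)) = (\<lambda>S. h (kdiff M x I \<phi> S))"
proof (rule kdiff_map[symmetric])
  show "abelian_group M" "abelian_group N" using assms(1,2) by (simp_all add: module_def)
  fix t m assume "t \<in> I" "m \<in> carrier M"
  then show "x t \<odot>\<^bsub>M\<^esub> m \<in> carrier M" using assms(4) module.smult_closed[OF assms(1)] by blast
qed (use assms(3-5) kcochains_closed[OF assms(6)] in \<open>auto simp: module_map_def\<close>)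

lemma module_map_zero:
  assumes "module R M" "module R N" "module_map R M N h"
  shows "h \<zero>\<^bsub>M\<^esub> = \<zero>\<^bsub>N\<^esub>"
  using assms by (intro abelian_group.additive_map_zero[of M N]) (auto simp: module_def module_map_def)

lemma kcochains_module_map:
  assumes "module R M" "module R N" "module_map R M N h" "\<phi> \<in> kcochains M I i"
  shows "(\<lambda>S. h (\<phi> S)) \<in> kcochains N I i"
  using assms(3) kcochains_closed[OF assms(4)] kcochains_zero[OF assms(4)] module_map_zero[OF assms(1-3)]
  by (intro kcochainsI) (auto simp: module_map_def)

text \<open>A cocycle is pushed into \<open>M\<close> by \<open>i\<close>, bounded there, and its
  primitive is brought back by \<open>p\<close>.\<close>

lemma kacyclic_retract:
  assumes M: "module R M" and N: "module R N" and p: "module_map R M N p" and i: "module_map R N M i"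
    and pi: "\<And>m. m \<in> carrier N \<Longrightarrow> p (i m) = m"
    and x: "x ` I \<subseteq> carrier R" "finite I" and T: "T \<subseteq> carrier R"
    and ac: "kacyclic M T x I n"
  shows "kacyclic N T x I n"
  unfolding kacyclic_def
proof (intro allI impI ballI)
  fix j \<phi> assume j: "j < int n" and \<phi>: "\<phi> \<in> kcochains N I j" and d: "kdiff N x I \<phi> = (\<lambda>_. \<zero>\<^bsub>N\<^esub>)"
  have "kdiff M x I (\<lambda>S. i (\<phi> S)) = (\<lambda>_. \<zero>\<^bsub>M\<^esub>)"
    using kdiff_module_map[OF N M i x \<phi>] d module_map_zero[OF N M i] by simp
  then obtain t \<psi> where t: "t \<in> T" "\<psi> \<in> kcochains M I (j - 1)" "(\<lambda>S. t \<odot>\<^bsub>M\<^esub> i (\<phi> S)) = kdiff M x I \<psi>"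
    using kacyclicE[OF ac j kcochains_module_map[OF N M i \<phi>]] by auto
  have "kdiff N x I (\<lambda>S. p (\<psi> S)) = (\<lambda>S. p (t \<odot>\<^bsub>M\<^esub> i (\<phi> S)))"
    using kdiff_module_map[OF M N p x t(2)] t(3) by metis
  also have "\<dots> = (\<lambda>S. t \<odot>\<^bsub>N\<^esub> \<phi> S)"
    using p i t(1) T kcochains_closed[OF \<phi>] pi by (auto simp: module_map_def subset_eq)
  finally show "\<exists>t\<in>T. \<exists>\<psi>\<in>kcochains N I (j - 1). (\<lambda>S. t \<odot>\<^bsub>N\<^esub> \<phi> S) = kdiff N x I \<psi>"
    using t(1) kcochains_module_map[OF M N p t(2)] by metis
qed

text \<open>An endomorphism of \<open>M\<close> that factors through \<open>N\<close> acts as zero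
  on cohomology in the degrees where that of \<open>N\<close> vanishes.\<close>

lemma kcocycle_factor_coboundary:
  assumes M: "module R M" and N: "module R N" and q: "module_map R M N q" and e: "module_map R N M e"
    and x: "x ` I \<subseteq> carrier R" "finite I" and ac: "kacyclic N {\<one>\<^bsub>R\<^esub>} x I n" and j: "j < int n"
    and \<phi>: "\<phi> \<in> kcochains M I j" and d: "kdiff M x I \<phi> = (\<lambda>_. \<zero>\<^bsub>M\<^esub>)"
  shows "\<exists>\<psi>\<in>kcochains M I (j - 1). kdiff M x I \<psi> = (\<lambda>S. e (q (\<phi> S)))"
proof -
  have "kdiff N x I (\<lambda>S. q (\<phi> S)) = (\<lambda>_. \<zero>\<^bsub>N\<^esub>)"
    using kdiff_module_map[OF M N q x \<phi>] d module_map_zero[OF M N q] by simp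
  then obtain t \<psi> where t: "t \<in> {\<one>\<^bsub>R\<^esub>}" "\<psi> \<in> kcochains N I (j - 1)" "(\<lambda>S. t \<odot>\<^bsub>N\<^esub> q (\<phi> S)) = kdiff N x I \<psi>"
    using kacyclicE[OF ac j kcochains_module_map[OF M N q \<phi>]] by auto
  have "(\<lambda>S. t \<odot>\<^bsub>N\<^esub> q (\<phi> S)) = (\<lambda>S. q (\<phi> S))"
    using t(1) module.smult_one[OF N] kcochains_closed[OF kcochains_module_map[OF M N q \<phi>]] by simp
  then have "kdiff M x I (\<lambda>S. e (\<psi> S)) = (\<lambda>S. e (q (\<phi> S)))"
    using kdiff_module_map[OF N M e x t(2)] t(3) by metis
  then show ?thesis using kcochains_module_map[OF N M e t(2)] by blast
qed

text \<open>The identity of \<open>M\<close> is a sum of two endomorphisms, each factoring through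
  one summand. With \<open>\<one>\<close> as the only denominator, the two primitives can simply be
  added.\<close>

lemma kacyclic_direct_sum:
  assumes M: "module R M" and N1: "module R N1" and N2: "module R N2"
    and p: "module_map R M N1 p1" "module_map R M N2 p2"
    and i: "module_map R N1 M i1" "module_map R N2 M i2"
    and sum: "\<And>m. m \<in> carrier M \<Longrightarrow> i1 (p1 m) \<oplus>\<^bsub>M\<^esub> i2 (p2 m) = m"
    and x: "x ` I \<subseteq> carrier R" "finite I"
    and ac1: "kacyclic N1 {\<one>\<^bsub>R\<^esub>} x I n" and ac2: "kacyclic N2 {\<one>\<^bsub>R\<^esub>} x I n"
  shows "kacyclic M {\<one>\<^bsub>R\<^esub>} x I n"
  unfolding kacyclic_def
proof (intro allI impI ballI)
  fix j \<phi> assume j: "j < int n" and \<phi>: "\<phi> \<in> kcochains M I j" and d: "kdiff M x I \<phi> = (\<lambda>_. \<zero>\<^bsub>M\<^esub>)"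
  interpret module R M by fact
  obtain \<psi>1 where 1: "\<psi>1 \<in> kcochains M I (j - 1)" "kdiff M x I \<psi>1 = (\<lambda>S. i1 (p1 (\<phi> S)))"
    using kcocycle_factor_coboundary[OF M N1 p(1) i(1) x ac1 j \<phi> d] by blast
  obtain \<psi>2 where 2: "\<psi>2 \<in> kcochains M I (j - 1)" "kdiff M x I \<psi>2 = (\<lambda>S. i2 (p2 (\<phi> S)))"
    using kcocycle_factor_coboundary[OF M N2 p(2) i(2) x ac2 j \<phi> d] by blast
  have "kdiff M x I (\<lambda>S. \<psi>1 S \<oplus>\<^bsub>M\<^esub> \<psi>2 S) = (\<lambda>S. \<one>\<^bsub>R\<^esub> \<odot>\<^bsub>M\<^esub> \<phi> S)"
    using kdiff_add[OF x(1) kcochains_closed[OF 1(1)] kcochains_closed[OF 2(1)]] 1(2) 2(2)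
      sum kcochains_closed[OF \<phi>] by simp
  then show "\<exists>t\<in>{\<one>\<^bsub>R\<^esub>}. \<exists>\<psi>\<in>kcochains M I (j - 1). (\<lambda>S. t \<odot>\<^bsub>M\<^esub> \<phi> S) = kdiff M x I \<psi>"
    using kcochains_add[OF 1(1) 2(1)] by (metis singletonI)
qed

text \<open>The union of the ideals generated by finite subsets of \<open>G\<close> is itself an
  ideal. A finite sequence in an extended ideal can thus be traded for images of finitely many
  elements downstairs, although its own entries need not be such images.\<close>

lemma (in ring) genideal_finitely_supported:
  assumes G: "G \<subseteq> carrier R" and F: "finite F" "F \<subseteq> Idl G"
  shows "\<exists>Y. finite Y \<and> Y \<subseteq> G \<and> F \<subseteq> Idl Y"
proof -
  let ?U = "{z. \<exists>Y. finite Y \<and> Y \<subseteq> G \<and> z \<in> Idl Y}"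
  have mono: "Idl Y \<subseteq> Idl (Y \<union> Z)" "Idl Z \<subseteq> Idl (Y \<union> Z)" if "Y \<subseteq> G" "Z \<subseteq> G" for Y Z
    using that G subset_Idl_subset[of "Y \<union> Z" Y] subset_Idl_subset[of "Y \<union> Z" Z] by auto
  have idl: "ideal (Idl Y) R" if "Y \<subseteq> G" for Y using that G by (intro genideal_ideal) auto
  have "ideal ?U R"
  proof (rule idealI)
    show "ring R" by (rule ring_axioms)
    show "subgroup ?U (add_monoid R)"
    proof (rule add.subgroupI)
      show "?U \<subseteq> carrier R" using ideal.Icarr[OF idl] by blast
      have "\<zero> \<in> Idl {}" using additive_subgroup.zero_closed[OF ideal.axioms(1)[OF idl[of "{}"]]] by simp
      then show "?U \<noteq> {}" by blast
      show "\<ominus> a \<in> ?U" if "a \<in> ?U" for a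
        using that additive_subgroup.a_inv_closed[OF ideal.axioms(1)[OF idl]] by blast
      fix a b assume "a \<in> ?U" "b \<in> ?U"
      then obtain Y Z where Y: "finite Y" "Y \<subseteq> G" "a \<in> Idl Y" and Z: "finite Z" "Z \<subseteq> G" "b \<in> Idl Z" by blast
      have YZ: "Y \<union> Z \<subseteq> G" using Y(2) Z(2) by blast
      have "a \<oplus> b \<in> Idl (Y \<union> Z)"
        using mono[OF Y(2) Z(2)] Y(3) Z(3) additive_subgroup.a_closed[OF ideal.axioms(1)[OF idl[OF YZ]]] by blast
      then show "a \<oplus> b \<in> ?U" using Y(1) Z(1) YZ by blast
    qed
    show "b \<otimes> a \<in> ?U" if "a \<in> ?U" "b \<in> carrier R" for a b
      using that ideal.I_l_closed[OF idl] by blast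
    show "a \<otimes> b \<in> ?U" if "a \<in> ?U" "b \<in> carrier R" for a b
      using that ideal.I_r_closed[OF idl] by blast
  qed
  moreover have "G \<subseteq> ?U"
  proof
    fix z assume "z \<in> G"
    then have "z \<in> Idl {z}" using G by (intro genideal_self') auto
    then show "z \<in> ?U" using \<open>z \<in> G\<close> by blast
  qed
  ultimately have U: "Idl G \<subseteq> ?U" by (rule genideal_minimal)
  show ?thesis using F
  proof (induction F rule: finite_induct)
    case (insert z F)
    obtain Y where Y: "finite Y" "Y \<subseteq> G" "F \<subseteq> Idl Y" using insert by auto
    obtain Z where Z: "finite Z" "Z \<subseteq> G" "z \<in> Idl Z" using insert.prems U by blast
    have "insert z F \<subseteq> Idl (Y \<union> Z)" using mono[OF Y(2) Z(2)] Y(3) Z(3) by blast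
    then show ?case using Y Z by (intro exI[of _ "Y \<union> Z"]) simp
  qed auto
qed

lemma Kgrade_mono: "I \<subseteq> I' \<Longrightarrow> Kgrade R M I \<le> Kgrade R M I'"
  unfolding Kgrade_def by (intro SUP_subset_mono) auto

section \<open>The amalgamation as a ring and as an \<open>A\<close>-module\<close>

locale amalgamation = A: cring A + B: cring B + J: ideal J B
  for A :: "'a ring" and B :: "'b ring" and f :: "'a \<Rightarrow> 'b" and J :: "'b set" +
  assumes f: "f \<in> ring_hom A B"
begin

abbreviation S :: "('a \<times> 'b) ring" where "S \<equiv> amalg A B f J"

lemmas f_closed = ring_hom_closed[OF f]

lemmas f_hom = ring_hom_mult[OF f] ring_hom_add[OF f] ring_hom_one[OF f]
  ring_hom_zero[OF f A.ring_axioms B.ring_axioms]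

lemma amalg_simps [simp]:
  "x \<otimes>\<^bsub>S\<^esub> y = (fst x \<otimes>\<^bsub>A\<^esub> fst y, snd x \<otimes>\<^bsub>B\<^esub> snd y)"
  "x \<oplus>\<^bsub>S\<^esub> y = (fst x \<oplus>\<^bsub>A\<^esub> fst y, snd x \<oplus>\<^bsub>B\<^esub> snd y)"
  "\<one>\<^bsub>S\<^esub> = (\<one>\<^bsub>A\<^esub>, \<one>\<^bsub>B\<^esub>)" "\<zero>\<^bsub>S\<^esub> = (\<zero>\<^bsub>A\<^esub>, \<zero>\<^bsub>B\<^esub>)"
  by (simp_all add: amalg_def)

lemma amalg_carrierE:
  assumes "x \<in> carrier S"
  obtains a j where "a \<in> carrier A" "j \<in> J" "x = (a, f a \<oplus>\<^bsub>B\<^esub> j)"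
  using assms by (auto simp: amalg_def)

lemma amalg_carrierI: "a \<in> carrier A \<Longrightarrow> j \<in> J \<Longrightarrow> (a, f a \<oplus>\<^bsub>B\<^esub> j) \<in> carrier S"
  by (auto simp: amalg_def)

lemma amalg_carrierD: "x \<in> carrier S \<Longrightarrow> fst x \<in> carrier A" "x \<in> carrier S \<Longrightarrow> snd x \<in> carrier B"
  by (auto elim!: amalg_carrierE simp: f_closed J.Icarr)

lemma amalg_carrier_0J: "j \<in> J \<Longrightarrow> (\<zero>\<^bsub>A\<^esub>, j) \<in> carrier S"
  using amalg_carrierI[of "\<zero>\<^bsub>A\<^esub>" j] by (simp add: f_hom J.Icarr)

lemma iota_closed: "a \<in> carrier A \<Longrightarrow> iota f a \<in> carrier S"
  using amalg_carrierI[of a "\<zero>\<^bsub>B\<^esub>"] by (simp add: iota_def f_closed)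

lemma amalg_cring: "cring S"
proof (rule cringI)
  show "abelian_group S"
  proof (rule abelian_groupI)
    fix x y assume xy: "x \<in> carrier S" "y \<in> carrier S"
    obtain a j where x: "a \<in> carrier A" "j \<in> J" "x = (a, f a \<oplus>\<^bsub>B\<^esub> j)" by (rule amalg_carrierE[OF xy(1)])
    obtain b k where y: "b \<in> carrier A" "k \<in> J" "y = (b, f b \<oplus>\<^bsub>B\<^esub> k)" by (rule amalg_carrierE[OF xy(2)])
    have "x \<oplus>\<^bsub>S\<^esub> y = (a \<oplus>\<^bsub>A\<^esub> b, f (a \<oplus>\<^bsub>A\<^esub> b) \<oplus>\<^bsub>B\<^esub> (j \<oplus>\<^bsub>B\<^esub> k))"
      using x y by (simp add: f_hom f_closed J.Icarr B.a_ac)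
    then show "x \<oplus>\<^bsub>S\<^esub> y \<in> carrier S" using x y amalg_carrierI[of "a \<oplus>\<^bsub>A\<^esub> b" "j \<oplus>\<^bsub>B\<^esub> k"] by simp
  next
    show "\<zero>\<^bsub>S\<^esub> \<in> carrier S" using amalg_carrier_0J[of "\<zero>\<^bsub>B\<^esub>"] by simp
  next
    fix x assume x': "x \<in> carrier S"
    obtain a j where x: "a \<in> carrier A" "j \<in> J" "x = (a, f a \<oplus>\<^bsub>B\<^esub> j)" by (rule amalg_carrierE[OF x'])
    have m: "f (\<ominus>\<^bsub>A\<^esub> a) = \<ominus>\<^bsub>B\<^esub> f a"
      using A.additive_map_minus[OF B.abelian_group_axioms, of f a] f_closed f_hom x by simp
    show "\<exists>y\<in>carrier S. y \<oplus>\<^bsub>S\<^esub> x = \<zero>\<^bsub>S\<^esub>"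
    proof
      show "(\<ominus>\<^bsub>A\<^esub> a, f (\<ominus>\<^bsub>A\<^esub> a) \<oplus>\<^bsub>B\<^esub> (\<ominus>\<^bsub>B\<^esub> j)) \<in> carrier S" using x by (intro amalg_carrierI) auto
      have "\<ominus>\<^bsub>B\<^esub> f a \<oplus>\<^bsub>B\<^esub> \<ominus>\<^bsub>B\<^esub> j \<oplus>\<^bsub>B\<^esub> (f a \<oplus>\<^bsub>B\<^esub> j) = \<zero>\<^bsub>B\<^esub>"
        using f_closed[OF x(1)] J.Icarr[OF x(2)] by algebra
      then show "(\<ominus>\<^bsub>A\<^esub> a, f (\<ominus>\<^bsub>A\<^esub> a) \<oplus>\<^bsub>B\<^esub> (\<ominus>\<^bsub>B\<^esub> j)) \<oplus>\<^bsub>S\<^esub> x = \<zero>\<^bsub>S\<^esub>"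
        using x m by (simp add: A.l_neg)
    qed
  qed (simp_all add: amalg_carrierD A.a_ac B.a_ac prod_eq_iff)
  show "comm_monoid S"
  proof (rule comm_monoidI)
    fix x y assume xy: "x \<in> carrier S" "y \<in> carrier S"
    obtain a j where x: "a \<in> carrier A" "j \<in> J" "x = (a, f a \<oplus>\<^bsub>B\<^esub> j)" by (rule amalg_carrierE[OF xy(1)])
    obtain b k where y: "b \<in> carrier A" "k \<in> J" "y = (b, f b \<oplus>\<^bsub>B\<^esub> k)" by (rule amalg_carrierE[OF xy(2)])
    have "(f a \<oplus>\<^bsub>B\<^esub> j) \<otimes>\<^bsub>B\<^esub> (f b \<oplus>\<^bsub>B\<^esub> k) = f a \<otimes>\<^bsub>B\<^esub> f b \<oplus>\<^bsub>B\<^esub> (f a \<otimes>\<^bsub>B\<^esub> k \<oplus>\<^bsub>B\<^esub> j \<otimes>\<^bsub>B\<^esub> (f b \<oplus>\<^bsub>B\<^esub> k))"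
      using f_closed[OF x(1)] f_closed[OF y(1)] J.Icarr[OF x(2)] J.Icarr[OF y(2)] by algebra
    then have "x \<otimes>\<^bsub>S\<^esub> y = (a \<otimes>\<^bsub>A\<^esub> b, f (a \<otimes>\<^bsub>A\<^esub> b) \<oplus>\<^bsub>B\<^esub> (f a \<otimes>\<^bsub>B\<^esub> k \<oplus>\<^bsub>B\<^esub> j \<otimes>\<^bsub>B\<^esub> (f b \<oplus>\<^bsub>B\<^esub> k)))"
      using x y by (simp add: f_hom)
    moreover have "f a \<otimes>\<^bsub>B\<^esub> k \<oplus>\<^bsub>B\<^esub> j \<otimes>\<^bsub>B\<^esub> (f b \<oplus>\<^bsub>B\<^esub> k) \<in> J"
      using J.I_l_closed[OF y(2) f_closed[OF x(1)]] J.I_r_closed[OF x(2), of "f b \<oplus>\<^bsub>B\<^esub> k"]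
        f_closed[OF y(1)] J.Icarr[OF y(2)] by (intro J.a_closed) auto
    ultimately show "x \<otimes>\<^bsub>S\<^esub> y \<in> carrier S" using x y amalg_carrierI[of "a \<otimes>\<^bsub>A\<^esub> b"] by simp
  next
    show "\<one>\<^bsub>S\<^esub> \<in> carrier S" using iota_closed[of "\<one>\<^bsub>A\<^esub>"] by (simp add: iota_def f_hom)
  qed (simp_all add: amalg_carrierD A.m_ac B.m_ac prod_eq_iff)
qed (simp add: amalg_carrierD A.l_distr B.l_distr)

sublocale S: cring S by (rule amalg_cring)

lemma iota_hom: "iota f \<in> ring_hom A S"
  by (rule ring_hom_memI) (auto simp: iota_closed, auto simp: iota_def f_hom)

lemma fst_hom: "fst \<in> ring_hom S A"
  by (rule ring_hom_memI) (simp_all add: amalg_carrierD)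

lemma snd_hom: "snd \<in> ring_hom S B"
  by (rule ring_hom_memI) (simp_all add: amalg_carrierD)

abbreviation SA :: "('a, 'a \<times> 'b) module" where "SA \<equiv> module_via S (iota f) (carrier S)"

lemma module_SA: "module A SA"
  by (rule module_module_via[OF A.is_cring amalg_cring iota_hom S.oneideal])

lemma module_J: "module A (module_via B f J)"
  by (rule module_module_via[OF A.is_cring B.is_cring f J.is_ideal])

lemma module_A: "module A (ring_module A)"
  by (rule module_ring_module[OF A.is_cring])

lemma module_map_fst: "module_map A SA (ring_module A) fst"
  by (simp add: module_map_def iota_def amalg_carrierD)

lemma module_map_iota: "module_map A (ring_module A) SA (iota f)"
  using ring_hom_add[OF iota_hom] ring_hom_mult[OF iota_hom]
  by (auto simp: module_map_def iota_closed)

lemma module_map_snd: "module_map A SA (module_via B f J) (\<lambda>x. snd x \<oplus>\<^bsub>B\<^esub> \<ominus>\<^bsub>B\<^esub> f (fst x))"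
  unfolding module_map_def
proof (intro conjI ballI)
  fix x assume "x \<in> carrier SA"
  then obtain a j where x: "a \<in> carrier A" "j \<in> J" "x = (a, f a \<oplus>\<^bsub>B\<^esub> j)" by (auto elim: amalg_carrierE)
  have "f a \<oplus>\<^bsub>B\<^esub> j \<oplus>\<^bsub>B\<^esub> \<ominus>\<^bsub>B\<^esub> f a = j" using f_closed[OF x(1)] J.Icarr[OF x(2)] by algebra
  then show "snd x \<oplus>\<^bsub>B\<^esub> \<ominus>\<^bsub>B\<^esub> f (fst x) \<in> carrier (module_via B f J)" using x by simp
next
  fix x y assume "x \<in> carrier SA" "y \<in> carrier SA"
  then have c: "fst x \<in> carrier A" "fst y \<in> carrier A" "snd x \<in> carrier B" "snd y \<in> carrier B"
    by (simp_all add: amalg_carrierD)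
  have "snd x \<oplus>\<^bsub>B\<^esub> snd y \<oplus>\<^bsub>B\<^esub> \<ominus>\<^bsub>B\<^esub> (f (fst x) \<oplus>\<^bsub>B\<^esub> f (fst y)) =
      (snd x \<oplus>\<^bsub>B\<^esub> \<ominus>\<^bsub>B\<^esub> f (fst x)) \<oplus>\<^bsub>B\<^esub> (snd y \<oplus>\<^bsub>B\<^esub> \<ominus>\<^bsub>B\<^esub> f (fst y))"
    using f_closed[OF c(1)] f_closed[OF c(2)] c(3,4) by algebra
  then show "snd (x \<oplus>\<^bsub>SA\<^esub> y) \<oplus>\<^bsub>B\<^esub> \<ominus>\<^bsub>B\<^esub> f (fst (x \<oplus>\<^bsub>SA\<^esub> y)) =
      (snd x \<oplus>\<^bsub>B\<^esub> \<ominus>\<^bsub>B\<^esub> f (fst x)) \<oplus>\<^bsub>module_via B f J\<^esub> (snd y \<oplus>\<^bsub>B\<^esub> \<ominus>\<^bsub>B\<^esub> f (fst y))"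
    using c by (simp add: f_hom)
next
  fix a x assume a: "a \<in> carrier A" and "x \<in> carrier SA"
  then have c: "fst x \<in> carrier A" "snd x \<in> carrier B" by (simp_all add: amalg_carrierD)
  have "f a \<otimes>\<^bsub>B\<^esub> snd x \<oplus>\<^bsub>B\<^esub> \<ominus>\<^bsub>B\<^esub> (f a \<otimes>\<^bsub>B\<^esub> f (fst x)) = f a \<otimes>\<^bsub>B\<^esub> (snd x \<oplus>\<^bsub>B\<^esub> \<ominus>\<^bsub>B\<^esub> f (fst x))"
    using f_closed[OF c(1)] f_closed[OF a] c(2) by algebra
  then show "snd (a \<odot>\<^bsub>SA\<^esub> x) \<oplus>\<^bsub>B\<^esub> \<ominus>\<^bsub>B\<^esub> f (fst (a \<odot>\<^bsub>SA\<^esub> x)) =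
      a \<odot>\<^bsub>module_via B f J\<^esub> (snd x \<oplus>\<^bsub>B\<^esub> \<ominus>\<^bsub>B\<^esub> f (fst x))"
    using a c by (simp add: iota_def f_hom)
qed

lemma module_map_0J: "module_map A (module_via B f J) SA (\<lambda>j. (\<zero>\<^bsub>A\<^esub>, j))"
  by (auto simp: module_map_def amalg_carrier_0J iota_def)

text \<open>After restriction of scalars along \<open>iota f\<close>, both \<open>A\<close> and
  \<open>J\<close> are retracts of the amalgamation, and it is their direct sum.\<close>

lemma kacyclic_amalg_iff:
  assumes xs: "set xs \<subseteq> carrier A"
  shows "kacyclic (ring_module S) {\<one>\<^bsub>S\<^esub>} (nth (map (iota f) xs)) {..<length (map (iota f) xs)} n \<longleftrightarrow>
    kacyclic (ring_module A) {\<one>\<^bsub>A\<^esub>} (nth xs) {..<length xs} n \<and>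
    kacyclic (module_via B f J) {\<one>\<^bsub>A\<^esub>} (nth xs) {..<length xs} n"
proof -
  let ?I = "{..<length xs}"
  have xc: "nth xs ` ?I \<subseteq> carrier A" using xs by auto
  have yc: "nth (map (iota f) xs) ` ?I \<subseteq> carrier S" 
  proof
    fix y assume "y \<in> nth (map (iota f) xs) ` ?I"
    then obtain t where t: "t < length xs" "y = iota f (xs ! t)" by auto
    then have "xs ! t \<in> carrier A" using xs nth_mem by blast
    then show "y \<in> carrier S" using t iota_closed by simp
  qed
  interpret SM: module S "ring_module S" by (rule module_ring_module[OF amalg_cring])
  have one: "iota f ` {\<one>\<^bsub>A\<^esub>} = {\<one>\<^bsub>S\<^esub>}" using ring_hom_one[OF iota_hom] by simp
  have oS: "{\<one>\<^bsub>S\<^esub>} \<subseteq> carrier S" by (rule subsetI) (simp only: singleton_iff S.one_closed)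
  \<comment> \<open>The list of images and the composed function agree only at positions below the
    length, hence the congruence in place of rewriting.\<close>
  have "kacyclic (ring_module S) {\<one>\<^bsub>S\<^esub>} (nth (map (iota f) xs)) ?I n \<longleftrightarrow>
      kacyclic (ring_module S) {\<one>\<^bsub>S\<^esub>} (\<lambda>t. iota f (xs ! t)) ?I n"
    by (rule SM.kacyclic_cong[OF _ yc _ oS]) simp_all
  also have "\<dots> \<longleftrightarrow> kacyclic SA {\<one>\<^bsub>A\<^esub>} (nth xs) ?I n"
    unfolding kacyclic_module_via_carrier one ..
  also have "\<dots> \<longleftrightarrow> kacyclic (ring_module A) {\<one>\<^bsub>A\<^esub>} (nth xs) ?I n \<and> kacyclic (module_via B f J) {\<one>\<^bsub>A\<^esub>} (nth xs) ?I n"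
  proof (intro iffI conjI)
    assume ac: "kacyclic SA {\<one>\<^bsub>A\<^esub>} (nth xs) ?I n"
    show "kacyclic (ring_module A) {\<one>\<^bsub>A\<^esub>} (nth xs) ?I n"
      by (rule kacyclic_retract[OF module_SA module_A module_map_fst module_map_iota _ xc _ _ ac])
        (auto simp: iota_def)
    show "kacyclic (module_via B f J) {\<one>\<^bsub>A\<^esub>} (nth xs) ?I n"
      by (rule kacyclic_retract[OF module_SA module_J module_map_snd module_map_0J _ xc _ _ ac])
        (auto simp: f_hom J.Icarr)
  next
    assume ac: "kacyclic (ring_module A) {\<one>\<^bsub>A\<^esub>} (nth xs) ?I n \<and> kacyclic (module_via B f J) {\<one>\<^bsub>A\<^esub>} (nth xs) ?I n"
    show "kacyclic SA {\<one>\<^bsub>A\<^esub>} (nth xs) ?I n"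
    proof (rule kacyclic_direct_sum[OF module_SA module_A module_J module_map_fst module_map_snd
          module_map_iota module_map_0J _ xc _ conjunct1[OF ac] conjunct2[OF ac]])
      fix x assume "x \<in> carrier SA"
      then obtain a j where x: "a \<in> carrier A" "j \<in> J" "x = (a, f a \<oplus>\<^bsub>B\<^esub> j)" by (auto elim: amalg_carrierE)
      have "f a \<oplus>\<^bsub>B\<^esub> (f a \<oplus>\<^bsub>B\<^esub> j \<oplus>\<^bsub>B\<^esub> \<ominus>\<^bsub>B\<^esub> f a) = f a \<oplus>\<^bsub>B\<^esub> j"
        using f_closed[OF x(1)] J.Icarr[OF x(2)] by algebra
      then show "iota f (fst x) \<oplus>\<^bsub>SA\<^esub> (\<zero>\<^bsub>A\<^esub>, snd x \<oplus>\<^bsub>B\<^esub> \<ominus>\<^bsub>B\<^esub> f (fst x)) = x"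
        using x by (simp add: iota_def)
    qed simp
  qed
  finally show ?thesis by simp
qed

lemma iota_image_carrier: "ideal \<aa> A \<Longrightarrow> iota f ` \<aa> \<subseteq> carrier S"
  using iota_closed ideal.Icarr[of \<aa> A] by auto

lemma ideal_ext_ideal: "ideal \<aa> A \<Longrightarrow> ideal (ext_ideal A B f J \<aa>) S"
  unfolding ext_ideal_def by (intro S.genideal_ideal iota_image_carrier)

text \<open>From left to right, a sequence in the extended ideal is replaced by images of finitely
  many elements of \<open>\<aa>\<close>. From right to left, the sequences good for \<open>A\<close>
  and for \<open>J\<close> may differ, and their concatenation serves both modules.\<close>

lemma Kgrade_ext_ideal_ge_iff:
  assumes \<aa>: "ideal \<aa> A"
  shows "enat n \<le> Kgrade S (ring_module S) (ext_ideal A B f J \<aa>) \<longleftrightarrow>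
    enat n \<le> Kgrade A (ring_module A) \<aa> \<and> enat n \<le> Kgrade A (module_via B f J) \<aa>"
proof -
  interpret SM: module S "ring_module S" by (rule module_ring_module[OF amalg_cring])
  note gS = Kgrade_ge_iff[OF module_ring_module[OF amalg_cring] ideal_ext_ideal[OF \<aa>]]
    and gA = Kgrade_ge_iff[OF module_A \<aa>] and gJ = Kgrade_ge_iff[OF module_J \<aa>]
  have ac: "\<aa> \<subseteq> carrier A" using ideal.Icarr[OF \<aa>] by (rule subsetI)
  note ic = iota_image_carrier[OF \<aa>]
  show ?thesis
  proof
    assume "enat n \<le> Kgrade S (ring_module S) (ext_ideal A B f J \<aa>)"
    then obtain zs where zs: "set zs \<subseteq> ext_ideal A B f J \<aa>"
      "kacyclic (ring_module S) {\<one>\<^bsub>S\<^esub>} (nth zs) {..<length zs} n" using gS by blast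
    obtain Y where Y: "finite Y" "Y \<subseteq> iota f ` \<aa>" "set zs \<subseteq> Idl\<^bsub>S\<^esub> Y"
      using S.genideal_finitely_supported[OF ic, of "set zs"] zs(1) by (auto simp: ext_ideal_def)
    obtain C where C: "C \<subseteq> \<aa>" "finite C" "Y = iota f ` C" using finite_subset_image[OF Y(1,2)] by auto
    obtain ys where ys: "set ys = C" using finite_list[OF C(2)] by blast
    have yc: "set ys \<subseteq> carrier A" using ys C ac by blast
    have m: "set (map (iota f) ys) \<subseteq> carrier S" using ys C Y(2) ic by auto
    have zc: "set zs \<subseteq> carrier S" using zs(1) ideal.Icarr[OF ideal_ext_ideal[OF \<aa>]] by blast
    have "kacyclic (ring_module S) {\<one>\<^bsub>S\<^esub>} (nth (map (iota f) ys)) {..<length (map (iota f) ys)} n"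
      by (rule SM.kacyclic_ideal_mono[OF zc m _ S.mult_set_one zs(2)]) (use Y C ys in simp)
    then show "enat n \<le> Kgrade A (ring_module A) \<aa> \<and> enat n \<le> Kgrade A (module_via B f J) \<aa>"
      unfolding kacyclic_amalg_iff[OF yc] gA gJ using ys C by blast
  next
    assume "enat n \<le> Kgrade A (ring_module A) \<aa> \<and> enat n \<le> Kgrade A (module_via B f J) \<aa>"
    then obtain xs ys where xs: "set xs \<subseteq> \<aa>" "kacyclic (ring_module A) {\<one>\<^bsub>A\<^esub>} (nth xs) {..<length xs} n"
      and ys: "set ys \<subseteq> \<aa>" "kacyclic (module_via B f J) {\<one>\<^bsub>A\<^esub>} (nth ys) {..<length ys} n"
      unfolding gA gJ by blast
    let ?zs = "xs @ ys"
    have c: "set xs \<subseteq> carrier A" "set ys \<subseteq> carrier A" "set ?zs \<subseteq> carrier A" using xs ys ac by auto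
    have sub: "set xs \<subseteq> Idl\<^bsub>A\<^esub> (set ?zs)" "set ys \<subseteq> Idl\<^bsub>A\<^esub> (set ?zs)"
      using A.genideal_self[OF c(3)] by auto
    have "kacyclic (ring_module A) {\<one>\<^bsub>A\<^esub>} (nth ?zs) {..<length ?zs} n"
      by (rule module.kacyclic_ideal_mono[OF module_A c(1,3) sub(1) A.mult_set_one xs(2)])
    moreover have "kacyclic (module_via B f J) {\<one>\<^bsub>A\<^esub>} (nth ?zs) {..<length ?zs} n"
      by (rule module.kacyclic_ideal_mono[OF module_J c(2,3) sub(2) A.mult_set_one ys(2)])
    ultimately have "kacyclic (ring_module S) {\<one>\<^bsub>S\<^esub>} (nth (map (iota f) ?zs)) {..<length (map (iota f) ?zs)} n"
      unfolding kacyclic_amalg_iff[OF c(3)] by simp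
    moreover have "set (map (iota f) ?zs) \<subseteq> ext_ideal A B f J \<aa>"
      using S.genideal_self[OF ic] xs(1) ys(1) unfolding ext_ideal_def by auto
    ultimately show "enat n \<le> Kgrade S (ring_module S) (ext_ideal A B f J \<aa>)" unfolding gS by blast
  qed
qed

text \<open>A prime of the amalgamation either contains \<open>0 \<times> J\<close>, and is then pulled back from \<open>A\<close>,
  or misses some \<open>(0, j)\<close>, and is then pulled back from the prime \<open>{b. (0, b j) \<in> Q}\<close> of \<open>B\<close>.\<close>

lemma prime_of_amalg_from_B:
  assumes Q: "primeideal Q S" and j: "j \<in> J" "(\<zero>\<^bsub>A\<^esub>, j) \<notin> Q"
  shows "\<exists>q. primeideal q B \<and> contract S snd q = Q"
proof (intro exI conjI)
  interpret Q: primeideal Q S by fact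
  let ?q = "{b \<in> carrier B. (\<zero>\<^bsub>A\<^esub>, b \<otimes>\<^bsub>B\<^esub> j) \<in> Q}"
  have jc: "j \<in> carrier B" using j J.Icarr by blast
  have jS: "(\<zero>\<^bsub>A\<^esub>, j) \<in> carrier S" using amalg_carrier_0J[OF j(1)] .
  have bS: "(\<zero>\<^bsub>A\<^esub>, b \<otimes>\<^bsub>B\<^esub> j) \<in> carrier S" if "b \<in> carrier B" for b
    using J.I_l_closed[OF j(1) that] by (rule amalg_carrier_0J)
  have mulc: "(\<zero>\<^bsub>A\<^esub>, (b \<otimes>\<^bsub>B\<^esub> c) \<otimes>\<^bsub>B\<^esub> j) \<in> Q" if "b \<in> ?q" "c \<in> carrier B" for b c
  proof -
    have bc: "b \<in> carrier B" using that by simp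
    have "(\<zero>\<^bsub>A\<^esub>, (b \<otimes>\<^bsub>B\<^esub> c) \<otimes>\<^bsub>B\<^esub> j) \<otimes>\<^bsub>S\<^esub> (\<zero>\<^bsub>A\<^esub>, j) = (\<zero>\<^bsub>A\<^esub>, b \<otimes>\<^bsub>B\<^esub> j) \<otimes>\<^bsub>S\<^esub> (\<zero>\<^bsub>A\<^esub>, c \<otimes>\<^bsub>B\<^esub> j)"
      using bc that(2) jc by (simp add: B.m_ac)
    also have "\<dots> \<in> Q" using that bS[OF that(2)] Q.I_r_closed by blast
    finally show ?thesis using Q.I_prime[OF bS jS] j(2) bc that(2) by blast
  qed
  show "primeideal ?q B"
  proof (rule primeidealI)
    show "cring B" by (rule B.is_cring)
    show "ideal ?q B"
    proof (rule idealI)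
      show "ring B" by (rule B.ring_axioms)
      show "subgroup ?q (add_monoid B)"
      proof (rule B.add.subgroupI)
        show "?q \<subseteq> carrier B" by blast
        have "\<zero>\<^bsub>B\<^esub> \<in> ?q" using Q.zero_closed jc by simp
        then show "?q \<noteq> {}" by blast
        show "\<ominus>\<^bsub>B\<^esub> b \<in> ?q" if "b \<in> ?q" for b
          using mulc[OF that, of "\<ominus>\<^bsub>B\<^esub> \<one>\<^bsub>B\<^esub>"] that by (simp add: B.r_minus)
        show "b \<oplus>\<^bsub>B\<^esub> c \<in> ?q" if bc: "b \<in> ?q" "c \<in> ?q" for b c
        proof -
          have "(\<zero>\<^bsub>A\<^esub>, b \<otimes>\<^bsub>B\<^esub> j) \<oplus>\<^bsub>S\<^esub> (\<zero>\<^bsub>A\<^esub>, c \<otimes>\<^bsub>B\<^esub> j) \<in> Q" using bc by (intro Q.a_closed) simp_all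
          then show ?thesis using bc jc by (simp add: B.l_distr)
        qed
      qed
      show "c \<otimes>\<^bsub>B\<^esub> b \<in> ?q" if "b \<in> ?q" "c \<in> carrier B" for b c
        using mulc[OF that] that by (simp add: B.m_comm)
      show "b \<otimes>\<^bsub>B\<^esub> c \<in> ?q" if "b \<in> ?q" "c \<in> carrier B" for b c
        using mulc[OF that] that by simp
    qed
    have "\<one>\<^bsub>B\<^esub> \<notin> ?q" using j(2) jc by simp
    then show "carrier B \<noteq> ?q" using B.one_closed by metis
    fix b c assume bc: "b \<in> carrier B" "c \<in> carrier B" "b \<otimes>\<^bsub>B\<^esub> c \<in> ?q"
    have "(\<zero>\<^bsub>A\<^esub>, b \<otimes>\<^bsub>B\<^esub> j) \<otimes>\<^bsub>S\<^esub> (\<zero>\<^bsub>A\<^esub>, c \<otimes>\<^bsub>B\<^esub> j) = (\<zero>\<^bsub>A\<^esub>, (b \<otimes>\<^bsub>B\<^esub> c) \<otimes>\<^bsub>B\<^esub> j) \<otimes>\<^bsub>S\<^esub> (\<zero>\<^bsub>A\<^esub>, j)"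
      using bc(1,2) jc by (simp add: B.m_ac)
    also have "\<dots> \<in> Q" using bc(3) jS Q.I_r_closed by blast
    finally have "(\<zero>\<^bsub>A\<^esub>, b \<otimes>\<^bsub>B\<^esub> j) \<in> Q \<or> (\<zero>\<^bsub>A\<^esub>, c \<otimes>\<^bsub>B\<^esub> j) \<in> Q"
      by (rule Q.I_prime[OF bS[OF bc(1)] bS[OF bc(2)]])
    then show "b \<in> ?q \<or> c \<in> ?q" using bc(1,2) by simp
  qed
  have "snd x \<in> ?q \<longleftrightarrow> x \<in> Q" if x: "x \<in> carrier S" for x
  proof -
    have "x \<otimes>\<^bsub>S\<^esub> (\<zero>\<^bsub>A\<^esub>, j) = (\<zero>\<^bsub>A\<^esub>, snd x \<otimes>\<^bsub>B\<^esub> j)" using amalg_carrierD[OF x] by simp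
    then have "snd x \<in> ?q \<longleftrightarrow> x \<otimes>\<^bsub>S\<^esub> (\<zero>\<^bsub>A\<^esub>, j) \<in> Q" using amalg_carrierD[OF x] by simp
    also have "\<dots> \<longleftrightarrow> x \<in> Q" using Q.I_prime[OF x jS] j(2) Q.I_r_closed[OF _ jS] by blast
    finally show ?thesis .
  qed
  then show "contract S snd ?q = Q" using Q.Icarr by blast
qed

lemma going_down_iota:
  assumes gd: "going_down A B f"
  shows "going_down A S (iota f)"
  unfolding going_down_def
proof (intro allI impI)
  fix p' p Q
  assume *: "primeideal p' A \<and> primeideal p A \<and> p' \<subseteq> p \<and> primeideal Q S \<and> contract A (iota f) Q = p"
  then interpret Q: primeideal Q S by simp
  interpret p': primeideal p' A using * by simp
  show "\<exists>Q'. primeideal Q' S \<and> Q' \<subseteq> Q \<and> contract A (iota f) Q' = p'"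
  proof (cases "\<forall>j\<in>J. (\<zero>\<^bsub>A\<^esub>, j) \<in> Q")
    case True
    let ?Q = "contract S fst p'"
    have "primeideal ?Q S" using * by (intro primeideal_contract[OF amalg_cring A.is_cring fst_hom]) simp
    moreover have "?Q \<subseteq> Q"
    proof
      fix x assume x: "x \<in> ?Q"
      then obtain a j where a: "a \<in> carrier A" "j \<in> J" "x = (a, f a \<oplus>\<^bsub>B\<^esub> j)" by (auto elim: amalg_carrierE)
      have "a \<in> p" using x a * by auto
      then have "iota f a \<in> Q" using * by auto
      then have "iota f a \<oplus>\<^bsub>S\<^esub> (\<zero>\<^bsub>A\<^esub>, j) \<in> Q" using True a(2) by (intro Q.a_closed) simp_all
      then show "x \<in> Q" using a by (simp add: iota_def)
    qed
    moreover have "contract A (iota f) ?Q = p'"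
    proof
      show "contract A (iota f) ?Q \<subseteq> p'" by (auto simp: iota_def)
      show "p' \<subseteq> contract A (iota f) ?Q" using iota_closed p'.Icarr by (auto simp: iota_def)
    qed
    ultimately show ?thesis by blast
  next
    case False
    then obtain j where j: "j \<in> J" "(\<zero>\<^bsub>A\<^esub>, j) \<notin> Q" by blast
    obtain q where q: "primeideal q B" "contract S snd q = Q"
      using prime_of_amalg_from_B[OF Q.primeideal j] by blast
    \<comment> \<open>The composite of \<open>iota f\<close> with \<open>snd\<close> is
      \<open>f\<close>, so going-down for \<open>f\<close> applies to \<open>q\<close> and its
      result can be pulled back.\<close>
    have c: "contract A (iota f) (contract S snd q) = contract A f q" for q
      using iota_closed by (auto simp: iota_def)
    have "contract A f q = p" using * q(2) c[of q] by simp
    then obtain q' where q': "primeideal q' B" "q' \<subseteq> q" "contract A f q' = p'"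
      using gd[unfolded going_down_def, rule_format, of p' p q] * q(1) by auto
    have "primeideal (contract S snd q') S"
      by (rule primeideal_contract[OF amalg_cring B.is_cring snd_hom q'(1)])
    moreover have "contract S snd q' \<subseteq> Q" using q'(2) q(2) by blast
    ultimately show ?thesis using c[of q'] q'(3) by blast
  qed
qed

end

theorem theorem4p11:
  fixes A :: "'a ring" and B :: "'b ring" and f :: "'a \<Rightarrow> 'b" and J :: "'b set"
  assumes "cring A" and "cring B" and "f \<in> ring_hom A B" and "ideal J B"
  shows "(\<forall>\<A>. \<A> \<noteq> {} \<and> (\<forall>\<aa>\<in>\<A>. ideal \<aa> A) \<and> going_down A B f \<and>
            CM_sense (amalg A B f J) (ext_ideal A B f J ` \<A>) \<longrightarrow>
            CM_sense A \<A> \<and> (\<forall>\<aa>\<in>\<A>. ht A \<aa> \<le> Kgrade A (module_via B f J) \<aa>))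
       \<and> (integral_extension A (amalg A B f J) (iota f) \<and> CM_sense A (all_ideals A) \<and>
            (\<forall>\<aa>. ideal \<aa> A \<longrightarrow> ht A \<aa> \<le> Kgrade A (module_via B f J) \<aa>) \<longrightarrow>
            CM_sense (amalg A B f J) (all_ideals (amalg A B f J)))"
proof -
  interpret amalgamation A B f J
    using assms by (simp add: amalgamation_def amalgamation_axioms_def)
  have descent: "CM_sense A \<A> \<and> (\<forall>\<aa>\<in>\<A>. ht A \<aa> \<le> Kgrade A (module_via B f J) \<aa>)"
    if id: "\<forall>\<aa>\<in>\<A>. ideal \<aa> A" and gd: "going_down A B f" and cm: "CM_sense S (ext_ideal A B f J ` \<A>)" for \<A>
  proof -
    have ge: "ht A \<aa> \<le> Kgrade A (ring_module A) \<aa> \<and> ht A \<aa> \<le> Kgrade A (module_via B f J) \<aa>"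
      if mem: "\<aa> \<in> \<A>" for \<aa>
    proof -
      have \<aa>: "ideal \<aa> A" using id mem by blast
      have "ht A \<aa> \<le> ht S (ext_ideal A B f J \<aa>)"
        unfolding ext_ideal_def
        by (rule ht_le_going_down[OF assms(1) amalg_cring iota_hom going_down_iota[OF gd] \<aa>])
      also have "\<dots> = Kgrade S (ring_module S) (ext_ideal A B f J \<aa>)"
        using cm mem unfolding CM_sense_def by simp
      finally have "ht A \<aa> \<le> Kgrade S (ring_module S) (ext_ideal A B f J \<aa>)" .
      \<comment> \<open>The height may be infinite, so the bound is passed on to the two modules
        through its finite parts.\<close>
      then have "enat n \<le> Kgrade A (ring_module A) \<aa> \<and> enat n \<le> Kgrade A (module_via B f J) \<aa>"
        if "enat n \<le> ht A \<aa>" for n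
        using Kgrade_ext_ideal_ge_iff[OF \<aa>, of n] order.trans[OF that] by simp
      then show ?thesis by (simp add: enat_leI)
    qed
    have "ht A \<aa> = Kgrade A (ring_module A) \<aa>" if "\<aa> \<in> \<A>" for \<aa>
      using ge[OF that] Kgrade_le_ht[OF assms(1)] id that by (simp add: antisym)
    then show ?thesis using ge unfolding CM_sense_def by simp
  qed
  have ascent: "CM_sense S (all_ideals S)"
    if ext: "integral_extension A S (iota f)" and cm: "CM_sense A (all_ideals A)"
      and J: "\<forall>\<aa>. ideal \<aa> A \<longrightarrow> ht A \<aa> \<le> Kgrade A (module_via B f J) \<aa>"
    unfolding CM_sense_def
  proof
    fix I assume "I \<in> all_ideals S"
    then have I: "ideal I S" by (simp add: all_ideals_def)
    let ?a = "contract A (iota f) I"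
    have int: "integral_over A S (iota f) x" if "x \<in> carrier S" for x
      using ext that unfolding integral_extension_def by simp
    have a: "ideal ?a A"
      by (rule ring_hom_ring.ideal_vimage[OF ring_hom_ringI2[OF A.ring_axioms S.ring_axioms iota_hom] I])
    \<comment> \<open>The hypotheses on \<open>A\<close> only speak of extended ideals upstairs. The
      extension of the contraction is the one inside \<open>I\<close>, and enlarging an ideal can
      only raise the grade.\<close>
    have sub: "ext_ideal A B f J ?a \<subseteq> I"
      unfolding ext_ideal_def using I by (intro S.genideal_minimal) auto
    have eq: "ht A ?a = Kgrade A (ring_module A) ?a" and le: "ht A ?a \<le> Kgrade A (module_via B f J) ?a"
      using cm J a unfolding CM_sense_def all_ideals_def by simp_all
    have "ht S I \<le> ht A ?a" by (rule ht_le_ht_contract[OF assms(1) amalg_cring iota_hom int I])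
    also have "\<dots> \<le> Kgrade S (ring_module S) (ext_ideal A B f J ?a)"
    proof (rule enat_leI)
      fix n assume n: "enat n \<le> ht A ?a"
      show "enat n \<le> Kgrade S (ring_module S) (ext_ideal A B f J ?a)"
        unfolding Kgrade_ext_ideal_ge_iff[OF a] using n eq order.trans[OF n le] by simp
    qed
    also have "\<dots> \<le> Kgrade S (ring_module S) I" by (rule Kgrade_mono[OF sub])
    finally show "ht S I = Kgrade S (ring_module S) I"
      using Kgrade_le_ht[OF amalg_cring I] by (rule antisym)
  qed
  show ?thesis
    by (rule conjI; intro allI impI; elim conjE) (rule descent ascent; assumption)+
qed

end
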